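(* Let $I$ be a nonzero principal ideal. Then the following are equivalent. (i) $I$ is am-stable. (ii) ${}_aI$ is nonzero and am-stable. (ii$'$) $I^o$ is nonzero and am-stable. (ii$''$) $I_-$ is nonzero and am-stable. (iii) $I^{oo}$ is am-stable. (iv) $I_a$ is am-stable. (iv$'$) $I^-$ is am-stable.
   Context: $H$ is a separable infinite-dimensional complex Hilbert space. "Ideal" means a two-sided ideal of $B(H)$ contained in the compact operators. $c_o^*$ is the set of nonnegative monotone nonincreasing sequences converging to $0$. $\Sigma(I):=\{s(X)\mid X\in I\}\subset c_o^*$, where $s(X)$ is the sequence of s-numbers (singular values) of $X$; $I\mapsto\Sigma(I)$ is an inclusion-preserving bijection between ideals and the hereditary (solid) subcones of $c_o^*$ invariant under the ampliations $D_m$, $(D_m\xi)_n:=\xi_{\lceil n/m\rceil}$, $m\in\mathbb N$. A principal ideal is one generated by a single operator. For $\xi\in c_o^*$ put $(\xi_a)_n:=\frac1n\sum_{j=1}^n\xi_j$. For an ideal $I$: ${}_aI$ is the ideal with $\Sigma({}_aI)=\{\xi\in c_o^*\mid\xi_a\in\Sigma(I)\}$; $I_a$ is the ideal with $\Sigma(I_a)=\{\xi\in c_o^*\mid\xi=O(\eta_a)\text{ for some }\eta\in\Sigma(I)\}$; $I^-:={}_a(I_a)$ (am-closure); $I^o:=({}_aI)_a$ (am-interior). $I$ is am-closed if $I=I^-$ and am-open if $I=I^o$. $I_-$ is the largest am-closed ideal contained in $I$ (possibly $\{0\}$) and $I^{oo}$ is the smallest am-open ideal containing $I$. $I$ is am-stable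 if $I={}_aI$ (equivalently, $I=I_a$). *)

theory Defs
  imports "HOL-Analysis.Analysis"
begin

section \<open>Complex Hilbert spaces\<close>

text \<open>
  The real structure inherited from \<open>real_inner\<close> is the underlying real inner product space:
  its inner product is the real part of the complex one, so positive definiteness and
  \<open>norm x = sqrt (Re (cinner x x))\<close> come from \<open>real_inner\<close>.
\<close>

class complex_inner = real_inner +
  fixes scaleC :: "complex \<Rightarrow> 'a \<Rightarrow> 'a" (infixr "*\<^sub>C" 75)
    and cinner :: "'a \<Rightarrow> 'a \<Rightarrow> complex"
  assumes scaleC_add_right: "c *\<^sub>C (x + y) = c *\<^sub>C x + c *\<^sub>C y"
    and scaleC_add_left: "(c + d) *\<^sub>C x = c *\<^sub>C x + d *\<^sub>C x"
    and scaleC_scaleC: "c *\<^sub>C d *\<^sub>C x = (c * d) *\<^sub>C x"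
    and scaleC_one: "1 *\<^sub>C x = x"
    and scaleR_scaleC: "r *\<^sub>R x = complex_of_real r *\<^sub>C x"
    and cinner_commute: "cinner x y = cnj (cinner y x)"
    and cinner_add_left: "cinner (x + y) z = cinner x z + cinner y z"
    and cinner_scaleC_left: "cinner (c *\<^sub>C x) y = c * cinner x y"
    and inner_eq_Re_cinner: "x \<bullet> y = Re (cinner x y)"

class complex_hilbert_space = complex_inner + complete_space

interpretation complex_vec: vector_space "scaleC :: complex \<Rightarrow> 'a::complex_inner \<Rightarrow> 'a"
  by standard (simp_all add: scaleC_add_right scaleC_add_left scaleC_scaleC scaleC_one)

definition separable_space_type :: "'a::topological_space itself \<Rightarrow> bool" where
  "separable_space_type _ \<longleftrightarrow> (\<exists>D::'a set. countable D \<and> closure D = UNIV)"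

definition infinite_dimensional :: "'a::complex_inner itself \<Rightarrow> bool" where
  "infinite_dimensional _ \<longleftrightarrow> \<not> (\<exists>B::'a set. finite B \<and> complex_vec.span B = UNIV)"


section \<open>Bounded and compact operators, operator ideals\<close>

text \<open>
  \<open>'a \<Rightarrow>\<^sub>L 'a\<close> consists of the bounded real-linear maps; \<open>B(H)\<close> is its complex-linear part.
\<close>

definition bounded_ops :: "('a::complex_hilbert_space \<Rightarrow>\<^sub>L 'a) set" where
  "bounded_ops = {X. \<forall>c x. blinfun_apply X (c *\<^sub>C x) = c *\<^sub>C blinfun_apply X x}"

definition compact_ops :: "('a::complex_hilbert_space \<Rightarrow>\<^sub>L 'a) set" where
  "compact_ops = {X \<in> bounded_ops. compact (closure (blinfun_apply X ` cball 0 1))}"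

definition op_adjoint :: "('a::complex_hilbert_space \<Rightarrow>\<^sub>L 'a) \<Rightarrow> 'a \<Rightarrow>\<^sub>L 'a" where
  "op_adjoint X = (THE Y. Y \<in> bounded_ops \<and>
     (\<forall>x y. cinner (blinfun_apply X x) y = cinner x (blinfun_apply Y y)))"

definition op_ideal :: "('a::complex_hilbert_space \<Rightarrow>\<^sub>L 'a) set \<Rightarrow> bool" where
  "op_ideal J \<longleftrightarrow> J \<subseteq> compact_ops \<and> 0 \<in> J \<and>
     (\<forall>X\<in>J. \<forall>Y\<in>J. X + Y \<in> J) \<and>
     (\<forall>X\<in>J. \<forall>A\<in>bounded_ops. A o\<^sub>L X \<in> J \<and> X o\<^sub>L A \<in> J)"

definition principal_ideal :: "('a::complex_hilbert_space \<Rightarrow>\<^sub>L 'a) set \<Rightarrow> bool" where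
  "principal_ideal I \<longleftrightarrow> (\<exists>X\<in>compact_ops. I = \<Inter>{J. op_ideal J \<and> X \<in> J})"


section \<open>Characteristic sets\<close>

text \<open>
  Sequences are indexed from 0, so \<open>\<xi> n\<close> stands for the \<open>(n+1)\<close>-st term.
\<close>

definition c0_star :: "(nat \<Rightarrow> real) set" where
  "c0_star = {\<xi>. (\<forall>n. 0 \<le> \<xi> n) \<and> decseq \<xi> \<and> \<xi> \<longlonglongrightarrow> 0}"

text \<open>
  The singular values of \<open>X\<close> are the square roots of the eigenvalues of \<open>X\<^sup>* X\<close>,
  in nonincreasing order and repeated according to multiplicity, followed by zeros when there
  are only finitely many positive ones. A member of \<open>c0_star\<close> is determined by how often it
  takes each positive value.
\<close>

definition s_numbers :: "('a::complex_hilbert_space \<Rightarrow>\<^sub>L 'a) \<Rightarrow> nat \<Rightarrow> real" where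
  "s_numbers X = (THE \<xi>. \<xi> \<in> c0_star \<and>
     (\<forall>t>0. card {n. \<xi> n = t} =
        complex_vec.dim {x. blinfun_apply (op_adjoint X o\<^sub>L X) x = complex_of_real (t\<^sup>2) *\<^sub>C x}))"

definition char_set :: "('a::complex_hilbert_space \<Rightarrow>\<^sub>L 'a) set \<Rightarrow> (nat \<Rightarrow> real) set" where
  "char_set I = s_numbers ` I"

definition arith_mean :: "(nat \<Rightarrow> real) \<Rightarrow> nat \<Rightarrow> real" where
  "arith_mean \<xi> n = (\<Sum>j\<le>n. \<xi> j) / real (Suc n)"

definition ideal_with_char_set :: "(nat \<Rightarrow> real) set \<Rightarrow> ('a::complex_hilbert_space \<Rightarrow>\<^sub>L 'a) set" where
  "ideal_with_char_set S = (THE J. op_ideal J \<and> char_set J = S)"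


section \<open>Arithmetic mean ideals\<close>

definition pre_am :: "('a::complex_hilbert_space \<Rightarrow>\<^sub>L 'a) set \<Rightarrow> ('a \<Rightarrow>\<^sub>L 'a) set" where
  "pre_am I = ideal_with_char_set {\<xi> \<in> c0_star. arith_mean \<xi> \<in> char_set I}"

text \<open>
  The bound in \<open>\<xi> = O(\<eta>\<^sub>a)\<close> is required at every index. As \<open>\<eta>\<^sub>a\<close> is everywhere positive for
  \<open>\<eta> \<noteq> 0\<close>, this differs from the eventual bound only for \<open>\<eta> = 0\<close>, where it keeps the
  arithmetic mean of the zero ideal equal to zero.
\<close>

definition am :: "('a::complex_hilbert_space \<Rightarrow>\<^sub>L 'a) set \<Rightarrow> ('a \<Rightarrow>\<^sub>L 'a) set" where
  "am I = ideal_with_char_set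
     {\<xi> \<in> c0_star. \<exists>\<eta>\<in>char_set I. \<exists>C. \<forall>n. \<xi> n \<le> C * arith_mean \<eta> n}"

definition am_closure :: "('a::complex_hilbert_space \<Rightarrow>\<^sub>L 'a) set \<Rightarrow> ('a \<Rightarrow>\<^sub>L 'a) set" where
  "am_closure I = pre_am (am I)"

definition am_interior :: "('a::complex_hilbert_space \<Rightarrow>\<^sub>L 'a) set \<Rightarrow> ('a \<Rightarrow>\<^sub>L 'a) set" where
  "am_interior I = am (pre_am I)"

definition am_closed :: "('a::complex_hilbert_space \<Rightarrow>\<^sub>L 'a) set \<Rightarrow> bool" where
  "am_closed I \<longleftrightarrow> I = am_closure I"

definition am_open :: "('a::complex_hilbert_space \<Rightarrow>\<^sub>L 'a) set \<Rightarrow> bool" where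
  "am_open I \<longleftrightarrow> I = am_interior I"

definition am_stable :: "('a::complex_hilbert_space \<Rightarrow>\<^sub>L 'a) set \<Rightarrow> bool" where
  "am_stable I \<longleftrightarrow> I = pre_am I"

definition largest_am_closed :: "('a::complex_hilbert_space \<Rightarrow>\<^sub>L 'a) set \<Rightarrow> ('a \<Rightarrow>\<^sub>L 'a) set" where
  "largest_am_closed I = (GREATEST J. op_ideal J \<and> am_closed J \<and> J \<subseteq> I)"

definition smallest_am_open :: "('a::complex_hilbert_space \<Rightarrow>\<^sub>L 'a) set \<Rightarrow> ('a \<Rightarrow>\<^sub>L 'a) set" where
  "smallest_am_open I = (LEAST J. op_ideal J \<and> am_open J \<and> I \<subseteq> J)"

end

theory Submission imports Defs begin

text \<open>
  Every compact operator has a Schmidt decomposition, found by maximising \<open>norm (X x)\<close> successively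
  on orthogonal complements, and its coefficients are the singular numbers. A min-max bound for
  them yields Calkin's correspondence, which turns the theorem into one about the principal
  characteristic set generated by a sequence \<open>\<eta>\<close>.

  Each of the ideals \<open>am I\<close>, \<open>smallest_am_open I\<close> and \<open>am_interior I\<close> is then generated by
  \<open>g n / n\<close> for a nondecreasing \<open>g\<close>, namely the partial sums of \<open>\<eta>\<close>, \<open>max k \<le> n. k \<eta>\<^sub>k\<close> and
  \<open>inf k \<ge> n. k \<eta>\<^sub>k\<close>. Stability means that \<open>g j / j\<close> summed over \<open>j \<le> n\<close> is \<open>O(g n)\<close>. As
  the harmonic series diverges, this forces \<open>2 g n \<le> g (m n)\<close> for some fixed \<open>m\<close>, and comparing
  \<open>g n\<close> with \<open>g (m n)\<close> shows in each case that the arithmetic mean of \<open>\<eta>\<close> is \<open>O(\<eta>)\<close>, i.e.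
  that \<open>I\<close> is stable. The remaining ideals reduce to these; the largest am-closed
  ideal exists because a sequence majorised by a sum splits into majorised summands.
\<close>

subsection \<open>Complex inner products\<close>

text \<open>The obstacle is ampliation: membership in the principal set of \<eta> only gives a bound
  by a multiple of \<open>\<eta> (n div m)\<close>, and this need not be O(\<eta>). Means and
  envelopes escape it: a quotient \<open>g n / real (Suc n)\<close> with g nondecreasing loses at
  most the factor m between \<open>n div m\<close> and n. So membership in the derived sets becomes
  domination by a multiple of one fixed sequence, and stability becomes a single inequality. The
  forward implications are formal, since a stable set is fixed by all six operations. The condition
  of being nonzero accompanies exactly the operations that shrink I, because the zero ideal is
  stable. There the lower envelope may vanish identically, and doubling says nothing about g = 0.
  Infinite dimension enters through the Schmidt decomposition: both orthonormal systems are indexed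
  by all natural numbers, even for operators of finite rank.\<close>

instance complex_hilbert_space \<subseteq> banach ..

lemma cinner_add_right: "cinner x (y + z) = cinner x y + cinner (x::'a::complex_inner) z"
  by (metis cinner_commute cinner_add_left complex_cnj_add)

lemma cinner_scaleC_right: "cinner x (c *\<^sub>C y) = cnj c * cinner (x::'a::complex_inner) y"
  by (metis cinner_commute cinner_scaleC_left complex_cnj_mult)

lemma cinner_self: "cinner x x = complex_of_real ((norm (x::'a::complex_inner))\<^sup>2)"
proof (rule complex_eqI)
  show "Re (cinner x x) = Re (complex_of_real ((norm x)\<^sup>2))"
    by (simp add: inner_eq_Re_cinner[symmetric] dot_square_norm)
  have "cinner x x = cnj (cinner x x)" by (rule cinner_commute)
  then show "Im (cinner x x) = Im (complex_of_real ((norm x)\<^sup>2))"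
    by (metis Im_complex_of_real Reals_cnj_iff complex_is_Real_iff)
qed

lemma norm_scaleC: "norm (c *\<^sub>C x) = cmod c * norm (x::'a::complex_inner)"
proof -
  have "complex_of_real ((norm (c *\<^sub>C x))\<^sup>2) = (c * cnj c) * complex_of_real ((norm x)\<^sup>2)"
    by (simp only: cinner_self[symmetric] cinner_scaleC_left cinner_scaleC_right mult_ac)
  also have "\<dots> = complex_of_real ((cmod c * norm x)\<^sup>2)"
    by (simp add: complex_norm_square[symmetric] power_mult_distrib)
  finally have "complex_of_real ((norm (c *\<^sub>C x))\<^sup>2) = complex_of_real ((cmod c * norm x)\<^sup>2)" .
  then have "(norm (c *\<^sub>C x))\<^sup>2 = (cmod c * norm x)\<^sup>2"
    using of_real_eq_iff by blast
  then show ?thesis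
    by (simp add: power2_eq_iff_nonneg)
qed

text \<open>The real Cauchy-Schwarz inequality controls only the real part. Rotating
  \<open>x\<close> by the unimodular \<open>c\<close> makes the complex inner product real and
  nonnegative and preserves the norm.\<close>

lemma cinner_norm_le: "cmod (cinner x y) \<le> norm x * norm (y::'a::complex_inner)"
proof -
  define c where "c = (if cinner x y = 0 then 1 else cnj (cinner x y) / cmod (cinner x y))"
  have c: "cmod c = 1" "c * cinner x y = cmod (cinner x y)"
    by (auto simp: c_def norm_divide complex_norm_square[symmetric] power2_eq_square mult.commute)
  have "cmod (cinner x y) = (c *\<^sub>C x) \<bullet> y"
    by (simp add: inner_eq_Re_cinner cinner_scaleC_left c)
  also have "\<dots> \<le> norm (c *\<^sub>C x) * norm y"
    by (rule norm_cauchy_schwarz)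
  finally show ?thesis
    by (simp add: norm_scaleC c)
qed

lemma bounded_bilinear_cinner: "bounded_bilinear (cinner :: 'a::complex_inner \<Rightarrow> _)"
proof
  show "\<exists>K. \<forall>(a::'a) b. cmod (cinner a b) \<le> norm a * norm b * K"
    by (rule exI[of _ 1]) (simp add: cinner_norm_le)
qed (simp_all add: cinner_add_left cinner_add_right scaleR_scaleC cinner_scaleC_left
    cinner_scaleC_right scaleR_conv_of_real)

lemma bounded_bilinear_scaleC: "bounded_bilinear (scaleC :: complex \<Rightarrow> 'a::complex_inner \<Rightarrow> 'a)"
proof
  show "\<exists>K. \<forall>a (b::'a). norm (a *\<^sub>C b) \<le> norm a * norm b * K"
    by (rule exI[of _ 1]) (simp add: norm_scaleC)
qed (simp_all add: scaleC_add_left scaleC_add_right scaleR_scaleC scaleC_scaleC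
    scaleR_conv_of_real mult.commute)

interpretation cinner: bounded_bilinear "cinner :: 'a::complex_inner \<Rightarrow> _"
  by (rule bounded_bilinear_cinner)

interpretation scaleC: bounded_bilinear "scaleC :: complex \<Rightarrow> 'a::complex_inner \<Rightarrow> 'a"
  by (rule bounded_bilinear_scaleC)

lemma cinner_eqI: "(\<And>z. cinner z x = cinner z (y::'a::complex_inner)) \<Longrightarrow> x = y"
proof -
  assume "\<And>z. cinner z x = cinner z y"
  then have "cinner (x - y) (x - y) = 0" by (simp add: cinner.diff_right)
  then show "x = y" by (simp add: cinner_self)
qed

lemma norm_add_sq_orthogonal:
  assumes "cinner x (y::'a::complex_inner) = 0"
  shows "(norm (x + y))\<^sup>2 = (norm x)\<^sup>2 + (norm y)\<^sup>2"
proof -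
  have "cinner y x = 0" using assms cinner_commute[of y x] by simp
  then have "complex_of_real ((norm (x + y))\<^sup>2) = of_real ((norm x)\<^sup>2 + (norm y)\<^sup>2)"
    using assms by (simp only: cinner_self[symmetric] of_real_add cinner.add_left cinner.add_right)
      simp
  then show ?thesis using of_real_eq_iff by blast
qed

subsection \<open>Orthonormal systems\<close>

definition orthonormal_on :: "nat set \<Rightarrow> (nat \<Rightarrow> 'a::complex_inner) \<Rightarrow> bool" where
  "orthonormal_on A e \<longleftrightarrow> (\<forall>i\<in>A. \<forall>j\<in>A. cinner (e i) (e j) = (if i = j then 1 else 0))"

abbreviation orthonormal :: "(nat \<Rightarrow> 'a::complex_inner) \<Rightarrow> bool" where
  "orthonormal \<equiv> orthonormal_on UNIV"

lemma orthonormal_cinner: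
  "orthonormal e \<Longrightarrow> cinner (e i) (e j) = (if i = j then 1 else 0)"
  by (simp add: orthonormal_on_def)

lemma orthonormal_on_norm: "orthonormal_on A e \<Longrightarrow> i \<in> A \<Longrightarrow> norm (e i) = 1"
  using cinner_self[of "e i"]
  by (simp add: orthonormal_on_def)
     (metis norm_ge_zero of_real_1 of_real_eq_iff of_real_power power2_eq_1_iff abs_of_nonneg abs_1 abs_minus_cancel)

lemma orthonormal_norm: "orthonormal e \<Longrightarrow> norm (e i) = 1"
  using orthonormal_on_norm by blast

lemma orthonormal_reindex: "orthonormal e \<Longrightarrow> inj r \<Longrightarrow> orthonormal (\<lambda>n. e (r n))"
  by (auto simp: orthonormal_on_def inj_eq)

lemma cinner_sum_orthonormal:
  assumes "orthonormal_on A e" "F \<subseteq> A" "finite F" "j \<in> A"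
  shows "cinner (\<Sum>i\<in>F. c i *\<^sub>C e i) (e j) = (if j \<in> F then c j else 0)"
proof -
  have "cinner (\<Sum>i\<in>F. c i *\<^sub>C e i) (e j) = (\<Sum>i\<in>F. if i = j then c i else 0)"
    unfolding cinner.sum_left
    by (rule sum.cong) (use assms in \<open>auto simp: cinner_scaleC_left orthonormal_on_def subset_iff\<close>)
  then show ?thesis using assms(3) by simp
qed

lemma norm_sum_orthonormal:
  assumes "orthonormal_on A e" "F \<subseteq> A" "finite F"
  shows "(norm (\<Sum>i\<in>F. c i *\<^sub>C e i))\<^sup>2 = (\<Sum>i\<in>F. (cmod (c i))\<^sup>2)"
proof -
  have "complex_of_real ((norm (\<Sum>i\<in>F. c i *\<^sub>C e i))\<^sup>2) = (\<Sum>j\<in>F. cnj (c j) * c j)"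
    unfolding cinner_self[symmetric] cinner.sum_right cinner_scaleC_right
    by (rule sum.cong) (use assms cinner_sum_orthonormal[OF assms, of _ c] in \<open>auto simp: subset_iff\<close>)
  also have "\<dots> = complex_of_real (\<Sum>i\<in>F. (cmod (c i))\<^sup>2)"
    by (simp add: complex_norm_square[symmetric] mult.commute[of "cnj _"])
  finally show ?thesis using of_real_eq_iff by blast
qed

text \<open>Both bounds are Pythagoras for the orthogonal decomposition of \<open>x\<close> into its
  projection and the residual. The second one controls a vector whose first coefficients have been
  removed, as the tail estimates require.\<close>

lemma bessel:
  assumes "orthonormal_on A e" "F \<subseteq> A" "finite F"
  shows "(\<Sum>i\<in>F. (cmod (cinner x (e i)))\<^sup>2) \<le> (norm x)\<^sup>2"
    and "norm (x - (\<Sum>i\<in>F. cinner x (e i) *\<^sub>C e i)) \<le> norm x"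
proof -
  let ?p = "\<Sum>i\<in>F. cinner x (e i) *\<^sub>C e i"
  have "cinner (x - ?p) (e j) = 0" if "j \<in> F" for j
    using that assms by (subst cinner.diff_left, subst cinner_sum_orthonormal[OF assms]) auto
  then have "cinner (x - ?p) ?p = 0"
    by (simp add: cinner.sum_right cinner_scaleC_right)
  from norm_add_sq_orthogonal[OF this]
  have *: "(norm x)\<^sup>2 = (norm (x - ?p))\<^sup>2 + (norm ?p)\<^sup>2" by simp
  then show "(\<Sum>i\<in>F. (cmod (cinner x (e i)))\<^sup>2) \<le> (norm x)\<^sup>2"
    using norm_sum_orthonormal[OF assms, of "\<lambda>i. cinner x (e i)"] by simp
  have "(norm (x - ?p))\<^sup>2 \<le> (norm x)\<^sup>2" using * by simp
  then show "norm (x - ?p) \<le> norm x" by (rule power2_le_imp_le) simp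
qed

lemma orthonormal_summable:
  fixes f :: "nat \<Rightarrow> 'a::complex_hilbert_space"
  assumes f: "orthonormal f" and c: "summable (\<lambda>n. (cmod (c n))\<^sup>2)"
  shows "summable (\<lambda>n. c n *\<^sub>C f n)"
  unfolding summable_Cauchy
proof (intro allI impI)
  fix \<epsilon> :: real assume "\<epsilon> > 0"
  then obtain N where N: "\<And>m n. m \<ge> N \<Longrightarrow> norm (\<Sum>i=m..<n. (cmod (c i))\<^sup>2) < \<epsilon>\<^sup>2"
    using c unfolding summable_Cauchy by (meson zero_less_power)
  have "norm (\<Sum>i=m..<n. c i *\<^sub>C f i) < \<epsilon>" if "m \<ge> N" for m n
  proof -
    have "(norm (\<Sum>i=m..<n. c i *\<^sub>C f i))\<^sup>2 < \<epsilon>\<^sup>2"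
      using N[OF that, of n] norm_sum_orthonormal[OF f, of "{m..<n}" c] by simp
    then show ?thesis using \<open>\<epsilon> > 0\<close> by (meson less_imp_le power_less_imp_less_base)
  qed
  then show "\<exists>N. \<forall>m\<ge>N. \<forall>n. norm (\<Sum>i=m..<n. c i *\<^sub>C f i) < \<epsilon>" by blast
qed

lemma bessel_summable:
  assumes "orthonormal e"
  shows "summable (\<lambda>n. (cmod (cinner x (e n)))\<^sup>2)"
    by (rule summableI_nonneg_bounded[where x = "(norm x)\<^sup>2"])
       (use bessel(1)[OF assms] in auto)

subsection \<open>Diagonal operators\<close>

text \<open>Schmidt form of an operator. Two systems are used so that operators which are not normal
  are covered too. The systems need not be complete: everything orthogonal to all \<open>e n\<close>
  is sent to 0.\<close>

definition diag_op :: "(nat \<Rightarrow> 'a) \<Rightarrow> (nat \<Rightarrow> 'a) \<Rightarrow> (nat \<Rightarrow> real) \<Rightarrow> ('a::complex_hilbert_space \<Rightarrow>\<^sub>L 'a)" where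
  "diag_op e f a = Blinfun (\<lambda>x. \<Sum>n. (complex_of_real (a n) * cinner x (e n)) *\<^sub>C f n)"

lemma diag_summable:
  fixes f :: "nat \<Rightarrow> 'a::complex_hilbert_space"
  assumes "orthonormal e" "orthonormal f" "Bseq a"
  shows "summable (\<lambda>n. (complex_of_real (a n) * cinner x (e n)) *\<^sub>C f n)"
proof (rule orthonormal_summable[OF assms(2)])
  obtain K where K: "\<And>n. \<bar>a n\<bar> \<le> K" using assms(3) by (auto simp: Bseq_def)
  have "(cmod (complex_of_real (a n) * cinner x (e n)))\<^sup>2 \<le> K\<^sup>2 * (cmod (cinner x (e n)))\<^sup>2" for n
    using power_mono[OF K[of n], of 2]
    by (simp add: norm_mult power_mult_distrib mult_right_mono)
  then show "summable (\<lambda>n. (cmod (complex_of_real (a n) * cinner x (e n)))\<^sup>2)"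
    by (intro summable_comparison_test[OF _ summable_mult[OF bessel_summable[OF assms(1), of x], of "K\<^sup>2"]]) auto
qed

text \<open>The bound on \<open>a n\<close> is demanded only where \<open>x\<close> has a
  coefficient, so a vector orthogonal to the first few \<open>e n\<close> is estimated by the later
  entries alone.\<close>

lemma diag_norm_le:
  fixes f :: "nat \<Rightarrow> 'a::complex_hilbert_space"
  assumes "orthonormal e" "orthonormal f" "0 \<le> K" "\<And>n. cinner x (e n) \<noteq> 0 \<Longrightarrow> \<bar>a n\<bar> \<le> K"
  shows "norm (\<Sum>n<N. (complex_of_real (a n) * cinner x (e n)) *\<^sub>C f n) \<le> K * norm x"
proof -
  have "(norm (\<Sum>n<N. (complex_of_real (a n) * cinner x (e n)) *\<^sub>C f n))\<^sup>2
     = (\<Sum>n<N. (cmod (complex_of_real (a n) * cinner x (e n)))\<^sup>2)"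
    by (rule norm_sum_orthonormal[OF assms(2)]) auto
  also have "\<dots> \<le> (\<Sum>n<N. K\<^sup>2 * (cmod (cinner x (e n)))\<^sup>2)"
  proof (rule sum_mono)
    fix n
    show "(cmod (complex_of_real (a n) * cinner x (e n)))\<^sup>2 \<le> K\<^sup>2 * (cmod (cinner x (e n)))\<^sup>2"
    proof (cases "cinner x (e n) = 0")
      case False
      then show ?thesis
        using power_mono[OF assms(4)[OF False], of 2]
        by (simp add: norm_mult power_mult_distrib mult_right_mono)
    qed simp
  qed
  also have "\<dots> \<le> K\<^sup>2 * (norm x)\<^sup>2"
    unfolding sum_distrib_left[symmetric]
    by (rule mult_left_mono[OF bessel(1)[OF assms(1)]]) auto
  finally have "(norm (\<Sum>n<N. (complex_of_real (a n) * cinner x (e n)) *\<^sub>C f n))\<^sup>2 \<le> (K * norm x)\<^sup>2"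
    by (simp add: power_mult_distrib)
  then show ?thesis by (rule power2_le_imp_le) (simp add: assms(3))
qed

context
  fixes e f :: "nat \<Rightarrow> 'a::complex_hilbert_space" and a :: "nat \<Rightarrow> real"
  assumes e: "orthonormal e" and f: "orthonormal f" and a: "Bseq a"
begin

lemma bounded_linear_diag:
  "bounded_linear (\<lambda>x. \<Sum>n. (complex_of_real (a n) * cinner x (e n)) *\<^sub>C f n)"
proof
  note s = diag_summable[OF e f a]
  fix x y :: 'a and r :: real
  show "(\<Sum>n. (complex_of_real (a n) * cinner (x + y) (e n)) *\<^sub>C f n)
    = (\<Sum>n. (complex_of_real (a n) * cinner x (e n)) *\<^sub>C f n) + (\<Sum>n. (complex_of_real (a n) * cinner y (e n)) *\<^sub>C f n)"
    by (simp add: suminf_add[OF s s] cinner.add_left distrib_left scaleC.add_left)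
  show "(\<Sum>n. (complex_of_real (a n) * cinner (r *\<^sub>R x) (e n)) *\<^sub>C f n)
    = r *\<^sub>R (\<Sum>n. (complex_of_real (a n) * cinner x (e n)) *\<^sub>C f n)"
    unfolding suminf_scaleR_right[OF s]
    by (simp add: cinner.scaleR_left mult_scaleR_right scaleC.scaleR_left)
  obtain K where a': "\<And>n. \<bar>a n\<bar> \<le> K" using a by (auto simp: Bseq_def)
  have K: "0 \<le> K" using a'[of 0] by simp
  have "norm (\<Sum>n. (complex_of_real (a n) * cinner x (e n)) *\<^sub>C f n) \<le> norm x * K" for x
  proof (rule LIMSEQ_le_const2[OF tendsto_norm[OF summable_LIMSEQ[OF s]]], intro exI[of _ 0] allI impI)
    show "norm (\<Sum>n<N. (complex_of_real (a n) * cinner x (e n)) *\<^sub>C f n) \<le> norm x * K" for N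
      using diag_norm_le[OF e f K, of x a N] a' by (simp add: mult.commute)
  qed
  then show "\<exists>K. \<forall>x. norm (\<Sum>n. (complex_of_real (a n) * cinner x (e n)) *\<^sub>C f n) \<le> norm x * K"
    by blast
qed

lemma diag_op_sums: "(\<lambda>n. (complex_of_real (a n) * cinner x (e n)) *\<^sub>C f n) sums diag_op e f a x"
  unfolding diag_op_def bounded_linear_Blinfun_apply[OF bounded_linear_diag]
  by (rule summable_sums[OF diag_summable[OF e f a]])

lemma diag_op_norm_le:
  assumes "0 \<le> C" "\<And>n. cinner x (e n) \<noteq> 0 \<Longrightarrow> \<bar>a n\<bar> \<le> C"
  shows "norm (diag_op e f a x) \<le> C * norm x"
  using diag_norm_le[OF e f assms]
  by (intro LIMSEQ_le_const2[OF tendsto_norm[OF diag_op_sums[unfolded sums_def]]]) auto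

lemma diag_op_cinner_sums:
  "(\<lambda>n. complex_of_real (a n) * cinner x (e n) * cinner (f n) y) sums cinner (diag_op e f a x) y"
  using bounded_linear.sums[OF cinner.bounded_linear_left[of y] diag_op_sums[of x]]
  by (simp add: cinner_scaleC_left)

lemma diag_op_coeff: "cinner (diag_op e f a x) (f n) = complex_of_real (a n) * cinner x (e n)"
proof -
  have "(\<lambda>k. complex_of_real (a k) * cinner x (e k) * cinner (f k) (f n)) sums (complex_of_real (a n) * cinner x (e n) * cinner (f n) (f n))"
    using sums_finite[of "{n}" "\<lambda>k. complex_of_real (a k) * cinner x (e k) * cinner (f k) (f n)"]
    by (simp add: orthonormal_cinner[OF f])
  with diag_op_cinner_sums[of x "f n"] show ?thesis
    using sums_unique2 by (fastforce simp: orthonormal_cinner[OF f])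
qed

lemma diag_op_scaleC: "diag_op e f a (c *\<^sub>C x) = c *\<^sub>C diag_op e f a x"
proof -
  have "(\<lambda>n. (complex_of_real (a n) * cinner (c *\<^sub>C x) (e n)) *\<^sub>C f n) sums (c *\<^sub>C diag_op e f a x)"
    using bounded_linear.sums[OF scaleC.bounded_linear_right[of c] diag_op_sums[of x]]
    by (simp add: cinner_scaleC_left scaleC_scaleC mult_ac)
  with diag_op_sums[of "c *\<^sub>C x"] show ?thesis using sums_unique2 by blast
qed

lemma diag_op_bounded_ops: "diag_op e f a \<in> bounded_ops"
  by (simp add: bounded_ops_def diag_op_scaleC)

end

lemma diag_op_basis:
  assumes e: "orthonormal e" and f: "orthonormal f" and a: "Bseq a"
  shows "diag_op e f a (e n) = complex_of_real (a n) *\<^sub>C f n"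
proof -
  have "(\<lambda>k. (complex_of_real (a k) * cinner (e n) (e k)) *\<^sub>C f k) sums
     (\<Sum>k\<in>{n}. (complex_of_real (a k) * cinner (e n) (e k)) *\<^sub>C f k)"
    by (rule sums_finite) (simp_all add: orthonormal_cinner[OF e])
  with diag_op_sums[OF assms, of "e n"] show ?thesis
    using sums_unique2 by (fastforce simp: orthonormal_cinner[OF e])
qed

lemma diag_op_adjoint:
  assumes e: "orthonormal e" and f: "orthonormal f" and a: "Bseq a"
  shows "cinner (diag_op e f a x) y = cinner x (diag_op f e a y)"
proof -
  note s = bounded_linear.sums[OF bounded_linear_cnj diag_op_cinner_sums[OF f e a, of y x]]
  have "(\<lambda>n. complex_of_real (a n) * cinner x (e n) * cinner (f n) y) sums cinner x (diag_op f e a y)"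
  proof -
    have "cnj (complex_of_real (a n) * cinner y (f n) * cinner (e n) x)
      = complex_of_real (a n) * cinner x (e n) * cinner (f n) y" for n
      using cinner_commute[of "f n" y] cinner_commute[of x "e n"] by simp
    then show ?thesis using s unfolding cinner_commute[of x "diag_op f e a y"] by presburger
  qed
  with diag_op_cinner_sums[OF e f a, of x y] show ?thesis using sums_unique2 by blast
qed

text \<open>Adjoints are only ever computed for diagonal operators, where swapping the two systems
  exhibits one; uniqueness follows by testing against all vectors.\<close>

lemma op_adjoint_diag_op:
  assumes e: "orthonormal e" and f: "orthonormal f" and a: "Bseq a"
  shows "op_adjoint (diag_op e f a) = diag_op f e a"
  unfolding op_adjoint_def
proof (rule the_equality)
  show "diag_op f e a \<in> bounded_ops \<and>
      (\<forall>x y. cinner (diag_op e f a x) y = cinner x (diag_op f e a y))"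
    using diag_op_bounded_ops[OF f e a] diag_op_adjoint[OF e f a] by blast
  fix Y assume "Y \<in> bounded_ops \<and> (\<forall>x y. cinner (diag_op e f a x) y = cinner x (blinfun_apply Y y))"
  then show "Y = diag_op f e a"
    by (intro blinfun_eqI cinner_eqI) (simp add: diag_op_adjoint[OF e f a])
qed

lemma diag_op_compose:
  assumes e: "orthonormal e" and f: "orthonormal f" and g: "orthonormal g"
    and a: "Bseq a" and b: "Bseq b"
  shows "diag_op f g b o\<^sub>L diag_op e f a = diag_op e g (\<lambda>n. b n * a n)"
proof (rule blinfun_eqI)
  have ab: "Bseq (\<lambda>n. b n * a n)" by (rule Bseq_mult[OF b a])
  fix x
  have "(\<lambda>n. (complex_of_real (b n * a n) * cinner x (e n)) *\<^sub>C g n) sums diag_op f g b (diag_op e f a x)"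
    using diag_op_sums[OF f g b, of "diag_op e f a x"] by (simp add: diag_op_coeff[OF e f a] mult_ac)
  with diag_op_sums[OF e g ab, of x] show "(diag_op f g b o\<^sub>L diag_op e f a) x = diag_op e g (\<lambda>n. b n * a n) x"
    using sums_unique2 by fastforce
qed

lemma diag_op_add:
  assumes e: "orthonormal e" and f: "orthonormal f"
    and a: "Bseq a" and b: "Bseq b"
  shows "diag_op e f (\<lambda>n. a n + b n) = diag_op e f a + diag_op e f b"
proof (rule blinfun_eqI)
  obtain K L where "\<And>n. \<bar>a n\<bar> \<le> K" "\<And>n. \<bar>b n\<bar> \<le> L" using a b by (auto simp: Bseq_def)
  then have "norm (a n + b n) \<le> K + L" for n
    unfolding real_norm_def using abs_triangle_ineq add_mono order_trans by metis
  then have ab: "Bseq (\<lambda>n. a n + b n)" by (rule BseqI')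
  fix x
  have "(\<lambda>n. (complex_of_real (a n + b n) * cinner x (e n)) *\<^sub>C f n) sums (diag_op e f a x + diag_op e f b x)"
    using sums_add[OF diag_op_sums[OF e f a, of x] diag_op_sums[OF e f b, of x]]
    by (simp add: distrib_right scaleC.add_left)
  with diag_op_sums[OF e f ab, of x]
  show "diag_op e f (\<lambda>n. a n + b n) x = (diag_op e f a + diag_op e f b) x"
    using sums_unique2 by (fastforce simp: blinfun.add_left)
qed

text \<open>Even and odd indices split the systems into two pairs, each carrying the coefficients
  \<open>a\<close>. An ideal containing one diagonal operator with these coefficients contains both
  summands, hence their ampliation.\<close>

lemma diag_op_ampliation:
  assumes e: "orthonormal e" and f: "orthonormal f" and a: "Bseq a"
  shows "diag_op e f (\<lambda>n. a (n div 2))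
    = diag_op (\<lambda>n. e (2 * n)) (\<lambda>n. f (2 * n)) a + diag_op (\<lambda>n. e (2 * n + 1)) (\<lambda>n. f (2 * n + 1)) a"
proof (rule blinfun_eqI)
  fix x
  have a2: "Bseq (\<lambda>n. a (n div 2))" using a unfolding Bseq_def by blast
  let ?t = "\<lambda>n. (complex_of_real (a (n div 2)) * cinner x (e n)) *\<^sub>C f n"
  have "?t sums diag_op e f (\<lambda>n. a (n div 2)) x"
    by (rule diag_op_sums[OF e f a2])
  from sums_group[OF this, of 2]
  have 1: "(\<lambda>n. ?t (2 * n) + ?t (2 * n + 1)) sums diag_op e f (\<lambda>n. a (n div 2)) x"
    by (simp add: mult.commute numeral_2_eq_2)
  have o: "orthonormal (\<lambda>n. e (2 * n))" "orthonormal (\<lambda>n. f (2 * n))"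
      "orthonormal (\<lambda>n. e (2 * n + 1))" "orthonormal (\<lambda>n. f (2 * n + 1))"
    by (rule orthonormal_reindex, fact, simp add: inj_def)+
  have 2: "(\<lambda>n. ?t (2 * n) + ?t (2 * n + 1)) sums
     (diag_op (\<lambda>n. e (2 * n)) (\<lambda>n. f (2 * n)) a x + diag_op (\<lambda>n. e (2 * n + 1)) (\<lambda>n. f (2 * n + 1)) a x)"
    using sums_add[OF diag_op_sums[OF o(1,2) a, of x] diag_op_sums[OF o(3,4) a, of x]] by simp
  from sums_unique2[OF 1 2]
  show "diag_op e f (\<lambda>n. a (n div 2)) x = (diag_op (\<lambda>n. e (2 * n)) (\<lambda>n. f (2 * n)) a
    + diag_op (\<lambda>n. e (2 * n + 1)) (\<lambda>n. f (2 * n + 1)) a) x"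
    by (simp add: blinfun.add_left)
qed

subsection \<open>Compact operators\<close>

lemma bounded_ops_scaleC: "X \<in> bounded_ops \<Longrightarrow> blinfun_apply X (c *\<^sub>C x) = c *\<^sub>C X x"
  by (simp add: bounded_ops_def)

lemma bounded_ops_sum:
  "X \<in> bounded_ops \<Longrightarrow> blinfun_apply X (\<Sum>i\<in>F. c i *\<^sub>C x i) = (\<Sum>i\<in>F. c i *\<^sub>C X (x i))"
  by (simp add: blinfun.sum_right bounded_ops_scaleC)

lemma bounded_ops_add: "X \<in> bounded_ops \<Longrightarrow> Y \<in> bounded_ops \<Longrightarrow> X + Y \<in> bounded_ops"
  by (simp add: bounded_ops_def blinfun.add_left scaleC_add_right)

lemma bounded_ops_compose: "X \<in> bounded_ops \<Longrightarrow> Y \<in> bounded_ops \<Longrightarrow> X o\<^sub>L Y \<in> bounded_ops"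
  by (simp add: bounded_ops_def)

lemma compact_ops_iff:
  "X \<in> compact_ops \<longleftrightarrow> X \<in> bounded_ops \<and> (\<exists>K. compact K \<and> blinfun_apply X ` cball 0 1 \<subseteq> K)"
proof -
  have "compact (closure S)" if "compact K" "S \<subseteq> K" for S K :: "'a set"
    using compact_Int_closed[OF that(1) closed_closure[of S]]
      closure_minimal[OF that(2) compact_imp_closed[OF that(1)]]
    by (simp add: inf.absorb2)
  then have "compact (closure S) \<longleftrightarrow> (\<exists>K. compact K \<and> S \<subseteq> K)" for S :: "'a set"
    by (metis closure_subset)
  then show ?thesis
    by (simp add: compact_ops_def)
qed

lemma compact_opsI:
  "X \<in> bounded_ops \<Longrightarrow> compact K \<Longrightarrow> blinfun_apply X ` cball 0 1 \<subseteq> K \<Longrightarrow> X \<in> compact_ops"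
  unfolding compact_ops_iff by blast

lemma compact_ops_bounded_ops: "X \<in> compact_ops \<Longrightarrow> X \<in> bounded_ops"
  by (simp add: compact_ops_def)

lemma compact_ops_add:
  assumes "X \<in> compact_ops" "Y \<in> compact_ops" shows "X + Y \<in> compact_ops"
proof -
  obtain K L where KL: "compact K" "blinfun_apply X ` cball 0 1 \<subseteq> K" "compact L" "blinfun_apply Y ` cball 0 1 \<subseteq> L"
    using assms unfolding compact_ops_iff by blast
  then have "compact {a + b |a b. a \<in> K \<and> b \<in> L}" by (intro compact_sums)
  moreover have "blinfun_apply (X + Y) ` cball 0 1 \<subseteq> {a + b |a b. a \<in> K \<and> b \<in> L}"
    using KL unfolding blinfun.add_left by blast
  ultimately show ?thesis
    using assms by (meson compact_opsI bounded_ops_add compact_ops_bounded_ops)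
qed

lemma compact_ops_compose_left:
  assumes "X \<in> compact_ops" "A \<in> bounded_ops" shows "A o\<^sub>L X \<in> compact_ops"
proof -
  obtain K where K: "compact K" "blinfun_apply X ` cball 0 1 \<subseteq> K"
    using assms unfolding compact_ops_iff by blast
  then have "compact (blinfun_apply A ` K)"
    by (intro compact_continuous_image linear_continuous_on blinfun.bounded_linear_right)
  moreover have "blinfun_apply (A o\<^sub>L X) ` cball 0 1 \<subseteq> blinfun_apply A ` K"
    using K(2) by auto
  ultimately show ?thesis
    using assms by (meson compact_opsI bounded_ops_compose compact_ops_bounded_ops)
qed

lemma compact_ops_compose_right:
  assumes "X \<in> compact_ops" "A \<in> bounded_ops" shows "X o\<^sub>L A \<in> compact_ops"
proof -
  obtain K where K: "compact K" "blinfun_apply X ` cball 0 1 \<subseteq> K"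
    using assms unfolding compact_ops_iff by blast
  \<comment> \<open>The added 1 keeps \<open>c\<close> positive when \<open>A\<close> is 0, so that
    dividing by it is possible.\<close>
  define c where "c = norm A + 1"
  have c: "c > 0" by (simp add: c_def add_nonneg_pos)
  have "blinfun_apply (X o\<^sub>L A) ` cball 0 1 \<subseteq> (\<lambda>x. c *\<^sub>R x) ` K"
  proof clarify
    fix x :: 'a assume "x \<in> cball 0 1"
    then have "norm (A x) \<le> c"
      using norm_blinfun[of A x] mult_left_mono[of "norm x" 1 "norm A"] by (simp add: c_def)
    then have "inverse c *\<^sub>R A x \<in> cball 0 1"
      using c by (simp add: field_simps)
    then have "X (inverse c *\<^sub>R A x) \<in> K" using K(2) by blast
    then have "c *\<^sub>R X (inverse c *\<^sub>R A x) \<in> (\<lambda>x. c *\<^sub>R x) ` K" by blast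
    then show "(X o\<^sub>L A) x \<in> (\<lambda>x. c *\<^sub>R x) ` K"
      using c by (simp add: blinfun.scaleR_right)
  qed
  with compact_scaling[OF K(1), of c] show ?thesis
    using assms by (meson compact_opsI bounded_ops_compose compact_ops_bounded_ops)
qed

text \<open>Completeness reduces the claim to total boundedness, and a finite net of the
  approximating compact set serves as a coarser net of \<open>S\<close>.\<close>

lemma compact_closure_if_approx:
  fixes S :: "'a::complete_space set"
  assumes "\<And>\<epsilon>. \<epsilon> > 0 \<Longrightarrow> \<exists>K. compact K \<and> (\<forall>x\<in>S. \<exists>y\<in>K. dist y x \<le> \<epsilon>)"
  shows "compact (closure S)"
  unfolding compact_eq_totally_bounded
proof (intro conjI allI impI)
  show "complete (closure S)" by (simp add: complete_eq_closed)
  fix \<epsilon> :: real assume "\<epsilon> > 0"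
  then obtain K where K: "compact K" "\<And>x. x \<in> S \<Longrightarrow> \<exists>y\<in>K. dist y x \<le> \<epsilon>/4"
    using assms[of "\<epsilon>/4"] by auto
  have "\<exists>k. finite k \<and> K \<subseteq> (\<Union>x\<in>k. ball x (\<epsilon>/4))"
    using K(1) \<open>\<epsilon> > 0\<close> unfolding compact_eq_totally_bounded by simp
  then obtain k where k: "finite k" "K \<subseteq> (\<Union>x\<in>k. ball x (\<epsilon>/4))" by blast
  \<comment> \<open>Closed balls, because the cover has to survive passing to the closure; the slack
    between half of \<epsilon> and \<epsilon> opens them again.\<close>
  have "S \<subseteq> (\<Union>x\<in>k. cball x (\<epsilon>/2))"
  proof
    fix x assume "x \<in> S"
    then obtain y where y: "y \<in> K" "dist y x \<le> \<epsilon>/4" using K(2) by blast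
    then obtain z where z: "z \<in> k" "dist z y < \<epsilon>/4" using k by (meson UN_E mem_ball subsetD)
    have "dist z x \<le> dist z y + dist y x" by (rule dist_triangle)
    then show "x \<in> (\<Union>x\<in>k. cball x (\<epsilon>/2))" using y z by (intro UN_I[of z]) auto
  qed
  then have "closure S \<subseteq> (\<Union>x\<in>k. cball x (\<epsilon>/2))"
    by (rule closure_minimal) (use k in auto)
  also have "\<dots> \<subseteq> (\<Union>x\<in>k. ball x \<epsilon>)" using \<open>\<epsilon> > 0\<close> by auto
  finally show "\<exists>k. finite k \<and> closure S \<subseteq> (\<Union>x\<in>k. ball x \<epsilon>)" using k by blast
qed

text \<open>Removing the first N coefficients from \<open>x\<close> leaves a vector that meets only
  entries \<open>a n\<close> with n at least N, and removing them does not increase the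
  norm.\<close>

lemma diag_op_tail_norm_le:
  assumes e: "orthonormal e" and f: "orthonormal f" and a: "Bseq a"
    and "0 \<le> C" and C: "\<And>n. N \<le> n \<Longrightarrow> \<bar>a n\<bar> \<le> C"
  shows "norm (diag_op e f a x - (\<Sum>n<N. (complex_of_real (a n) * cinner x (e n)) *\<^sub>C f n)) \<le> C * norm x"
proof -
  let ?y = "x - (\<Sum>n<N. cinner x (e n) *\<^sub>C e n)"
  have "diag_op e f a ?y = diag_op e f a x - (\<Sum>n<N. (complex_of_real (a n) * cinner x (e n)) *\<^sub>C f n)"
    by (simp add: blinfun.diff_right bounded_ops_sum[OF diag_op_bounded_ops[OF e f a]]
        diag_op_basis[OF e f a] scaleC_scaleC mult.commute)
  moreover have "norm (diag_op e f a ?y) \<le> C * norm ?y"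
  proof (rule diag_op_norm_le[OF e f a \<open>0 \<le> C\<close>])
    fix n assume "cinner ?y (e n) \<noteq> 0"
    then have "N \<le> n"
      using cinner_sum_orthonormal[OF e, of "{..<N}" n "\<lambda>n. cinner x (e n)"]
      by (auto simp: cinner.diff_left split: if_splits)
    then show "\<bar>a n\<bar> \<le> C" by (rule C)
  qed
  moreover have "C * norm ?y \<le> C * norm x"
    using bessel(2)[OF e, of "{..<N}" x] \<open>0 \<le> C\<close> by (simp add: mult_left_mono)
  ultimately show ?thesis by simp
qed

text \<open>The truncations \<open>P N\<close> map the unit ball into compact sets, adding one disc
  of multiples of \<open>f N\<close> at a time, and they approximate the operator uniformly on that
  ball.\<close>

lemma diag_op_compact:
  assumes e: "orthonormal e" and f: "orthonormal f" and a: "a \<longlonglongrightarrow> 0"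
  shows "diag_op e f a \<in> compact_ops"
proof -
  have B: "Bseq a" using a by (intro convergent_imp_Bseq convergentI)
  define P where "P N x = (\<Sum>n<N. (complex_of_real (a n) * cinner x (e n)) *\<^sub>C f n)" for N x
  have P: "\<exists>K. compact K \<and> P N ` cball 0 1 \<subseteq> K" for N
  proof (induction N)
    case 0
    show ?case by (rule exI[of _ "{0}"]) (auto simp: P_def)
  next
    case (Suc N)
    then obtain K where K: "compact K" "P N ` cball 0 1 \<subseteq> K" by blast
    let ?L = "(\<lambda>c. c *\<^sub>C f N) ` cball 0 \<bar>a N\<bar>"
    have L: "compact ?L"
      by (intro compact_continuous_image linear_continuous_on scaleC.bounded_linear_left compact_cball)
    have "P (Suc N) ` cball 0 1 \<subseteq> {u + v |u v. u \<in> K \<and> v \<in> ?L}"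
    proof clarify
      fix x :: 'a assume x: "x \<in> cball 0 1"
      have "cmod (cinner x (e N)) \<le> 1"
        using cinner_norm_le[of x "e N"] x by (simp add: orthonormal_norm[OF e])
      then have "cmod (complex_of_real (a N) * cinner x (e N)) \<le> \<bar>a N\<bar>"
        by (simp add: norm_mult mult_left_le)
      then have "(complex_of_real (a N) * cinner x (e N)) *\<^sub>C f N \<in> ?L"
        by (intro imageI) simp
      moreover have "P N x \<in> K" using K x by blast
      ultimately show "\<exists>u v. P (Suc N) x = u + v \<and> u \<in> K \<and> v \<in> ?L" by (auto simp: P_def)
    qed
    then show ?case using compact_sums[OF K(1) L] by blast
  qed
  have "compact (closure (diag_op e f a ` cball 0 1))"
  proof (rule compact_closure_if_approx)
    fix \<epsilon> :: real assume "\<epsilon> > 0"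
    with a obtain N where N: "\<And>n. n \<ge> N \<Longrightarrow> \<bar>a n\<bar> \<le> \<epsilon>"
      unfolding LIMSEQ_iff by (metis diff_zero less_imp_le real_norm_def)
    obtain K where K: "compact K" "P N ` cball 0 1 \<subseteq> K" using P by blast
    have "\<exists>y\<in>K. dist y (diag_op e f a x) \<le> \<epsilon>" if "x \<in> cball 0 1" for x
    proof
      show "P N x \<in> K" using K that by blast
      have "norm (diag_op e f a x - P N x) \<le> \<epsilon> * norm x"
        unfolding P_def using diag_op_tail_norm_le[OF e f B] N \<open>\<epsilon> > 0\<close> by simp
      also have "\<dots> \<le> \<epsilon>" using that \<open>\<epsilon> > 0\<close> by (simp add: mult_left_le)
      finally show "dist (P N x) (diag_op e f a x) \<le> \<epsilon>" by (simp add: dist_norm norm_minus_commute)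
    qed
    with K(1) show "\<exists>K. compact K \<and> (\<forall>x\<in>diag_op e f a ` cball 0 1. \<exists>y\<in>K. dist y x \<le> \<epsilon>)" by blast
  qed
  then show ?thesis
    by (simp add: compact_ops_def diag_op_bounded_ops[OF e f B])
qed

subsection \<open>The Schmidt decomposition\<close>

text \<open>One Gram-Schmidt step applied to a vector outside the span of \<open>S\<close>. It works
  with a set because the later choices carry the set of vectors already chosen.\<close>

lemma infinite_dimensional_orthogonal:
  fixes S :: "'a::complex_hilbert_space set"
  assumes "infinite_dimensional TYPE('a)" "finite S"
    and S: "\<forall>u\<in>S. \<forall>v\<in>S. cinner u v = (if u = v then 1 else 0)"
  shows "\<exists>x. norm x = 1 \<and> (\<forall>u\<in>S. cinner x u = 0)"
proof -
  obtain x where x: "x \<notin> complex_vec.span S"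
    using assms(1,2) unfolding infinite_dimensional_def by blast
  define y where "y = x - (\<Sum>u\<in>S. cinner x u *\<^sub>C u)"
  have "(\<Sum>u\<in>S. cinner x u *\<^sub>C u) \<in> complex_vec.span S"
    by (intro complex_vec.span_sum complex_vec.span_scale complex_vec.span_base)
  with x have "y \<noteq> 0" by (auto simp: y_def)
  have "cinner y v = 0" if "v \<in> S" for v
  proof -
    have "(\<Sum>u\<in>S. cinner (cinner x u *\<^sub>C u) v) = (\<Sum>u\<in>S. if u = v then cinner x u else 0)"
      by (rule sum.cong) (use S that in \<open>auto simp: cinner_scaleC_left\<close>)
    then show ?thesis
      using that assms(2) by (simp add: y_def cinner.diff_left cinner.sum_left)
  qed
  with \<open>y \<noteq> 0\<close> show ?thesis
    by (intro exI[of _ "complex_of_real (inverse (norm y)) *\<^sub>C y"])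
       (simp add: norm_scaleC cinner_scaleC_left norm_inverse)
qed

text \<open>A maximising sequence whose images converge is itself Cauchy: the midpoints of its members
  also nearly maximise, so the parallelogram law applies. This spares the adjoint operator.\<close>

lemma compact_op_norm_attained:
  fixes X :: "'a::complex_hilbert_space \<Rightarrow>\<^sub>L 'a"
  assumes X: "X \<in> compact_ops" and V: "subspace V" "closed V" and v: "v \<in> V" "norm v = 1"
  shows "\<exists>u\<in>V. norm u = 1 \<and> (\<forall>x\<in>V. norm (X x) \<le> norm (X u) * norm x)"
proof -
  define U where "U = {x \<in> V. norm x = 1}"
  define s where "s = (SUP x\<in>U. norm (X x))"
  have bdd: "bdd_above ((\<lambda>x. norm (X x)) ` U)"
  proof (rule bdd_aboveI2)
    fix x assume "x \<in> U"
    then show "norm (X x) \<le> norm X" using norm_blinfun[of X x] by (simp add: U_def)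
  qed
  have "v \<in> U" using v by (simp add: U_def)
  have le_s: "norm (X x) \<le> s" if "x \<in> U" for x
    unfolding s_def using bdd that by (rule cSUP_upper2) simp
  have le: "norm (X x) \<le> s * norm x" if "x \<in> V" for x
  proof (cases "x = 0")
    case False
    then have "inverse (norm x) *\<^sub>R x \<in> U" using that V(1) by (simp add: U_def subspace_scale)
    from le_s[OF this] False show ?thesis by (simp add: blinfun.scaleR_right field_simps)
  qed simp
  have "\<exists>u\<in>U. norm (X u) = s"
  proof (cases "s = 0")
    case True
    then show ?thesis using le_s[OF \<open>v \<in> U\<close>] \<open>v \<in> U\<close> by (intro bexI[of _ v]) auto
  next
    case False
    then have "s > 0" using le_s[OF \<open>v \<in> U\<close>] norm_ge_zero by (metis less_eq_real_def order_trans)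
    have "\<exists>x. x \<in> U \<and> s - inverse (real (Suc n)) < norm (X x)" for n
      using less_cSUP_iff[of U "\<lambda>x. norm (X x)" "s - inverse (real (Suc n))"] \<open>v \<in> U\<close> bdd
      unfolding s_def[symmetric] by fastforce
    then obtain x where x: "\<And>n. x n \<in> U" "\<And>n. s - inverse (real (Suc n)) < norm (X (x n))" by metis
    have "(\<lambda>n. norm (X (x n))) \<longlonglongrightarrow> s"
    proof (rule tendsto_sandwich)
      show "\<forall>\<^sub>F n in sequentially. s - inverse (real (Suc n)) \<le> norm (X (x n))"
        using x(2) by (simp add: less_imp_le)
      show "\<forall>\<^sub>F n in sequentially. norm (X (x n)) \<le> s" using le_s x(1) by simp
      show "(\<lambda>n. s - inverse (real (Suc n))) \<longlonglongrightarrow> s"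
        using tendsto_diff[OF tendsto_const LIMSEQ_inverse_real_of_nat, of s] by simp
    qed simp
    obtain K where "compact K" "blinfun_apply X ` cball 0 1 \<subseteq> K" using X unfolding compact_ops_iff by blast
    moreover have "\<forall>n. X (x n) \<in> blinfun_apply X ` cball 0 1" using x(1) by (simp add: U_def)
    ultimately obtain z r where r: "strict_mono r" "((\<lambda>n. X (x n)) \<circ> r) \<longlonglongrightarrow> z"
      unfolding compact_def by (meson subset_iff)
    have "norm z = s"
      using tendsto_norm[OF r(2)] LIMSEQ_subseq_LIMSEQ[OF \<open>(\<lambda>n. norm (X (x n))) \<longlonglongrightarrow> s\<close> r(1)]
      by (auto simp: o_def intro: LIMSEQ_unique)
    define y where "y n = x (r n)" for n
    have yU: "y n \<in> U" for n by (simp add: y_def x)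
    have yz: "(\<lambda>n. X (y n)) \<longlonglongrightarrow> z" using r(2) by (simp add: y_def o_def)
    have "Cauchy y"
      unfolding Cauchy_def
    proof (intro allI impI)
      fix \<epsilon> :: real assume "\<epsilon> > 0"
      \<comment> \<open>The divisor 9 gives \<open>8 * d < \<epsilon>\<^sup>2\<close>, the error
        left by the parallelogram law. The cap at 1 makes \<open>2 - 2 * d\<close> nonnegative, so
        that it may be squared.\<close>
      define d where "d = min 1 (\<epsilon>\<^sup>2 / 9)"
      have d: "d > 0" "d \<le> 1" "8 * d < \<epsilon>\<^sup>2"
        using \<open>\<epsilon> > 0\<close> zero_less_power[OF \<open>\<epsilon> > 0\<close>, of 2] by (auto simp: d_def min_def)
      obtain N where N: "\<And>n. n \<ge> N \<Longrightarrow> norm (X (y n) - z) < d * s"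
        using yz d \<open>s > 0\<close> unfolding LIMSEQ_iff by (meson mult_pos_pos)
      have "dist (y m) (y n) < \<epsilon>" if "m \<ge> N" "n \<ge> N" for m n
      proof -
        have "norm (2 *\<^sub>R z) = 2 * s" using \<open>norm z = s\<close> by simp
        moreover have "2 *\<^sub>R z = X (y m + y n) - (X (y m) - z) - (X (y n) - z)"
          by (simp add: blinfun.add_right scaleR_2)
        moreover have "norm (X (y m + y n) - (X (y m) - z) - (X (y n) - z))
          \<le> norm (X (y m + y n)) + norm (X (y m) - z) + norm (X (y n) - z)"
          using norm_triangle_ineq4[of "X (y m + y n) - (X (y m) - z)" "X (y n) - z"]
            norm_triangle_ineq4[of "X (y m + y n)" "X (y m) - z"] by linarith
        moreover have "norm (X (y m + y n)) \<le> s * norm (y m + y n)"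
          using yU V(1) by (intro le) (auto simp: U_def subspace_add)
        ultimately have "s * (2 - 2 * d) \<le> s * norm (y m + y n)"
          using N[OF that(1)] N[OF that(2)] by (simp add: algebra_simps)
        then have "2 - 2 * d \<le> norm (y m + y n)" using \<open>s > 0\<close> by simp
        then have "(2 - 2 * d)\<^sup>2 \<le> (norm (y m + y n))\<^sup>2" using d by (intro power_mono) auto
        moreover have "(2 - 2 * d)\<^sup>2 \<ge> 4 - 8 * d" by (simp add: power2_eq_square algebra_simps)
        moreover have "(norm (y m - y n))\<^sup>2 + (norm (y m + y n))\<^sup>2 = 2 * (norm (y m))\<^sup>2 + 2 * (norm (y n))\<^sup>2"
          by (simp add: power2_norm_eq_inner inner_simps inner_commute)
        moreover have "(norm (y m))\<^sup>2 = 1" "(norm (y n))\<^sup>2 = 1"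
          using yU by (simp_all add: U_def)
        ultimately have "(norm (y m - y n))\<^sup>2 < \<epsilon>\<^sup>2"
          using d \<open>(norm (y m))\<^sup>2 = 1\<close> \<open>(norm (y n))\<^sup>2 = 1\<close> by linarith
        then show ?thesis
          using \<open>\<epsilon> > 0\<close> by (simp add: dist_norm power_less_imp_less_base)
      qed
      then show "\<exists>M. \<forall>m\<ge>M. \<forall>n\<ge>M. dist (y m) (y n) < \<epsilon>" by blast
    qed
    then obtain u where u: "y \<longlonglongrightarrow> u" using Cauchy_convergent convergent_def by blast
    have "u \<in> V" using V(2) u yU by (auto simp: closed_sequential_limits U_def)
    moreover have "norm u = 1"
      using tendsto_norm[OF u] yU by (auto simp: U_def intro: LIMSEQ_unique)
    moreover have "X u = z"
      using bounded_linear.tendsto[OF blinfun.bounded_linear_right u] yz LIMSEQ_unique by blast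
    ultimately show ?thesis using \<open>norm z = s\<close> by (auto simp: U_def)
  qed
  then show ?thesis using le by (auto simp: U_def)
qed

text \<open>First variation: if the images were not orthogonal, moving \<open>u\<close> a little in
  the direction \<open>y\<close> would raise the norm of the image to first order, while the norm of
  the argument grows only to second order.\<close>

lemma norm_maximiser_orthogonal:
  fixes X :: "'a::complex_hilbert_space \<Rightarrow>\<^sub>L 'a"
  assumes X: "X \<in> bounded_ops" and V: "complex_vec.subspace V"
    and u: "u \<in> V" "norm u = 1" "\<And>x. x \<in> V \<Longrightarrow> norm (X x) \<le> norm (X u) * norm x"
    and y: "y \<in> V" "cinner y u = 0"
  shows "cinner (X y) (X u) = 0"
proof (rule ccontr)
  define w where "w = cinner (X y) (X u)"
  define B where "B = (norm (X u))\<^sup>2 * (norm y)\<^sup>2"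
  \<comment> \<open>This step size gives \<open>t * B < 1\<close>, which makes the second-order loss
    smaller than the first-order gain. The phase \<open>cnj w\<close> in \<open>c\<close> makes that
    gain real and positive.\<close>
  define t where "t = inverse (B + 1)"
  define c where "c = complex_of_real t * cnj w"
  assume "cinner (X y) (X u) \<noteq> 0"
  then have w: "w \<noteq> 0" by (simp add: w_def)
  have "B \<ge> 0" by (simp add: B_def)
  then have t: "t > 0" "t * B < 1" by (auto simp: t_def field_simps)
  have "u + c *\<^sub>C y \<in> V"
    using V u y by (simp add: complex_vec.subspace_add complex_vec.subspace_scale)
  from u(3)[OF this] have "(norm (X (u + c *\<^sub>C y)))\<^sup>2 \<le> (norm (X u))\<^sup>2 * (norm (u + c *\<^sub>C y))\<^sup>2"
    unfolding power_mult_distrib[symmetric] by (rule power_mono) simp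
  moreover have "(norm (u + c *\<^sub>C y))\<^sup>2 = 1 + (cmod c)\<^sup>2 * (norm y)\<^sup>2"
    using norm_add_sq_orthogonal[of u "c *\<^sub>C y"] u y cinner_commute[of u y]
    by (simp add: cinner_scaleC_right norm_scaleC power_mult_distrib)
  moreover have "(norm (X (u + c *\<^sub>C y)))\<^sup>2
    = (norm (X u))\<^sup>2 + 2 * Re (c * w) + (cmod c)\<^sup>2 * (norm (X y))\<^sup>2"
  proof -
    have "(norm (X u + c *\<^sub>C X y))\<^sup>2
      = (norm (X u))\<^sup>2 + 2 * ((c *\<^sub>C X y) \<bullet> X u) + (norm (c *\<^sub>C X y))\<^sup>2"
      by (simp add: power2_norm_eq_inner inner_simps inner_commute)
    then show ?thesis
      by (simp add: blinfun.add_right bounded_ops_scaleC[OF X] inner_eq_Re_cinner cinner_scaleC_left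
          w_def norm_scaleC power_mult_distrib)
  qed
  moreover have Re_cw: "Re (c * w) = t * (cmod w)\<^sup>2"
    by (simp add: c_def mult.assoc mult.commute[of "cnj w"] complex_norm_square[symmetric]
        flip: of_real_power of_real_mult)
  moreover have cmod_c: "(cmod c)\<^sup>2 = t\<^sup>2 * (cmod w)\<^sup>2"
    using t by (simp add: c_def norm_mult power_mult_distrib)
  moreover have "(cmod c)\<^sup>2 * (norm (X y))\<^sup>2 \<ge> 0" by simp
  ultimately have "2 * Re (c * w) \<le> (cmod c)\<^sup>2 * B"
    unfolding B_def by (simp only: distrib_left mult_1_right mult_ac)
  then have "2 * (t * (cmod w)\<^sup>2) \<le> (t * (cmod w)\<^sup>2) * (t * B)"
    unfolding Re_cw cmod_c
    by (simp only: power2_eq_square mult_ac)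
  moreover have "t * (cmod w)\<^sup>2 > 0" using t w by simp
  ultimately show False
    using t mult_strict_left_mono[of "t * B" 1 "t * (cmod w)\<^sup>2"] by linarith
qed

text \<open>Each choice depends on its predecessors only through their set, so a plain recursion on
  that set suffices; the set stays finite, as the premise requires.\<close>

lemma dependent_set_choice:
  assumes "\<And>n S. finite S \<Longrightarrow> \<exists>u. P n S u"
  shows "\<exists>e::nat \<Rightarrow> 'a. \<forall>n. P n (e ` {..<n}) (e n)"
proof -
  define pick where "pick n S = (SOME u. P n S u)" for n S
  define S where "S = rec_nat {} (\<lambda>n T. insert (pick n T) T)"
  have S: "S 0 = {}" "S (Suc n) = insert (pick n (S n)) (S n)" for n by (simp_all add: S_def)
  define e where "e n = pick n (S n)" for n
  have eq: "e ` {..<n} = S n" for n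
    by (induction n) (simp_all add: S e_def lessThan_Suc)
  have fin: "finite (S n)" for n by (induction n) (simp_all add: S)
  have "P n (S n) (e n)" for n
    unfolding e_def pick_def by (rule someI_ex[OF assms[OF fin]])
  then show ?thesis unfolding eq[symmetric] by blast
qed

lemma orthonormalI:
  fixes e :: "nat \<Rightarrow> 'a::complex_inner"
  assumes "\<And>n. norm (e n) = 1" "\<And>i n. i < n \<Longrightarrow> cinner (e n) (e i) = 0"
  shows "orthonormal e"
  unfolding orthonormal_on_def
proof (intro ballI)
  fix i j show "cinner (e i) (e j) = (if i = j then 1 else 0)"
    using assms(2)[of i j] assms(2)[of j i] assms(1)[of i] cinner_commute[of "e i" "e j"]
    by (cases i j rule: linorder_cases) (auto simp: cinner_self)
qed

text \<open>Converts orthogonality to earlier members into the condition on a set that the choice of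
  the next vector presupposes. Equal vectors at distinct indices would give 0 = 1.\<close>

lemma orthonormal_initial:
  fixes e :: "nat \<Rightarrow> 'a::complex_inner"
  assumes "\<And>k. k < n \<Longrightarrow> norm (e k) = 1" "\<And>i k. i < k \<Longrightarrow> k < n \<Longrightarrow> cinner (e k) (e i) = 0"
  shows "\<forall>u\<in>e ` {..<n}. \<forall>v\<in>e ` {..<n}. cinner u v = (if u = v then 1 else 0)"
proof -
  have *: "cinner (e i) (e j) = (if i = j then 1 else 0)" if "i < n" "j < n" for i j
    using assms(2)[of i j] assms(2)[of j i] assms(1)[of i] cinner_commute[of "e i" "e j"] that
    by (cases i j rule: linorder_cases) (auto simp: cinner_self)
  show ?thesis
  proof (intro ballI)
    fix u v assume "u \<in> e ` {..<n}" "v \<in> e ` {..<n}"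
    then obtain i j where "i < n" "j < n" "u = e i" "v = e j" by blast
    then show "cinner u v = (if u = v then 1 else 0)"
      using * by (metis zero_neq_one)
  qed
qed

theorem schmidt_decomposition:
  fixes X :: "'a::complex_hilbert_space \<Rightarrow>\<^sub>L 'a"
  assumes inf: "infinite_dimensional TYPE('a)" and X: "X \<in> compact_ops"
  shows "\<exists>e f \<xi>. orthonormal e \<and> orthonormal f \<and> \<xi> \<in> c0_star \<and> X = diag_op e f \<xi>"
proof -
  let ?on = "\<lambda>S::'a set. \<forall>u\<in>S. \<forall>v\<in>S. cinner u v = (if u = v then 1 else 0)"
  let ?V = "\<lambda>S::'a set. {x. \<forall>u\<in>S. cinner x u = 0}"
  have X': "X \<in> bounded_ops" by (rule compact_ops_bounded_ops[OF X])
  have subV: "complex_vec.subspace (?V S)" for S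
    by (auto simp: complex_vec.subspace_def cinner.add_left cinner_scaleC_left cinner.zero_left)
  \<comment> \<open>The property is conditional on \<open>S\<close> being orthonormal, so that a
    witness exists for every finite set. The condition is discharged for the actual predecessors by
    strong induction afterwards.\<close>
  define P where "P S u \<longleftrightarrow> (?on S \<longrightarrow> norm u = 1 \<and> u \<in> ?V S \<and>
    (\<forall>x\<in>?V S. norm (X x) \<le> norm (X u) * norm x))" for S u
  have ex_P: "\<exists>u. P S u" if fin: "finite S" for S
  proof (cases "?on S")
    case True
    then obtain v where v: "v \<in> ?V S" "norm v = 1"
      using infinite_dimensional_orthogonal[OF inf fin] by blast
    have "subspace (?V S)"
      using subV[of S] by (auto simp: complex_vec.subspace_def subspace_def scaleR_scaleC)
    moreover have "closed (?V S)"
    proof -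
      have "closed {x. cinner x u = 0}" for u :: 'a
        by (intro closed_Collect_eq linear_continuous_on cinner.bounded_linear_left continuous_on_const)
      then have "closed (\<Inter>u\<in>S. {x. cinner x u = 0})" by blast
      then show ?thesis by (simp add: Collect_ball_eq)
    qed
    ultimately obtain u where "u \<in> ?V S" "norm u = 1" "\<forall>x\<in>?V S. norm (X x) \<le> norm (X u) * norm x"
      using compact_op_norm_attained[OF X _ _ v] by blast
    then show ?thesis unfolding P_def by (intro exI[of _ u]) blast
  qed (use P_def in blast)
  then obtain e :: "nat \<Rightarrow> 'a" where e: "\<And>n. ?on (e ` {..<n}) \<Longrightarrow> norm (e n) = 1 \<and> e n \<in> ?V (e ` {..<n}) \<and>
      (\<forall>x\<in>?V (e ` {..<n}). norm (X x) \<le> norm (X (e n)) * norm x)"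
    using dependent_set_choice[of "\<lambda>_. P", OF ex_P] unfolding P_def by blast
  have one: "?on (e ` {..<n})" for n
  proof (rule orthonormal_initial)
    have "norm (e k) = 1 \<and> (\<forall>i<k. cinner (e k) (e i) = 0)" for k
    proof (induction k rule: less_induct)
      case (less k)
      then have "?on (e ` {..<k})" by (intro orthonormal_initial) auto
      from e[OF this] show ?case by blast
    qed
    then show "norm (e k) = 1" "i < k \<Longrightarrow> cinner (e k) (e i) = 0" for i k by blast+
  qed
  have e1: "norm (e n) = 1" and e2: "i < n \<Longrightarrow> cinner (e n) (e i) = 0"
    and e3: "(\<And>i. i < n \<Longrightarrow> cinner x (e i) = 0) \<Longrightarrow> norm (X x) \<le> norm (X (e n)) * norm x" for n i x
    using e[OF one[of n]] by blast+
  have on_e: "orthonormal e" using e1 e2 by (rule orthonormalI)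
  define \<xi> where "\<xi> n = norm (X (e n))" for n
  have dec: "decseq \<xi>"
    unfolding decseq_Suc_iff \<xi>_def using e3[of _ "e (Suc _)"] e1 e2 by simp
  have orth: "cinner (X (e n)) (X (e i)) = 0" if "i < n" for i n
  proof (rule norm_maximiser_orthogonal[OF X' subV[of "e ` {..<i}"]])
    show "e i \<in> ?V (e ` {..<i})" "e n \<in> ?V (e ` {..<i})" using e2 that by auto
    show "norm (e i) = 1" "cinner (e n) (e i) = 0" using e1 e2 that by auto
    show "norm (X x) \<le> norm (X (e i)) * norm x" if "x \<in> ?V (e ` {..<i})" for x
      using that by (intro e3) auto
  qed
  have lim: "\<xi> \<longlonglongrightarrow> 0"
  proof -
    obtain L where L: "\<xi> \<longlonglongrightarrow> L" "\<And>n. L \<le> \<xi> n"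
      using decseq_convergent[OF dec, of 0] by (auto simp: \<xi>_def)
    have "0 \<le> L" using L(1) by (rule LIMSEQ_le_const) (auto simp: \<xi>_def)
    \<comment> \<open>Otherwise the images of the \<open>e n\<close> would be pairwise orthogonal
      with norms at least \<open>L\<close>, hence too far apart for the convergent subsequence that
      compactness provides.\<close>
    have "\<not> L > 0"
    proof
      assume "L > 0"
      obtain K where "compact K" "blinfun_apply X ` cball 0 1 \<subseteq> K" using X unfolding compact_ops_iff by blast
      moreover have "\<forall>n. X (e n) \<in> blinfun_apply X ` cball 0 1" using e1 by simp
      ultimately obtain z r where r: "strict_mono r" "((\<lambda>n. X (e n)) \<circ> r) \<longlonglongrightarrow> z"
        unfolding compact_def by (meson subset_iff)
      then obtain N where N: "\<And>m n. m \<ge> N \<Longrightarrow> n \<ge> N \<Longrightarrow> norm (X (e (r m)) - X (e (r n))) < L"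
        using LIMSEQ_imp_Cauchy[OF r(2)] \<open>L > 0\<close> unfolding Cauchy_iff o_def by blast
      have "r N < r (Suc N)" using r(1) by (simp add: strict_mono_def)
      from orth[OF this] have "(norm (X (e (r (Suc N))) + - X (e (r N))))\<^sup>2 = (\<xi> (r (Suc N)))\<^sup>2 + (\<xi> (r N))\<^sup>2"
        by (subst norm_add_sq_orthogonal) (simp_all add: \<xi>_def cinner.minus_right)
      moreover have "L\<^sup>2 \<le> (\<xi> (r N))\<^sup>2" using L(2) \<open>L > 0\<close> by (intro power_mono) auto
      moreover have "(norm (X (e (r (Suc N))) + - X (e (r N))))\<^sup>2 < L\<^sup>2"
        using N[of "Suc N" N] by (intro power_strict_mono) auto
      ultimately show False by (smt (verit) zero_le_power2)
    qed
    with \<open>0 \<le> L\<close> L(1) show ?thesis by simp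
  qed
  have \<xi>: "\<xi> \<in> c0_star" using dec lim by (simp add: c0_star_def \<xi>_def)
  \<comment> \<open>Where \<open>\<xi> n\<close> is positive, \<open>f n\<close> is forced. Once it
    vanishes, it stays 0, and any unit vector orthogonal to the earlier ones will do; infinite
    dimension supplies one.\<close>
  define Q where "Q n S u \<longleftrightarrow> (?on S \<longrightarrow> (if \<xi> n = 0 then norm u = 1 \<and> u \<in> ?V S
    else u = complex_of_real (inverse (\<xi> n)) *\<^sub>C X (e n)))" for n S u
  have ex_Q: "\<exists>u. Q n S u" if "finite S" for n S
    unfolding Q_def using infinite_dimensional_orthogonal[OF inf that] by (cases "?on S"; cases "\<xi> n = 0") auto
  then obtain f :: "nat \<Rightarrow> 'a" where f: "\<And>n. ?on (f ` {..<n}) \<Longrightarrow>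
      (if \<xi> n = 0 then norm (f n) = 1 \<and> f n \<in> ?V (f ` {..<n})
       else f n = complex_of_real (inverse (\<xi> n)) *\<^sub>C X (e n))"
    using dependent_set_choice[of Q, OF ex_Q] unfolding Q_def by blast
  have f1: "norm (f k) = 1 \<and> (\<forall>i<k. cinner (f k) (f i) = 0) \<and> X (e k) = complex_of_real (\<xi> k) *\<^sub>C f k" for k
  proof (induction k rule: less_induct)
    case (less k)
    then have "?on (f ` {..<k})" by (intro orthonormal_initial) auto
    note fk = f[OF this]
    show ?case
    proof (cases "\<xi> k = 0")
      case True
      then have "X (e k) = 0" by (simp add: \<xi>_def)
      with True fk show ?thesis by auto
    next
      case False
      then have fk: "f k = complex_of_real (inverse (\<xi> k)) *\<^sub>C X (e k)" using fk by simp
      have pos: "\<xi> k > 0" using False by (simp add: \<xi>_def)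
      have "cinner (f k) (f i) = 0" if "i < k" for i
      proof -
        have "\<xi> i > 0" using pos decseqD[OF dec, of i k] that by simp
        moreover have "cinner (f k) (X (e i)) = 0"
          using orth[OF that] by (simp add: fk cinner_scaleC_left)
        ultimately show ?thesis using less.IH[OF that] by (simp add: cinner_scaleC_right)
      qed
      moreover have "norm (f k) = 1" using pos
        by (simp add: fk norm_scaleC norm_inverse) (simp add: \<xi>_def)
      moreover have "X (e k) = complex_of_real (\<xi> k) *\<^sub>C f k"
        using pos by (simp add: fk scaleC_scaleC scaleC_one)
      ultimately show ?thesis by blast
    qed
  qed
  then have on_f: "orthonormal f" by (intro orthonormalI) auto
  have B: "Bseq \<xi>" using lim by (intro convergent_imp_Bseq convergentI)
  have "X = diag_op e f \<xi>"
  proof (rule blinfun_eqI)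
    fix x
    let ?p = "\<lambda>N. \<Sum>n<N. (complex_of_real (\<xi> n) * cinner x (e n)) *\<^sub>C f n"
    \<comment> \<open>The system \<open>e\<close> need not be complete. Convergence comes from
      maximality instead: the residual is orthogonal to the first N vectors, where the norm of X is
      at most \<open>\<xi> N\<close>.\<close>
    have le: "norm (X x - ?p N) \<le> \<xi> N * norm x" for N
    proof -
      let ?y = "x - (\<Sum>n<N. cinner x (e n) *\<^sub>C e n)"
      have "X ?y = X x - ?p N"
        using f1 by (simp add: blinfun.diff_right bounded_ops_sum[OF X'] scaleC_scaleC mult.commute)
      moreover have "norm (X ?y) \<le> \<xi> N * norm ?y"
        unfolding \<xi>_def
      proof (rule e3)
        show "cinner ?y (e i) = 0" if "i < N" for i
          using that by (subst cinner.diff_left, subst cinner_sum_orthonormal[OF on_e]) auto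
      qed
      moreover have "\<xi> N * norm ?y \<le> \<xi> N * norm x"
        using bessel(2)[OF on_e, of "{..<N}" x] by (simp add: mult_left_mono \<xi>_def)
      ultimately show ?thesis by simp
    qed
    have lim2: "(\<lambda>N. \<xi> N * norm x) \<longlonglongrightarrow> 0"
      using tendsto_mult_left_zero[OF lim] by simp
    have "(\<lambda>N. X x - ?p N) \<longlonglongrightarrow> 0"
      by (rule Lim_null_comparison[OF _ lim2]) (rule always_eventually, rule allI, rule le)
    from tendsto_diff[OF tendsto_const[of "X x"] this] have "?p \<longlonglongrightarrow> X x" by simp
    then have "(\<lambda>n. (complex_of_real (\<xi> n) * cinner x (e n)) *\<^sub>C f n) sums X x" by (simp add: sums_def)
    then show "X x = diag_op e f \<xi> x"
      using diag_op_sums[OF on_e on_f B] sums_unique2 by blast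
  qed
  with on_e on_f \<xi> show ?thesis by blast
qed

subsection \<open>Singular numbers\<close>

lemma c0_star_nonneg: "\<xi> \<in> c0_star \<Longrightarrow> 0 \<le> \<xi> n"
  by (simp add: c0_star_def)

lemma c0_star_antimono: "\<xi> \<in> c0_star \<Longrightarrow> m \<le> n \<Longrightarrow> \<xi> n \<le> \<xi> m"
  by (auto simp: c0_star_def decseqD)

lemma c0_star_tendsto: "\<xi> \<in> c0_star \<Longrightarrow> \<xi> \<longlonglongrightarrow> 0"
  by (simp add: c0_star_def)

lemma c0_star_Bseq: "\<xi> \<in> c0_star \<Longrightarrow> Bseq \<xi>"
  by (intro convergent_imp_Bseq convergentI) (rule c0_star_tendsto)

lemma c0_starI:
  "(\<And>n. 0 \<le> \<xi> n) \<Longrightarrow> (\<And>n. \<xi> (Suc n) \<le> \<xi> n) \<Longrightarrow> \<xi> \<longlonglongrightarrow> 0 \<Longrightarrow> \<xi> \<in> c0_star"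
  by (simp add: c0_star_def decseq_Suc_iff)

lemma finite_level_set:
  assumes "\<xi> \<in> c0_star" "t > 0" shows "finite {n. \<xi> n = t}"
proof -
  have "\<forall>\<^sub>F n in sequentially. \<xi> n < t"
    using order_tendstoD(2)[OF c0_star_tendsto[OF assms(1)] assms(2)] .
  then obtain N where "\<And>n. n \<ge> N \<Longrightarrow> \<xi> n < t" by (auto simp: eventually_sequentially)
  then have "{n. \<xi> n = t} \<subseteq> {..<N}" by (force simp: not_less[symmetric])
  then show ?thesis using finite_subset by blast
qed

text \<open>At the first index where the sequences differ, the larger one takes its value there
  strictly more often: the smaller one can take that value only earlier, where both agree. Level
  sets of positive values are finite, so cardinalities detect this.\<close>

lemma c0_star_eqI:
  assumes \<xi>: "\<xi> \<in> c0_star" and \<eta>: "\<eta> \<in> c0_star" and eq: "\<And>t. t > 0 \<Longrightarrow> card {n. \<xi> n = t} = card {n. \<eta> n = t}"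
  shows "\<xi> = \<eta>"
proof (rule ccontr)
  have main: False if "\<xi> \<in> c0_star" "\<eta> \<in> c0_star" "card {n. \<xi> n = \<xi> N} = card {n. \<eta> n = \<xi> N}"
    "\<And>k. k < N \<Longrightarrow> \<xi> k = \<eta> k" "\<eta> N < \<xi> N" for \<xi> \<eta> N
  proof -
    have pos: "\<xi> N > 0" using c0_star_nonneg[OF that(2), of N] that(5) by simp
    have "{n. \<eta> n = \<xi> N} \<subseteq> {n. \<xi> n = \<xi> N} - {N}"
    proof
      fix k assume "k \<in> {n. \<eta> n = \<xi> N}"
      then have k: "\<eta> k = \<xi> N" by simp
      then have "k < N" using c0_star_antimono[OF that(2), of N k] that(5) by force
      then show "k \<in> {n. \<xi> n = \<xi> N} - {N}" using that(4) k by simp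
    qed
    then have "{n. \<eta> n = \<xi> N} \<subset> {n. \<xi> n = \<xi> N}" by blast
    from psubset_card_mono[OF finite_level_set[OF that(1) pos] this] that(3) show False by simp
  qed
  assume "\<xi> \<noteq> \<eta>"
  then have ex: "\<exists>n. \<xi> n \<noteq> \<eta> n" by blast
  define N where "N = (LEAST n. \<xi> n \<noteq> \<eta> n)"
  have N: "\<xi> N \<noteq> \<eta> N" unfolding N_def using ex by (rule LeastI_ex)
  have less: "\<xi> k = \<eta> k" if "k < N" for k using not_less_Least[of k "\<lambda>n. \<xi> n \<noteq> \<eta> n"] that unfolding N_def by blast
  show False
  proof (cases "\<eta> N < \<xi> N")
    case True
    then have "\<xi> N > 0" using c0_star_nonneg[OF \<eta>, of N] by simp
    from main[OF \<xi> \<eta> eq[OF this] less True] show False by blast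
  next
    case False
    then have l: "\<xi> N < \<eta> N" using N by simp
    then have "\<eta> N > 0" using c0_star_nonneg[OF \<xi>, of N] by simp
    from main[OF \<eta> \<xi> eq[OF this, symmetric] less[symmetric] l] show False by blast
  qed
qed

lemma orthonormal_independent:
  assumes e: "orthonormal e" and "finite N"
  shows "complex_vec.independent (e ` N)" "card (e ` N) = card N"
proof -
  have inj: "inj e"
    by (rule injI) (metis e orthonormal_cinner zero_neq_one)
  show "card (e ` N) = card N" by (rule card_image[OF inj_on_subset[OF inj subset_UNIV]])
  show "complex_vec.independent (e ` N)"
  proof
    assume "complex_vec.dependent (e ` N)"
    then obtain u n where u: "n \<in> N" "u (e n) \<noteq> 0" "(\<Sum>v\<in>e ` N. u v *\<^sub>C v) = 0"
      using assms(2) by (auto simp: complex_vec.dependent_finite)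
    have "(\<Sum>v\<in>e ` N. u v *\<^sub>C v) = (\<Sum>i\<in>N. u (e i) *\<^sub>C e i)"
      by (subst sum.reindex[OF inj_on_subset[OF inj subset_UNIV]]) simp
    then have "cinner (\<Sum>i\<in>N. u (e i) *\<^sub>C e i) (e n) = 0" using u by (simp add: cinner.zero_left)
    with u cinner_sum_orthonormal[OF e, of N n "\<lambda>i. u (e i)"] assms(2) show False by simp
  qed
qed

text \<open>Coefficients of an eigenvector vanish off the level set, so its image is a finite
  combination of the \<open>e n\<close>. Positivity of \<open>t\<close> allows the vector to be
  recovered from that image; kernel vectors may lie outside the span of the
  \<open>e n\<close>.\<close>

lemma diag_op_eigenspace:
  assumes e: "orthonormal e" and \<xi>: "\<xi> \<in> c0_star" and t: "t > 0"
  shows "{x. diag_op e e (\<lambda>n. \<xi> n * \<xi> n) x = complex_of_real (t\<^sup>2) *\<^sub>C x} = complex_vec.span (e ` {n. \<xi> n = t})"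
    (is "?E = complex_vec.span (e ` ?N)")
proof
  have B: "Bseq (\<lambda>n. \<xi> n * \<xi> n)" by (intro Bseq_mult c0_star_Bseq \<xi>)
  have sub: "complex_vec.subspace ?E"
    by (auto simp: complex_vec.subspace_def blinfun.add_right scaleC_add_right
        diag_op_scaleC[OF e e B] scaleC_scaleC mult.commute scaleC.zero_right)
  show "complex_vec.span (e ` ?N) \<subseteq> ?E"
    using sub by (intro complex_vec.span_minimal) (auto simp: diag_op_basis[OF e e B] power2_eq_square)
  show "?E \<subseteq> complex_vec.span (e ` ?N)"
  proof
    fix x assume "x \<in> ?E"
    then have x: "diag_op e e (\<lambda>n. \<xi> n * \<xi> n) x = complex_of_real (t\<^sup>2) *\<^sub>C x" by simp
    have zero: "cinner x (e n) = 0" if "n \<notin> ?N" for n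
    proof (rule ccontr)
      assume "cinner x (e n) \<noteq> 0"
      then have "complex_of_real (\<xi> n * \<xi> n) = complex_of_real (t\<^sup>2)"
        using diag_op_coeff[OF e e B, of x n] by (simp add: x cinner_scaleC_left)
      then have "(\<xi> n)\<^sup>2 = t\<^sup>2" unfolding of_real_eq_iff by (simp add: power2_eq_square)
      then show False using that t c0_star_nonneg[OF \<xi>, of n] by (simp add: power2_eq_iff_nonneg)
    qed
    have "(\<lambda>n. (complex_of_real (\<xi> n * \<xi> n) * cinner x (e n)) *\<^sub>C e n) sums
       (\<Sum>n\<in>?N. (complex_of_real (\<xi> n * \<xi> n) * cinner x (e n)) *\<^sub>C e n)"
      by (rule sums_finite[OF finite_level_set[OF \<xi> t]]) (simp add: zero scaleC.zero_left)
    then have "complex_of_real (t\<^sup>2) *\<^sub>C x = (\<Sum>n\<in>?N. (complex_of_real (\<xi> n * \<xi> n) * cinner x (e n)) *\<^sub>C e n)"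
      using diag_op_sums[OF e e B, of x] sums_unique2 unfolding x by blast
    also have "\<dots> \<in> complex_vec.span (e ` ?N)"
      by (intro complex_vec.span_sum complex_vec.span_scale complex_vec.span_base) auto
    finally have "complex_of_real (inverse (t\<^sup>2)) *\<^sub>C complex_of_real (t\<^sup>2) *\<^sub>C x \<in> complex_vec.span (e ` ?N)"
      by (rule complex_vec.span_scale)
    then show "x \<in> complex_vec.span (e ` ?N)"
      using t by (simp add: scaleC_scaleC scaleC_one)
  qed
qed

text \<open>The adjoint times the operator is diagonal in \<open>e\<close> with entries the squares
  of \<xi>, so each multiplicity is the size of a level set, and these sizes determine a member of
  \<open>c0_star\<close>.\<close>

theorem s_numbers_diag_op:
  assumes e: "orthonormal e" and f: "orthonormal f" and \<xi>: "\<xi> \<in> c0_star"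
  shows "s_numbers (diag_op e f \<xi>) = \<xi>"
proof -
  note B = c0_star_Bseq[OF \<xi>]
  have "op_adjoint (diag_op e f \<xi>) o\<^sub>L diag_op e f \<xi> = diag_op e e (\<lambda>n. \<xi> n * \<xi> n)"
    by (simp add: op_adjoint_diag_op[OF e f B] diag_op_compose[OF e f e B B])
  moreover have "complex_vec.dim {x. diag_op e e (\<lambda>n. \<xi> n * \<xi> n) x = complex_of_real (t\<^sup>2) *\<^sub>C x} = card {n. \<xi> n = t}"
    if "t > 0" for t
    unfolding diag_op_eigenspace[OF e \<xi> that]
    by (rule trans[OF complex_vec.dim_span_eq_card_independent
          orthonormal_independent(2)[OF e finite_level_set[OF \<xi> that]]])
       (rule orthonormal_independent(1)[OF e finite_level_set[OF \<xi> that]])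
  ultimately show ?thesis
    unfolding s_numbers_def using \<xi> by (intro the_equality) (auto intro: c0_star_eqI)
qed

text \<open>Gaussian elimination: a pivot unknown is removed from the other equations and restored
  at the end. The index set is arbitrary so that the pivot can be deleted from it.\<close>

lemma homogeneous_system:
  fixes M :: "nat \<Rightarrow> 'b \<Rightarrow> complex"
  assumes "finite J" "n < card J"
  shows "\<exists>a. (\<exists>j\<in>J. a j \<noteq> 0) \<and> (\<forall>i<n. (\<Sum>j\<in>J. M i j * a j) = 0)"
  using assms
proof (induction n arbitrary: M J)
  case 0
  then have "J \<noteq> {}" by auto
  then show ?case by (intro exI[of _ "\<lambda>_. 1"]) auto
next
  case (Suc n)
  show ?case
  proof (cases "\<exists>p\<in>J. M n p \<noteq> 0")
    case False
    then show ?thesis using Suc.IH[of J M] Suc.prems by (auto simp: less_Suc_eq)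
  next
    case True
    then obtain p where p: "p \<in> J" "M n p \<noteq> 0" by blast
    let ?J = "J - {p}"
    have "\<exists>a. (\<exists>j\<in>?J. a j \<noteq> 0) \<and> (\<forall>i<n. (\<Sum>j\<in>?J. (M i j - M i p * M n j / M n p) * a j) = 0)"
      using Suc.prems p by (intro Suc.IH) auto
    then obtain a where a: "\<exists>j\<in>?J. a j \<noteq> 0" "\<And>i. i < n \<Longrightarrow> (\<Sum>j\<in>?J. (M i j - M i p * M n j / M n p) * a j) = 0"
      by blast
    define s where "s = (\<Sum>j\<in>?J. M n j * a j)"
    define b where "b = a(p := - s / M n p)"
    have split: "(\<Sum>j\<in>J. M i j * b j) = M i p * (- s / M n p) + (\<Sum>j\<in>?J. M i j * a j)" for i
    proof -
      have "(\<Sum>j\<in>?J. M i j * b j) = (\<Sum>j\<in>?J. M i j * a j)"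
        by (rule sum.cong) (auto simp: b_def)
      then show ?thesis using p Suc.prems by (simp add: sum.remove[of J p] b_def)
    qed
    have sys: "(\<Sum>j\<in>J. M i j * b j) = 0" if "i < Suc n" for i
    proof (cases "i = n")
      case True
      then show ?thesis using p by (simp add: split s_def)
    next
      case False
      have "(\<Sum>j\<in>?J. (M i j - M i p * M n j / M n p) * a j)
        = (\<Sum>j\<in>?J. M i j * a j - M i p / M n p * (M n j * a j))"
        by (rule sum.cong) (auto simp: left_diff_distrib)
      then have "(\<Sum>j\<in>?J. M i j * a j) - M i p / M n p * s = 0"
        using a(2)[of i] that False by (simp add: s_def sum_distrib_left sum_subtractf)
      then show ?thesis by (simp add: split)
    qed
    have "\<exists>j\<in>J. b j \<noteq> 0" using a(1) by (auto simp: b_def)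
    with sys show ?thesis by blast
  qed
qed

text \<open>The functionals take the form \<open>x \<mapsto> \<langle>A x, g\<rangle>\<close> so that no Riesz representation
  is needed when the functionals of a composition are pulled back.\<close>

lemma singular_value_le:
  assumes e: "orthonormal e" and f: "orthonormal f" and \<xi>: "\<xi> \<in> c0_star"
    and A: "\<And>i. A i \<in> bounded_ops"
    and le: "\<And>x. (\<And>i. i < n \<Longrightarrow> cinner (blinfun_apply (A i) x) (g i) = 0) \<Longrightarrow> norm (diag_op e f \<xi> x) \<le> c * norm x"
  shows "\<xi> n \<le> c"
proof -
  note B = c0_star_Bseq[OF \<xi>]
  \<comment> \<open>There are n conditions on the n + 1 coefficients of a combination of
    \<open>e 0\<close> to \<open>e n\<close>. On that span the operator stretches by at least
    \<open>\<xi> n\<close>.\<close>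
  obtain a where a: "\<exists>j\<in>{..n}. a j \<noteq> 0" "\<And>i. i < n \<Longrightarrow> (\<Sum>j\<in>{..n}. cinner (A i (e j)) (g i) * a j) = 0"
    using homogeneous_system[of "{..n}" n "\<lambda>i j. cinner (A i (e j)) (g i)"] by auto
  define x where "x = (\<Sum>j\<le>n. a j *\<^sub>C e j)"
  have nx: "(norm x)\<^sup>2 = (\<Sum>j\<le>n. (cmod (a j))\<^sup>2)"
    unfolding x_def by (rule norm_sum_orthonormal[OF e]) auto
  obtain j where "j \<le> n" "a j \<noteq> 0" using a(1) by blast
  then have "0 < (\<Sum>j\<le>n. (cmod (a j))\<^sup>2)" by (intro sum_pos2[of _ j]) auto
  then have "norm x > 0" using nx by auto
  have "diag_op e f \<xi> x = (\<Sum>j\<le>n. (complex_of_real (\<xi> j) * a j) *\<^sub>C f j)"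
    by (simp add: x_def bounded_ops_sum[OF diag_op_bounded_ops[OF e f B]] diag_op_basis[OF e f B]
        scaleC_scaleC mult.commute)
  then have "(norm (diag_op e f \<xi> x))\<^sup>2 = (\<Sum>j\<le>n. (cmod (complex_of_real (\<xi> j) * a j))\<^sup>2)"
    using norm_sum_orthonormal[OF f, of "{..n}" "\<lambda>j. complex_of_real (\<xi> j) * a j"] by simp
  also have "\<dots> \<ge> (\<Sum>j\<le>n. (\<xi> n)\<^sup>2 * (cmod (a j))\<^sup>2)"
    using c0_star_antimono[OF \<xi>] c0_star_nonneg[OF \<xi>]
    by (intro sum_mono) (simp add: norm_mult power_mult_distrib mult_right_mono power_mono)
  finally have "(\<xi> n * norm x)\<^sup>2 \<le> (norm (diag_op e f \<xi> x))\<^sup>2"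
    by (simp add: power_mult_distrib nx sum_distrib_left)
  then have "\<xi> n * norm x \<le> norm (diag_op e f \<xi> x)" by (rule power2_le_imp_le) simp
  also have "\<dots> \<le> c * norm x"
  proof (rule le)
    fix i assume "i < n"
    then show "cinner (A i x) (g i) = 0"
      using a(2) by (simp add: x_def bounded_ops_sum[OF A] cinner.sum_left cinner_scaleC_left mult.commute)
  qed
  finally show ?thesis using \<open>norm x > 0\<close> by simp
qed

lemma diag_op_norm_le_singular_value:
  assumes e: "orthonormal e" and f: "orthonormal f" and \<xi>: "\<xi> \<in> c0_star"
    and x: "\<And>i. i < n \<Longrightarrow> cinner x (e i) = 0"
  shows "norm (diag_op e f \<xi> x) \<le> \<xi> n * norm x"
proof (rule diag_op_norm_le[OF e f c0_star_Bseq[OF \<xi>] c0_star_nonneg[OF \<xi>]])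
  fix k assume "cinner x (e k) \<noteq> 0"
  then have "n \<le> k" using x not_less by blast
  then show "\<bar>\<xi> k\<bar> \<le> \<xi> n" using c0_star_antimono[OF \<xi>] c0_star_nonneg[OF \<xi>] by simp
qed

lemma id_bounded_ops: "id_blinfun \<in> bounded_ops"
  by (simp add: bounded_ops_def)

context
  assumes inf: "infinite_dimensional TYPE('a::complex_hilbert_space)"
begin

lemma compact_opE:
  fixes X :: "'a \<Rightarrow>\<^sub>L 'a"
  assumes "X \<in> compact_ops"
  obtains e f where "orthonormal e" "orthonormal f" "X = diag_op e f (s_numbers X)" "s_numbers X \<in> c0_star"
  using schmidt_decomposition[OF inf assms] s_numbers_diag_op by metis

lemma s_numbers_c0_star: "(X :: 'a \<Rightarrow>\<^sub>L 'a) \<in> compact_ops \<Longrightarrow> s_numbers X \<in> c0_star"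
  by (rule compact_opE)

lemma s_numbers_compose_left:
  fixes X A :: "'a \<Rightarrow>\<^sub>L 'a"
  assumes X: "X \<in> compact_ops" and A: "A \<in> bounded_ops"
  shows "s_numbers (A o\<^sub>L X) n \<le> norm A * s_numbers X n"
proof -
  obtain e f where ef: "orthonormal e" "orthonormal f" "X = diag_op e f (s_numbers X)" "s_numbers X \<in> c0_star"
    by (rule compact_opE[OF X])
  obtain e' f' where ef': "orthonormal e'" "orthonormal f'" "A o\<^sub>L X = diag_op e' f' (s_numbers (A o\<^sub>L X))"
      "s_numbers (A o\<^sub>L X) \<in> c0_star"
    by (rule compact_opE[OF compact_ops_compose_left[OF X A]])
  show ?thesis
  proof (rule singular_value_le[OF ef'(1,2,4) id_bounded_ops, of n e])
    fix x assume "\<And>i. i < n \<Longrightarrow> cinner (id_blinfun x) (e i) = 0"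
    then have "norm (X x) \<le> s_numbers X n * norm x"
      using diag_op_norm_le_singular_value[OF ef(1,2,4), of n x] ef(3) by simp
    then have "norm (A (X x)) \<le> norm A * (s_numbers X n * norm x)"
      using norm_blinfun[of A "X x"] by (meson mult_left_mono norm_ge_zero order_trans)
    then show "norm (diag_op e' f' (s_numbers (A o\<^sub>L X)) x) \<le> norm A * s_numbers X n * norm x"
      by (simp add: ef'(3)[symmetric] mult.assoc)
  qed
qed

lemma s_numbers_compose_right:
  fixes X A :: "'a \<Rightarrow>\<^sub>L 'a"
  assumes X: "X \<in> compact_ops" and A: "A \<in> bounded_ops"
  shows "s_numbers (X o\<^sub>L A) n \<le> norm A * s_numbers X n"
proof -
  obtain e f where ef: "orthonormal e" "orthonormal f" "X = diag_op e f (s_numbers X)" "s_numbers X \<in> c0_star"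
    by (rule compact_opE[OF X])
  obtain e' f' where ef': "orthonormal e'" "orthonormal f'" "X o\<^sub>L A = diag_op e' f' (s_numbers (X o\<^sub>L A))"
      "s_numbers (X o\<^sub>L A) \<in> c0_star"
    by (rule compact_opE[OF compact_ops_compose_right[OF X A]])
  show ?thesis
  proof (rule singular_value_le[OF ef'(1,2,4) A, of n e])
    fix x assume "\<And>i. i < n \<Longrightarrow> cinner (A x) (e i) = 0"
    then have "norm (X (A x)) \<le> s_numbers X n * norm (A x)"
      using diag_op_norm_le_singular_value[OF ef(1,2,4), of n "A x"] ef(3) by simp
    also have "\<dots> \<le> s_numbers X n * (norm A * norm x)"
      using norm_blinfun[of A x] c0_star_nonneg[OF ef(4)] by (simp add: mult_left_mono)
    finally show "norm (diag_op e' f' (s_numbers (X o\<^sub>L A)) x) \<le> norm A * s_numbers X n * norm x"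
      by (simp add: ef'(3)[symmetric] mult_ac)
  qed
qed

text \<open>Requiring orthogonality to the first k vectors of each of the two systems makes 2 k
  conditions and bounds both summands at once. For odd n, monotonicity passes from
  \<open>2 * k\<close> to n.\<close>

lemma s_numbers_add:
  fixes X Y :: "'a \<Rightarrow>\<^sub>L 'a"
  assumes X: "X \<in> compact_ops" and Y: "Y \<in> compact_ops"
  shows "s_numbers (X + Y) n \<le> s_numbers X (n div 2) + s_numbers Y (n div 2)"
proof -
  obtain e f where ef: "orthonormal e" "orthonormal f" "X = diag_op e f (s_numbers X)" "s_numbers X \<in> c0_star"
    by (rule compact_opE[OF X])
  obtain e' f' where ef': "orthonormal e'" "orthonormal f'" "Y = diag_op e' f' (s_numbers Y)" "s_numbers Y \<in> c0_star"
    by (rule compact_opE[OF Y])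
  obtain e'' f'' where ef'': "orthonormal e''" "orthonormal f''" "X + Y = diag_op e'' f'' (s_numbers (X + Y))"
      "s_numbers (X + Y) \<in> c0_star"
    by (rule compact_opE[OF compact_ops_add[OF X Y]])
  define k where "k = n div 2"
  have "s_numbers (X + Y) (2 * k) \<le> s_numbers X k + s_numbers Y k"
  proof (rule singular_value_le[OF ef''(1,2,4) id_bounded_ops, of _ "\<lambda>i. if i < k then e i else e' (i - k)"])
    fix x assume x: "\<And>i. i < 2 * k \<Longrightarrow> cinner (id_blinfun x) (if i < k then e i else e' (i - k)) = 0"
    have "norm (X x) \<le> s_numbers X k * norm x"
    proof -
      have "cinner x (e i) = 0" if "i < k" for i using x[of i] that by simp
      then show ?thesis using diag_op_norm_le_singular_value[OF ef(1,2,4), of k x] ef(3) by simp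
    qed
    moreover have "norm (Y x) \<le> s_numbers Y k * norm x"
    proof -
      have "cinner x (e' i) = 0" if "i < k" for i using x[of "i + k"] that by simp
      then show ?thesis using diag_op_norm_le_singular_value[OF ef'(1,2,4), of k x] ef'(3) by simp
    qed
    ultimately show "norm (diag_op e'' f'' (s_numbers (X + Y)) x) \<le> (s_numbers X k + s_numbers Y k) * norm x"
      unfolding ef''(3)[symmetric] using norm_triangle_ineq[of "X x" "Y x"]
      by (simp add: blinfun.add_left distrib_right)
  qed
  moreover have "s_numbers (X + Y) n \<le> s_numbers (X + Y) (2 * k)"
    by (rule c0_star_antimono[OF ef''(4)]) (simp add: k_def)
  ultimately show ?thesis by (simp add: k_def)
qed

end

subsection \<open>The Calkin correspondence\<close>

text \<open>Invariance under the ampliation \<open>D\<^sub>2\<close> implies invariance under all \<open>D\<^sub>m\<close>.\<close>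

definition char_cone :: "(nat \<Rightarrow> real) set \<Rightarrow> bool" where
  "char_cone S \<longleftrightarrow> S \<subseteq> c0_star \<and> (\<lambda>_. 0) \<in> S \<and> (\<forall>\<xi>\<in>S. \<forall>\<eta>\<in>S. (\<lambda>n. \<xi> n + \<eta> n) \<in> S) \<and>
     (\<forall>\<xi>\<in>S. \<forall>\<eta>\<in>c0_star. \<forall>C. (\<forall>n. \<eta> n \<le> C * \<xi> n) \<longrightarrow> \<eta> \<in> S) \<and>
     (\<forall>\<xi>\<in>S. (\<lambda>n. \<xi> (n div 2)) \<in> S)"

lemma char_cone_c0_star: "char_cone S \<Longrightarrow> \<xi> \<in> S \<Longrightarrow> \<xi> \<in> c0_star"
  and char_cone_zero: "char_cone S \<Longrightarrow> (\<lambda>_. 0) \<in> S"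
  and char_cone_add: "char_cone S \<Longrightarrow> \<xi> \<in> S \<Longrightarrow> \<eta> \<in> S \<Longrightarrow> (\<lambda>n. \<xi> n + \<eta> n) \<in> S"
  and char_cone_le: "char_cone S \<Longrightarrow> \<xi> \<in> S \<Longrightarrow> \<eta> \<in> c0_star \<Longrightarrow> (\<And>n. \<eta> n \<le> C * \<xi> n) \<Longrightarrow> \<eta> \<in> S"
  and char_cone_double: "char_cone S \<Longrightarrow> \<xi> \<in> S \<Longrightarrow> (\<lambda>n. \<xi> (n div 2)) \<in> S"
  unfolding char_cone_def by blast+

lemma c0_star_zero: "(\<lambda>_. 0) \<in> c0_star"
  by (simp add: c0_star_def decseq_def)

lemma c0_star_add: "\<xi> \<in> c0_star \<Longrightarrow> \<eta> \<in> c0_star \<Longrightarrow> (\<lambda>n. \<xi> n + \<eta> n) \<in> c0_star"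
  unfolding c0_star_def using tendsto_add[of \<xi> 0 sequentially \<eta> 0] by (simp add: decseq_def add_mono)

text \<open>With indices starting at 0, \<open>n div m\<close> is the shifted form of the ceiling of
  (n + 1) / m, so this is the ampliation by m.\<close>

lemma c0_star_ampliation:
  assumes "\<xi> \<in> c0_star" "0 < m" shows "(\<lambda>n. \<xi> (n div m)) \<in> c0_star"
proof -
  have "filterlim (\<lambda>n. n div m) at_top sequentially"
    unfolding filterlim_at_top eventually_sequentially
  proof
    fix Z show "\<exists>N. \<forall>n\<ge>N. Z \<le> n div m"
      by (rule exI[of _ "Z * m"]) (use assms(2) in \<open>simp add: less_eq_div_iff_mult_less_eq\<close>)
  qed
  from filterlim_compose[OF c0_star_tendsto[OF assms(1)] this]
  have "(\<lambda>n. \<xi> (n div m)) \<longlonglongrightarrow> 0" .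
  then show ?thesis using assms(1)
    by (auto simp: c0_star_def decseq_def div_le_mono)
qed

lemma op_ideal_compact: "op_ideal J \<Longrightarrow> X \<in> J \<Longrightarrow> X \<in> compact_ops"
  unfolding op_ideal_def by blast

context
  assumes inf: "infinite_dimensional TYPE('a::complex_hilbert_space)"
begin

text \<open>\<open>Y\<close> factors through \<open>X\<close>: an isometric change of system takes
  \<open>e'\<close> to \<open>e\<close>, then \<open>X\<close> acts, then a diagonal operator
  multiplies by the bounded quotients of the singular numbers.\<close>

lemma op_ideal_hereditary:
  fixes X Y :: "'a \<Rightarrow>\<^sub>L 'a"
  assumes J: "op_ideal J" and X: "X \<in> J" and Y: "Y \<in> compact_ops"
    and le: "\<And>n. s_numbers Y n \<le> C * s_numbers X n"
  shows "Y \<in> J"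
proof -
  obtain e f where ef: "orthonormal e" "orthonormal f" "X = diag_op e f (s_numbers X)" "s_numbers X \<in> c0_star"
    by (rule compact_opE[OF inf op_ideal_compact[OF J X]])
  obtain e' f' where ef': "orthonormal e'" "orthonormal f'" "Y = diag_op e' f' (s_numbers Y)" "s_numbers Y \<in> c0_star"
    by (rule compact_opE[OF inf Y])
  \<comment> \<open>Where the denominator vanishes the quotient is 0 by convention, which is right
    because the numerator then vanishes by \<open>le\<close>.\<close>
  define b where "b n = s_numbers Y n / s_numbers X n" for n
  have "\<bar>b n\<bar> \<le> \<bar>C\<bar>" for n
  proof (cases "s_numbers X n = 0")
    case False
    then have "s_numbers X n > 0" using c0_star_nonneg[OF ef(4), of n] by simp
    then have "b n \<le> C" using le[of n] by (simp add: b_def divide_le_eq)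
    moreover have "b n \<ge> 0" unfolding b_def by (intro divide_nonneg_nonneg c0_star_nonneg ef ef')
    ultimately show ?thesis by simp
  qed (simp add: b_def)
  then have b: "Bseq b" by (intro BseqI') simp
  have one: "Bseq (\<lambda>_. 1 :: real)" by simp
  \<comment> \<open>The trailing 1 is the coefficient of the operator taking \<open>e'\<close> to
    \<open>e\<close>; it gives the product the shape that composing the three diagonal operators
    produces.\<close>
  have "s_numbers Y n = b n * (s_numbers X n * 1)" for n
    using le[of n] c0_star_nonneg[OF ef'(4), of n] by (cases "s_numbers X n = 0") (simp_all add: b_def)
  then have "Y = diag_op e' f' (\<lambda>n. b n * (s_numbers X n * 1))" using ef'(3) by presburger
  also have "\<dots> = diag_op f f' b o\<^sub>L diag_op e' f (\<lambda>n. s_numbers X n * 1)"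
    by (subst diag_op_compose[OF ef'(1) ef(2) ef'(2) _ b]) (simp_all add: c0_star_Bseq[OF ef(4)])
  also have "diag_op e' f (\<lambda>n. s_numbers X n * 1) = X o\<^sub>L diag_op e' e (\<lambda>_. 1)"
    by (subst (2) ef(3)) (rule diag_op_compose[OF ef'(1) ef(1,2) one c0_star_Bseq[OF ef(4)], symmetric])
  finally have "Y = diag_op f f' b o\<^sub>L (X o\<^sub>L diag_op e' e (\<lambda>_. 1))" .
  moreover have "diag_op f f' b \<in> bounded_ops" "diag_op e' e (\<lambda>_. 1) \<in> bounded_ops"
    using diag_op_bounded_ops[OF ef(2) ef'(2) b] diag_op_bounded_ops[OF ef'(1) ef(1) one] .
  ultimately show ?thesis using J X unfolding op_ideal_def by blast
qed

lemma op_ideal_mem_iff: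
  fixes X :: "'a \<Rightarrow>\<^sub>L 'a"
  assumes "op_ideal J" "X \<in> compact_ops"
  shows "X \<in> J \<longleftrightarrow> s_numbers X \<in> char_set J"
proof
  assume "s_numbers X \<in> char_set J"
  then obtain Y where "Y \<in> J" "s_numbers X = s_numbers Y" by (auto simp: char_set_def)
  then show "X \<in> J" using op_ideal_hereditary[OF assms(1) _ assms(2), of Y 1] by simp
qed (simp add: char_set_def)

lemma op_ideal_subset_iff:
  fixes J K :: "('a \<Rightarrow>\<^sub>L 'a) set"
  assumes "op_ideal J" "op_ideal K"
  shows "J \<subseteq> K \<longleftrightarrow> char_set J \<subseteq> char_set K"
proof
  assume "char_set J \<subseteq> char_set K"
  then show "J \<subseteq> K"
    using op_ideal_mem_iff assms op_ideal_compact by (metis subsetD subsetI)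
qed (auto simp: char_set_def)

lemma op_ideal_eq_iff:
  fixes J K :: "('a \<Rightarrow>\<^sub>L 'a) set"
  assumes "op_ideal J" "op_ideal K"
  shows "J = K \<longleftrightarrow> char_set J = char_set K"
  using op_ideal_subset_iff[OF assms] op_ideal_subset_iff[OF assms(2,1)] by blast

text \<open>The Schmidt decomposition of the zero operator already contains an infinite orthonormal
  sequence.\<close>

lemma exists_orthonormal: "\<exists>e::nat \<Rightarrow> 'a. orthonormal e"
proof -
  have "(0 :: 'a \<Rightarrow>\<^sub>L 'a) \<in> compact_ops"
    by (rule compact_opsI[of _ "{0}"]) (auto simp: bounded_ops_def scaleC.zero_right)
  then show ?thesis using compact_opE[OF inf] by metis
qed

lemma op_ideal_diag_op:
  fixes e f :: "nat \<Rightarrow> 'a"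
  assumes "op_ideal J" "orthonormal e" "orthonormal f" "\<xi> \<in> c0_star"
  shows "diag_op e f \<xi> \<in> J \<longleftrightarrow> \<xi> \<in> char_set J"
  using op_ideal_mem_iff[OF assms(1) diag_op_compact[OF assms(2,3) c0_star_tendsto[OF assms(4)]]]
  by (simp add: s_numbers_diag_op[OF assms(2-4)])

lemma char_set_c0_star: "op_ideal (J :: ('a \<Rightarrow>\<^sub>L 'a) set) \<Longrightarrow> \<xi> \<in> char_set J \<Longrightarrow> \<xi> \<in> c0_star"
  using op_ideal_compact s_numbers_c0_star[OF inf] by (auto simp: char_set_def)

text \<open>Each closure property is realised by diagonal operators over one fixed system; the
  ampliation uses its even and odd subsystems.\<close>

theorem char_cone_char_set:
  fixes J :: "('a \<Rightarrow>\<^sub>L 'a) set"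
  assumes J: "op_ideal J"
  shows "char_cone (char_set J)"
proof -
  obtain e :: "nat \<Rightarrow> 'a" where e: "orthonormal e" using exists_orthonormal by blast
  note D = op_ideal_diag_op[OF J]
  show ?thesis
    unfolding char_cone_def
  proof (intro conjI ballI allI impI subsetI)
    show "\<xi> \<in> c0_star" if "\<xi> \<in> char_set J" for \<xi> by (rule char_set_c0_star[OF J that])
  next
    have "diag_op e e (\<lambda>_. 0) = 0"
      using diag_op_norm_le[OF e e c0_star_Bseq[OF c0_star_zero], of 0] by (intro blinfun_eqI) simp
    then show "(\<lambda>_. 0) \<in> char_set J"
      using D[OF e e c0_star_zero] J by (simp add: op_ideal_def)
  next
    fix \<xi> \<eta> assume *: "\<xi> \<in> char_set J" "\<eta> \<in> char_set J"
    note c = *[THEN char_set_c0_star[OF J]]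
    have "diag_op e e \<xi> + diag_op e e \<eta> \<in> J"
      using * D[OF e e] c J by (simp add: op_ideal_def)
    then have "diag_op e e (\<lambda>n. \<xi> n + \<eta> n) \<in> J"
      by (simp add: diag_op_add[OF e e c0_star_Bseq[OF c(1)] c0_star_Bseq[OF c(2)]])
    then show "(\<lambda>n. \<xi> n + \<eta> n) \<in> char_set J"
      using D[OF e e] c0_star_add[OF c] by blast
  next
    fix \<xi> \<eta> C assume *: "\<xi> \<in> char_set J" "\<eta> \<in> c0_star" "\<forall>n. \<eta> n \<le> C * \<xi> n"
    note c = char_set_c0_star[OF J *(1)]
    have "diag_op e e \<eta> \<in> J"
    proof (rule op_ideal_hereditary[OF J])
      show "diag_op e e \<xi> \<in> J" using * D[OF e e c] by simp
      show "diag_op e e \<eta> \<in> compact_ops" by (rule diag_op_compact[OF e e c0_star_tendsto[OF *(2)]])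
      show "s_numbers (diag_op e e \<eta>) n \<le> C * s_numbers (diag_op e e \<xi>) n" for n
        using * by (simp add: s_numbers_diag_op[OF e e] c)
    qed
    then show "\<eta> \<in> char_set J" using D[OF e e *(2)] by simp
  next
    fix \<xi> assume *: "\<xi> \<in> char_set J"
    note c = char_set_c0_star[OF J *]
    have o: "orthonormal (\<lambda>n. e (2 * n))" "orthonormal (\<lambda>n. e (2 * n + 1))"
      by (rule orthonormal_reindex[OF e], simp add: inj_def)+
    have "diag_op e e (\<lambda>n. \<xi> (n div 2)) \<in> J"
      unfolding diag_op_ampliation[OF e e c0_star_Bseq[OF c]]
      using D[OF o(1,1) c] D[OF o(2,2) c] * J by (simp add: op_ideal_def)
    then show "(\<lambda>n. \<xi> (n div 2)) \<in> char_set J"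
      using D[OF e e c0_star_ampliation[OF c]] by simp
  qed
qed

theorem op_ideal_of_char_cone:
  assumes S: "char_cone S"
  shows "op_ideal {X :: 'a \<Rightarrow>\<^sub>L 'a. X \<in> compact_ops \<and> s_numbers X \<in> S}" (is "op_ideal ?J")
    and "char_set {X :: 'a \<Rightarrow>\<^sub>L 'a. X \<in> compact_ops \<and> s_numbers X \<in> S} = S"
proof -
  obtain e :: "nat \<Rightarrow> 'a" where e: "orthonormal e" using exists_orthonormal by blast
  show "char_set ?J = S"
  proof
    show "S \<subseteq> char_set ?J"
    proof
      fix \<xi> assume "\<xi> \<in> S"
      then have "\<xi> \<in> c0_star" using char_cone_c0_star[OF S] by blast
      then have "s_numbers (diag_op e e \<xi>) = \<xi>" "diag_op e e \<xi> \<in> compact_ops"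
        using s_numbers_diag_op[OF e e] diag_op_compact[OF e e c0_star_tendsto] by blast+
      then show "\<xi> \<in> char_set ?J" using \<open>\<xi> \<in> S\<close> unfolding char_set_def
        by (intro image_eqI[of _ _ "diag_op e e \<xi>"]) auto
    qed
  qed (auto simp: char_set_def)
  show "op_ideal ?J"
    unfolding op_ideal_def
  proof (intro conjI ballI)
    have z: "(0 :: 'a \<Rightarrow>\<^sub>L 'a) \<in> compact_ops" "(0 :: 'a \<Rightarrow>\<^sub>L 'a) \<in> bounded_ops"
      using compact_opsI[of 0 "{0}"] by (auto simp: bounded_ops_def scaleC.zero_right)
    \<comment> \<open>The zero operator is a composition whose left factor has norm 0. The bound is
      written as a product to fit \<open>char_cone_le\<close> with constant 0.\<close>
    have "s_numbers (0 :: 'a \<Rightarrow>\<^sub>L 'a) n \<le> 0 * 0" for n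
      using s_numbers_compose_left[OF inf z, of n] by simp
    then show "0 \<in> ?J"
      using z char_cone_le[OF S char_cone_zero[OF S] s_numbers_c0_star[OF inf z(1)], of 0] by simp
  next
    fix X Y :: "'a \<Rightarrow>\<^sub>L 'a" assume "X \<in> ?J" "Y \<in> ?J"
    then have *: "X \<in> compact_ops" "Y \<in> compact_ops" "s_numbers X \<in> S" "s_numbers Y \<in> S" by auto
    have "(\<lambda>n. s_numbers X (n div 2) + s_numbers Y (n div 2)) \<in> S"
      using char_cone_add[OF S char_cone_double[OF S *(3)] char_cone_double[OF S *(4)]] .
    from char_cone_le[OF S this s_numbers_c0_star[OF inf compact_ops_add[OF *(1,2)]], of 1]
    show "X + Y \<in> ?J" using s_numbers_add[OF inf *(1,2)] compact_ops_add[OF *(1,2)] by simp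
  next
    fix X A :: "'a \<Rightarrow>\<^sub>L 'a" assume "X \<in> ?J" and A: "A \<in> bounded_ops"
    then have *: "X \<in> compact_ops" "s_numbers X \<in> S" by auto
    note l = compact_ops_compose_left[OF *(1) A] and r = compact_ops_compose_right[OF *(1) A]
    show "A o\<^sub>L X \<in> ?J"
      using l char_cone_le[OF S *(2) s_numbers_c0_star[OF inf l] s_numbers_compose_left[OF inf *(1) A]] by simp
    show "X o\<^sub>L A \<in> ?J"
      using r char_cone_le[OF S *(2) s_numbers_c0_star[OF inf r] s_numbers_compose_right[OF inf *(1) A]] by simp
  qed auto
qed

text \<open>Makes the definite description meaningful: existence is the construction from a cone,
  and uniqueness holds because an ideal is determined by its singular numbers.\<close>

lemma ideal_with_char_set:
  assumes "char_cone S"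
  shows "op_ideal (ideal_with_char_set S :: ('a \<Rightarrow>\<^sub>L 'a) set)"
    and "char_set (ideal_with_char_set S :: ('a \<Rightarrow>\<^sub>L 'a) set) = S"
proof -
  have "\<exists>!J :: ('a \<Rightarrow>\<^sub>L 'a) set. op_ideal J \<and> char_set J = S"
    using op_ideal_of_char_cone[OF assms] op_ideal_eq_iff by (intro ex_ex1I) blast+
  from theI'[OF this] show "op_ideal (ideal_with_char_set S :: ('a \<Rightarrow>\<^sub>L 'a) set)"
    "char_set (ideal_with_char_set S :: ('a \<Rightarrow>\<^sub>L 'a) set) = S"
    unfolding ideal_with_char_set_def by blast+
qed

lemma op_ideal_zero_iff:
  fixes J :: "('a \<Rightarrow>\<^sub>L 'a) set"
  assumes "op_ideal J"
  shows "J = {0} \<longleftrightarrow> char_set J = {\<lambda>_. 0}"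
proof -
  have "op_ideal ({0} :: ('a \<Rightarrow>\<^sub>L 'a) set)"
    using compact_opsI[of 0 "{0}"] unfolding op_ideal_def
    by (auto simp: bounded_ops_def scaleC.zero_right)
  moreover from char_cone_zero[OF char_cone_char_set[OF this]]
  have "char_set ({0} :: ('a \<Rightarrow>\<^sub>L 'a) set) = {\<lambda>_. 0}" by (auto simp: char_set_def)
  ultimately show ?thesis using op_ideal_eq_iff[OF assms] by metis
qed

section \<open>Principal ideals\<close>

lemma char_cone_principal:
  assumes \<eta>: "\<eta> \<in> c0_star"
  shows "char_cone {\<xi> \<in> c0_star. \<exists>C m. 0 < m \<and> (\<forall>n. \<xi> n \<le> C * \<eta> (n div m))}"
  unfolding char_cone_def
proof (intro conjI ballI allI impI)
  show "(\<lambda>_. 0) \<in> {\<xi> \<in> c0_star. \<exists>C m. 0 < m \<and> (\<forall>n. \<xi> n \<le> C * \<eta> (n div m))}"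
    using c0_star_zero by (intro CollectI conjI exI[of _ "0::real"] exI[of _ "1::nat"]) auto
next
  fix \<xi> \<zeta> assume "\<xi> \<in> {\<xi> \<in> c0_star. \<exists>C m. 0 < m \<and> (\<forall>n. \<xi> n \<le> C * \<eta> (n div m))}"
    "\<zeta> \<in> {\<xi> \<in> c0_star. \<exists>C m. 0 < m \<and> (\<forall>n. \<xi> n \<le> C * \<eta> (n div m))}"
  then obtain C m D k where *: "\<xi> \<in> c0_star" "\<zeta> \<in> c0_star" "0 < m" "0 < k"
    "\<And>n. \<xi> n \<le> C * \<eta> (n div m)" "\<And>n. \<zeta> n \<le> D * \<eta> (n div k)" by blast
  have "\<xi> n + \<zeta> n \<le> (\<bar>C\<bar> + \<bar>D\<bar>) * \<eta> (n div (m * k))" for n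
  proof -
    have "\<eta> (n div m) \<le> \<eta> (n div (m * k))" "\<eta> (n div k) \<le> \<eta> (n div (m * k))"
      using * by (auto intro!: c0_star_antimono[OF \<eta>] div_le_mono2)
    moreover have "C * \<eta> (n div m) \<le> \<bar>C\<bar> * \<eta> (n div m)" "D * \<eta> (n div k) \<le> \<bar>D\<bar> * \<eta> (n div k)"
      using c0_star_nonneg[OF \<eta>] by (auto intro!: mult_right_mono)
    ultimately show ?thesis using *(5,6)[of n]
      by (smt (verit) distrib_right mult_left_mono)
  qed
  with * show "(\<lambda>n. \<xi> n + \<zeta> n) \<in> {\<xi> \<in> c0_star. \<exists>C m. 0 < m \<and> (\<forall>n. \<xi> n \<le> C * \<eta> (n div m))}"
    by (auto intro!: c0_star_add exI[of _ "\<bar>C\<bar> + \<bar>D\<bar>"] exI[of _ "m * k"])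
next
  fix \<xi> \<zeta> D assume "\<xi> \<in> {\<xi> \<in> c0_star. \<exists>C m. 0 < m \<and> (\<forall>n. \<xi> n \<le> C * \<eta> (n div m))}"
    "\<zeta> \<in> c0_star" "\<forall>n. \<zeta> n \<le> D * \<xi> n"
  then obtain C m where *: "\<xi> \<in> c0_star" "\<zeta> \<in> c0_star" "0 < m"
    "\<And>n. \<xi> n \<le> C * \<eta> (n div m)" "\<And>n. \<zeta> n \<le> D * \<xi> n" by blast
  have "\<zeta> n \<le> (\<bar>D\<bar> * C) * \<eta> (n div m)" for n
  proof -
    have "\<zeta> n \<le> \<bar>D\<bar> * \<xi> n"
      using *(5)[of n] mult_right_mono[OF abs_ge_self[of D] c0_star_nonneg[OF *(1), of n]] by simp
    also have "\<dots> \<le> \<bar>D\<bar> * (C * \<eta> (n div m))" using * by (intro mult_left_mono) auto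
    finally show ?thesis by simp
  qed
  with * show "\<zeta> \<in> {\<xi> \<in> c0_star. \<exists>C m. 0 < m \<and> (\<forall>n. \<xi> n \<le> C * \<eta> (n div m))}" by blast
next
  fix \<xi> assume "\<xi> \<in> {\<xi> \<in> c0_star. \<exists>C m. 0 < m \<and> (\<forall>n. \<xi> n \<le> C * \<eta> (n div m))}"
  then obtain C m where *: "\<xi> \<in> c0_star" "0 < m" "\<And>n. \<xi> n \<le> C * \<eta> (n div m)" by blast
  then have "\<xi> (n div 2) \<le> C * \<eta> (n div (2 * m))" for n
    by (metis div_mult2_eq)
  then show "(\<lambda>n. \<xi> (n div 2)) \<in> {\<xi> \<in> c0_star. \<exists>C m. 0 < m \<and> (\<forall>n. \<xi> n \<le> C * \<eta> (n div m))}"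
    using c0_star_ampliation[OF *(1), of 2] *(2) by (auto intro!: exI[of _ C] exI[of _ "2 * m"])
qed auto

text \<open>Iterated doubling gives ampliations by powers of 2, and the one by \<open>2 ^ m\<close>
  dominates the one by m because the sequence is nonincreasing.\<close>

lemma char_cone_ampliation:
  assumes S: "char_cone S" and \<eta>: "\<eta> \<in> S" and m: "0 < m"
  shows "(\<lambda>n. \<eta> (n div m)) \<in> S"
proof -
  have pow: "(\<lambda>n. \<eta> (n div 2 ^ k)) \<in> S" for k
  proof (induction k)
    case (Suc k)
    from char_cone_double[OF S this] show ?case by (simp add: div_mult2_eq)
  qed (use \<eta> in simp)
  note \<eta>' = char_cone_c0_star[OF S \<eta>]
  have "m \<le> 2 ^ m" by (simp add: less_imp_le)
  then have "\<eta> (n div m) \<le> 1 * \<eta> (n div 2 ^ m)" for n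
    using m by (simp add: c0_star_antimono[OF \<eta>'] div_le_mono2)
  then show ?thesis by (rule char_cone_le[OF S pow c0_star_ampliation[OF \<eta>' m]])
qed

text \<open>Any ideal containing the generator contains its ampliations and what they dominate;
  conversely these sequences already form a cone, whose ideal contains the generator.\<close>

theorem principal_ideal_char_set:
  fixes I :: "('a \<Rightarrow>\<^sub>L 'a) set"
  assumes "principal_ideal I"
  obtains \<eta> where "op_ideal I" "\<eta> \<in> char_set I"
    "char_set I = {\<xi> \<in> c0_star. \<exists>C m. 0 < m \<and> (\<forall>n. \<xi> n \<le> C * \<eta> (n div m))}"
proof -
  from assms obtain X where X: "X \<in> compact_ops" and I: "I = \<Inter>{J. op_ideal J \<and> X \<in> J}"
    unfolding principal_ideal_def by blast
  define \<eta> where "\<eta> = s_numbers X"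
  have \<eta>: "\<eta> \<in> c0_star" unfolding \<eta>_def by (rule s_numbers_c0_star[OF inf X])
  define S where "S = {\<xi> \<in> c0_star. \<exists>C m. 0 < m \<and> (\<forall>n. \<xi> n \<le> C * \<eta> (n div m))}"
  define J where "J = {Y :: 'a \<Rightarrow>\<^sub>L 'a. Y \<in> compact_ops \<and> s_numbers Y \<in> S}"
  have S: "char_cone S" unfolding S_def by (rule char_cone_principal[OF \<eta>])
  have J: "op_ideal J" "char_set J = S" unfolding J_def by (rule op_ideal_of_char_cone[OF S])+
  have "\<eta> \<in> S" unfolding S_def using \<eta> by (auto intro!: exI[of _ 1])
  then have "X \<in> J" using X by (simp add: J_def \<eta>_def)
  then have "I \<subseteq> J" using J I by blast
  have oI: "op_ideal I"
    unfolding op_ideal_def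
  proof (intro conjI)
    show "I \<subseteq> compact_ops" using \<open>I \<subseteq> J\<close> J_def by blast
    show "0 \<in> I" unfolding I op_ideal_def by blast
    show "\<forall>X\<in>I. \<forall>Y\<in>I. X + Y \<in> I" unfolding I op_ideal_def by blast
    show "\<forall>X\<in>I. \<forall>A\<in>bounded_ops. A o\<^sub>L X \<in> I \<and> X o\<^sub>L A \<in> I" unfolding I op_ideal_def by blast
  qed
  have "X \<in> I" using I by blast
  then have mem: "\<eta> \<in> char_set I" by (simp add: \<eta>_def char_set_def)
  have "char_set I \<subseteq> S" using \<open>I \<subseteq> J\<close> op_ideal_subset_iff[OF oI J(1)] J(2) by simp
  moreover have "S \<subseteq> char_set I"
  proof
    fix \<xi> assume "\<xi> \<in> S"
    then obtain C m where "\<xi> \<in> c0_star" "0 < m" "\<And>n. \<xi> n \<le> C * \<eta> (n div m)" unfolding S_def by blast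
    then show "\<xi> \<in> char_set I"
      using char_cone_le[OF char_cone_char_set[OF oI] char_cone_ampliation[OF char_cone_char_set[OF oI] mem]] by blast
  qed
  ultimately show ?thesis using that[OF oI mem] unfolding S_def by blast
qed

end

subsection \<open>Arithmetic means of sequences\<close>

lemma quotient_le_iff:
  fixes a b C :: real
  shows "a / real (Suc n) \<le> C * (b / real (Suc n)) \<longleftrightarrow> a \<le> C * b"
  by (simp add: divide_le_cancel del: of_nat_Suc)

lemma sum_arith_mean: "(\<Sum>j\<le>n. \<xi> j) = real (Suc n) * arith_mean \<xi> n"
  by (simp add: arith_mean_def)

lemma arith_mean_zero: "arith_mean (\<lambda>_. 0) = (\<lambda>_. 0)"
  by (simp add: arith_mean_def fun_eq_iff)

lemma arith_mean_add: "arith_mean (\<lambda>n. \<xi> n + \<eta> n) = (\<lambda>n. arith_mean \<xi> n + arith_mean \<eta> n)"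
  by (simp add: arith_mean_def fun_eq_iff sum.distrib add_divide_distrib)

lemma arith_mean_mono:
  assumes "\<And>n. \<xi> n \<le> C * \<eta> n" shows "arith_mean \<xi> n \<le> C * arith_mean \<eta> n"
  using sum_mono[of "{..n}" \<xi> "\<lambda>n. C * \<eta> n", OF assms]
  by (simp add: arith_mean_def sum_distrib_left[symmetric] divide_right_mono)

lemma arith_mean_nonneg: "\<xi> \<in> c0_star \<Longrightarrow> 0 \<le> arith_mean \<xi> n"
  unfolding arith_mean_def by (intro divide_nonneg_nonneg sum_nonneg) (auto simp: c0_star_nonneg)

lemma sum_ge_mult_last:
  assumes "\<xi> \<in> c0_star" shows "real (Suc n) * \<xi> n \<le> (\<Sum>j\<le>n. \<xi> j)"
  using sum_mono[of "{..n}" "\<lambda>_. \<xi> n" \<xi>] c0_star_antimono[OF assms] by simp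

lemma le_arith_mean: "\<xi> \<in> c0_star \<Longrightarrow> \<xi> n \<le> arith_mean \<xi> n"
  using sum_ge_mult_last[of \<xi> n] by (simp add: arith_mean_def field_simps)

lemma arith_mean_tendsto_zero:
  assumes "\<xi> \<in> c0_star" shows "arith_mean \<xi> \<longlonglongrightarrow> 0"
proof (rule LIMSEQ_I)
  fix r :: real assume r: "0 < r"
  then have "\<forall>\<^sub>F n in sequentially. \<xi> n < r / 2"
    by (intro order_tendstoD(2)[OF c0_star_tendsto[OF assms]]) simp
  then obtain N where N: "\<And>n. n \<ge> N \<Longrightarrow> \<xi> n < r / 2" by (auto simp: eventually_sequentially)
  define A where "A = (\<Sum>j<N. \<xi> j)"
  have bound: "(\<Sum>j\<le>n. \<xi> j) \<le> A + real (Suc n) * (r / 2)" for n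
  proof -
    have "(\<Sum>j\<le>n. \<xi> j) \<le> (\<Sum>j\<le>n. (if j < N then \<xi> j else 0) + r / 2)"
      using N r by (intro sum_mono) (auto simp: less_imp_le not_less)
    also have "\<dots> = (\<Sum>j\<le>n. if j < N then \<xi> j else 0) + real (Suc n) * (r / 2)"
      by (simp add: sum.distrib)
    also have "(\<Sum>j\<le>n. if j < N then \<xi> j else 0) = (\<Sum>j\<in>{..n} \<inter> {j. j < N}. \<xi> j)"
      by (simp add: sum.If_cases)
    also have "\<dots> \<le> A"
      unfolding A_def using c0_star_nonneg[OF assms] by (intro sum_mono2) auto
    finally show ?thesis by simp
  qed
  obtain M where M: "2 * A / r < real M" using reals_Archimedean2 by blast
  have "norm (arith_mean \<xi> n - 0) < r" if "n \<ge> M" for n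
  proof -
    have "2 * A / r < real (Suc n)" using M that by simp
    then have "A < real (Suc n) * (r / 2)" using r by (simp add: field_simps)
    then have "(\<Sum>j\<le>n. \<xi> j) < real (Suc n) * r" using bound[of n] by (simp add: field_simps)
    then have "arith_mean \<xi> n < r" by (simp add: arith_mean_def divide_less_eq mult.commute)
    then show ?thesis using arith_mean_nonneg[OF assms, of n] by simp
  qed
  then show "\<exists>no. \<forall>n\<ge>no. norm (arith_mean \<xi> n - 0) < r" by blast
qed

lemma arith_mean_c0_star:
  assumes "\<xi> \<in> c0_star" shows "arith_mean \<xi> \<in> c0_star"
proof (rule c0_starI[OF arith_mean_nonneg[OF assms] _ arith_mean_tendsto_zero[OF assms]])
  fix n
  have "\<xi> (Suc n) \<le> arith_mean \<xi> n"
    using le_arith_mean[OF assms, of n] c0_star_antimono[OF assms, of n "Suc n"] by simp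
  moreover have "real (Suc (Suc n)) * arith_mean \<xi> (Suc n) = real (Suc n) * arith_mean \<xi> n + \<xi> (Suc n)"
    by (simp only: sum_arith_mean[symmetric] sum.atMost_Suc)
  ultimately have "real (Suc (Suc n)) * arith_mean \<xi> (Suc n) \<le> real (Suc (Suc n)) * arith_mean \<xi> n"
    by (simp add: algebra_simps)
  then show "arith_mean \<xi> (Suc n) \<le> arith_mean \<xi> n" by simp
qed

text \<open>The sum is enlarged to n + 1 full blocks of length m, on each of which the ampliated
  sequence is constant. Averaging thus turns an ampliation into a constant factor.\<close>

lemma arith_mean_ampliation:
  assumes "\<xi> \<in> c0_star" "0 < m" shows "arith_mean (\<lambda>n. \<xi> (n div m)) n \<le> real m * arith_mean \<xi> n"
proof -
  have "n < Suc n * m" using assms(2) by (metis lessI less_le_trans mult_le_mono2 mult_numeral_1_right numeral_One Suc_leI One_nat_def)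
  then have "(\<Sum>j\<le>n. \<xi> (j div m)) \<le> (\<Sum>j<Suc n * m. \<xi> (j div m))"
    using c0_star_nonneg[OF assms(1)] by (intro sum_mono2) auto
  also have "\<dots> = (\<Sum>k<Suc n. \<Sum>j=k*m..<k*m+m. \<xi> (j div m))"
    by (rule sum.nat_group[symmetric])
  also have "\<dots> = (\<Sum>k<Suc n. real m * \<xi> k)"
  proof (rule sum.cong[OF refl])
    fix k
    have "(\<Sum>j=k*m..<k*m+m. \<xi> (j div m)) = (\<Sum>j=k*m..<k*m+m. \<xi> k)"
    proof (rule sum.cong[OF refl])
      fix j assume "j \<in> {k*m..<k*m+m}"
      then have "j div m = k"
        by (intro div_nat_eqI) (auto simp: mult.commute)
      then show "\<xi> (j div m) = \<xi> k" by simp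
    qed
    then show "(\<Sum>j=k*m..<k*m+m. \<xi> (j div m)) = real m * \<xi> k" by simp
  qed
  finally have "(\<Sum>j\<le>n. \<xi> (j div m)) \<le> real m * (\<Sum>j\<le>n. \<xi> j)"
    by (simp only: sum_distrib_left lessThan_Suc_atMost)
  then show ?thesis
    unfolding arith_mean_def quotient_le_iff .
qed

text \<open>The numerator does not drop from \<open>n div m\<close> to n, and the denominator grows
  at most by the factor m. This is why domination by such a quotient is invariant under
  ampliation.\<close>

lemma quotient_ampliation:
  fixes g :: "nat \<Rightarrow> real"
  assumes "mono g" "\<And>n. 0 \<le> g n" "0 < m"
  shows "g (n div m) / real (Suc (n div m)) \<le> real m * (g n / real (Suc n))"
proof -
  have "n < m * Suc (n div m)" using dividend_less_times_div[OF assms(3), of n] by simp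
  then have "Suc n \<le> m * Suc (n div m)" by simp
  then have le: "real (Suc n) \<le> real m * real (Suc (n div m))" by (metis of_nat_le_iff of_nat_mult)
  have "g (n div m) * real (Suc n) \<le> g n * (real m * real (Suc (n div m)))"
    using assms by (intro mult_mono le monoD[OF assms(1)]) auto
  then show ?thesis by (simp add: field_simps)
qed

lemma mono_partial_sums: "\<xi> \<in> c0_star \<Longrightarrow> mono (\<lambda>n. \<Sum>j\<le>n. \<xi> j)"
  by (auto simp: mono_iff_le_Suc c0_star_nonneg)

lemma arith_mean_div:
  assumes "\<xi> \<in> c0_star" "0 < m" shows "arith_mean \<xi> (n div m) \<le> real m * arith_mean \<xi> n"
  unfolding arith_mean_def
  using quotient_ampliation[OF mono_partial_sums[OF assms(1)] _ assms(2)] c0_star_nonneg[OF assms(1)]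
  by (simp add: sum_nonneg)

text \<open>Averaging gains a factor logarithmic in \<open>m\<close> between \<open>n\<close> and \<open>m n\<close>, which the constant
  \<open>C\<close> must absorb; hence \<open>g\<close> has to grow.\<close>

lemma doubling_if_mean_bounded:
  fixes g :: "nat \<Rightarrow> real"
  assumes mono: "mono g" and nonneg: "\<And>n. 0 \<le> g n"
    and bound: "\<And>n. arith_mean (\<lambda>j. g j / real (Suc j)) n \<le> C * (g n / real (Suc n))"
  obtains m where "0 < m" "\<And>n. 2 * g n \<le> g (m * Suc n - 1)"
proof -
  have sum: "(\<Sum>j\<le>n. g j / real (Suc j)) \<le> C * g n" for n
    using bound[of n] unfolding arith_mean_def quotient_le_iff .
  \<comment> \<open>Dyadic blocks: the a indices from a to 2 a - 1 each contribute at least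
    \<open>g n / real (2 * a)\<close>, so every block adds half of \<open>g n\<close>.\<close>
  have lower: "real k * (g n / 2) \<le> (\<Sum>j<2 ^ k * Suc n. g j / real (Suc j))" for k n
  proof (induction k)
    case 0
    show ?case using nonneg by (simp add: sum_nonneg)
  next
    case (Suc k)
    define a where "a = 2 ^ k * Suc n"
    have a: "0 < a" "2 ^ Suc k * Suc n = 2 * a" by (simp_all add: a_def)
    have "g n / 2 = (\<Sum>j=a..<2 * a. g n / real (2 * a))"
      using a(1) by (simp add: field_simps)
    also have "\<dots> \<le> (\<Sum>j=a..<2 * a. g j / real (Suc j))"
    proof (rule sum_mono)
      fix j assume j: "j \<in> {a..<2 * a}"
      have "1 * Suc n \<le> a" unfolding a_def by (rule mult_le_mono1) simp
      then have "g n \<le> g j" using j by (intro monoD[OF mono]) simp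
      moreover have "real (Suc j) \<le> real (2 * a)" unfolding of_nat_le_iff using j by simp
      ultimately show "g n / real (2 * a) \<le> g j / real (Suc j)"
        using nonneg by (intro frac_le) auto
    qed
    finally have "g n / 2 \<le> (\<Sum>j=a..<2 * a. g j / real (Suc j))" .
    moreover have "(\<Sum>j<2 * a. g j / real (Suc j)) = (\<Sum>j<a. g j / real (Suc j)) + (\<Sum>j=a..<2 * a. g j / real (Suc j))"
      using sum.atLeastLessThan_concat[of 0 a "2 * a" "\<lambda>j. g j / real (Suc j)"]
      by (simp add: atLeast0LessThan)
    moreover have "real k * (g n / 2) \<le> (\<Sum>j<a. g j / real (Suc j))" unfolding a_def by (rule Suc.IH)
    moreover have "real (Suc k) * (g n / 2) = real k * (g n / 2) + g n / 2"
      by (simp only: of_nat_Suc distrib_right mult_1)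
    ultimately show ?case unfolding a(2) by linarith
  qed
  \<comment> \<open>Half of \<open>real k\<close> must exceed twice
    \<open>\<bar>C\<bar> + 1\<close>, so that cancelling this factor leaves the factor 2. The added
    1 makes the cancelled factor positive.\<close>
  obtain k where k: "4 * \<bar>C\<bar> + 4 < real k" using reals_Archimedean2 by blast
  have "2 * g n \<le> g (2 ^ k * Suc n - 1)" for n
  proof -
    define N where "N = 2 ^ k * Suc n - 1"
    have N: "2 ^ k * Suc n = Suc N" by (simp add: N_def)
    have "real k * (g n / 2) \<le> C * g N"
      using lower[of k n] sum[of N] unfolding N lessThan_Suc_atMost by (rule order_trans)
    also have "\<dots> \<le> (\<bar>C\<bar> + 1) * g N" by (intro mult_right_mono nonneg) auto
    finally have "real k * (g n / 2) \<le> (\<bar>C\<bar> + 1) * g N" .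
    moreover have "(4 * \<bar>C\<bar> + 4) * (g n / 2) \<le> real k * (g n / 2)"
      using k nonneg by (intro mult_right_mono) auto
    ultimately have "(\<bar>C\<bar> + 1) * (2 * g n) \<le> (\<bar>C\<bar> + 1) * g N" by (simp add: algebra_simps)
    then have "2 * g n \<le> g N" by (rule mult_left_le_imp_le) (simp add: add_nonneg_pos)
    then show ?thesis by (simp only: N_def)
  qed
  then show ?thesis by (intro that[of "2 ^ k"]) auto
qed

text \<open>The partial sums of \<open>\<kappa>\<close> are the infimum of the affine majorants
  \<open>n \<mapsto> (1 + (n + 1) / (k + 1)) g k\<close> of \<open>g\<close>.\<close>

lemma quasi_concave_arith_mean:
  fixes g :: "nat \<Rightarrow> real"
  assumes mono: "mono g" and h: "(\<lambda>n. g n / real (Suc n)) \<in> c0_star"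
  obtains \<kappa> where "\<kappa> \<in> c0_star" "\<And>n. g n / real (Suc n) \<le> arith_mean \<kappa> n"
    "\<And>n. arith_mean \<kappa> n \<le> 2 * (g n / real (Suc n))"
proof -
  have nonneg: "0 \<le> g n" for n using c0_star_nonneg[OF h, of n] by (simp add: zero_le_divide_iff)
  define l where "l n k = (1 + real (Suc n) / real (Suc k)) * g k" for n k
  define A where "A n = (INF k. l n k)" for n
  have bdd: "bdd_below (range (l n))" for n
    by (rule bdd_belowI[of _ 0]) (auto simp: l_def nonneg intro!: mult_nonneg_nonneg add_nonneg_nonneg)
  have A_le: "A n \<le> l n k" for n k unfolding A_def by (rule cINF_lower[OF bdd]) simp
  have le_A: "c \<le> A n" if "\<And>k. c \<le> l n k" for c n unfolding A_def using that by (intro cINF_greatest) auto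
  \<comment> \<open>An infimum of increasing affine functions is nondecreasing and concave, so these
    increments are nonnegative and nonincreasing.\<close>
  define \<kappa> where "\<kappa> = rec_nat (A 0) (\<lambda>n _. A (Suc n) - A n)"
  have \<kappa>: "\<kappa> 0 = A 0" "\<kappa> (Suc n) = A (Suc n) - A n" for n by (simp_all add: \<kappa>_def)
  have sum: "(\<Sum>j\<le>n. \<kappa> j) = A n" for n by (induction n) (simp_all add: \<kappa>)
  \<comment> \<open>Up to k the constant part of the majorant suffices because g is nondecreasing;
    beyond k the linear part does because \<open>g n / real (Suc n)\<close> is
    nonincreasing.\<close>
  have gA: "g n \<le> A n" for n
  proof (rule le_A)
    fix k show "g n \<le> l n k"
    proof (cases "n \<le> k")
      case True
      have "g n \<le> g k" by (rule monoD[OF mono True])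
      also have "\<dots> \<le> l n k" using nonneg[of k] by (simp add: l_def distrib_right)
      finally show ?thesis .
    next
      case False
      then have "g n / real (Suc n) \<le> g k / real (Suc k)" using c0_star_antimono[OF h, of k n] by simp
      then have "g n \<le> real (Suc n) / real (Suc k) * g k" by (simp add: field_simps)
      also have "\<dots> \<le> l n k" using nonneg[of k] by (simp add: l_def distrib_right)
      finally show ?thesis .
    qed
  qed
  have Ag: "A n \<le> 2 * g n" for n using A_le[of n n] by (simp add: l_def)
  have \<kappa>_nonneg: "0 \<le> \<kappa> n" for n
  proof (cases n)
    case 0
    then show ?thesis using gA[of 0] nonneg[of 0] by (simp add: \<kappa>)
  next
    case (Suc m)
    have "A m \<le> A (Suc m)"
    proof (rule le_A)
      fix k
      have "l m k \<le> l (Suc m) k" unfolding l_def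
        by (intro mult_right_mono nonneg add_left_mono divide_right_mono) auto
      then show "A m \<le> l (Suc m) k" using A_le[of m k] by simp
    qed
    then show ?thesis by (simp add: Suc \<kappa>)
  qed
  have \<kappa>_dec: "\<kappa> (Suc n) \<le> \<kappa> n" for n
  proof (cases n)
    case 0
    \<comment> \<open>The first increment is the whole of \<open>A 0\<close>, so concavity alone
      does not compare it with the next one. The nonnegative constant term of each majorant
      does.\<close>
    have "A 1 / 2 \<le> A 0"
    proof (rule le_A)
      fix k
      have "l 1 k \<le> 2 * l 0 k" using nonneg[of k] by (simp add: l_def field_simps)
      then show "A 1 / 2 \<le> l 0 k" using A_le[of 1 k] by simp
    qed
    then show ?thesis by (simp add: 0 \<kappa>)
  next
    case (Suc m)
    have "(A (Suc (Suc m)) + A m) / 2 \<le> A (Suc m)"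
    proof (rule le_A)
      fix k
      have "l (Suc (Suc m)) k + l m k = 2 * l (Suc m) k"
        by (simp add: l_def algebra_simps add_divide_distrib)
      then show "(A (Suc (Suc m)) + A m) / 2 \<le> l (Suc m) k" using A_le[of "Suc (Suc m)" k] A_le[of m k] by simp
    qed
    then show ?thesis by (simp add: Suc \<kappa>)
  qed
  have upper: "arith_mean \<kappa> n \<le> 2 * (g n / real (Suc n))" for n
    using Ag[of n] by (simp add: arith_mean_def sum divide_right_mono)
  have "\<kappa> n \<le> arith_mean \<kappa> n" for n
  proof -
    have "antimono \<kappa>" using \<kappa>_dec by (simp add: decseq_Suc_iff)
    then have "(\<Sum>j\<le>n. \<kappa> n) \<le> (\<Sum>j\<le>n. \<kappa> j)" by (intro sum_mono) (auto dest: antimonoD)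
    then show ?thesis by (simp add: arith_mean_def field_simps)
  qed
  then have \<kappa>_le: "\<kappa> n \<le> 2 * (g n / real (Suc n))" for n using upper order_trans by blast
  have "\<kappa> \<longlonglongrightarrow> 0"
  proof (rule tendsto_sandwich[OF always_eventually always_eventually tendsto_const])
    show "\<forall>n. 0 \<le> \<kappa> n" "\<forall>n. \<kappa> n \<le> 2 * (g n / real (Suc n))" using \<kappa>_nonneg \<kappa>_le by blast+
    show "(\<lambda>n. 2 * (g n / real (Suc n))) \<longlonglongrightarrow> 0"
      using tendsto_mult[OF tendsto_const[of 2] c0_star_tendsto[OF h]] by simp
  qed
  then have "\<kappa> \<in> c0_star" by (intro c0_starI \<kappa>_nonneg \<kappa>_dec)
  moreover have "g n / real (Suc n) \<le> arith_mean \<kappa> n" for n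
    using gA[of n] by (simp add: arith_mean_def sum divide_right_mono)
  ultimately show ?thesis using that upper by blast
qed

text \<open>The classical regularity of a sequence, free of ampliations; for a generator it is the
  criterion for stability of the principal ideal.\<close>

definition regular :: "(nat \<Rightarrow> real) \<Rightarrow> bool" where
  "regular \<eta> \<longleftrightarrow> (\<exists>C. \<forall>n. arith_mean \<eta> n \<le> C * \<eta> n)"

text \<open>When partial sums double between n and \<open>m * Suc n - 1\<close>, the terms in
  between sum to at least the first n + 1 terms. There are at most \<open>m * Suc n\<close> of them,
  each at most \<open>\<eta> n\<close>.\<close>

lemma regular_if_arith_mean_regular:
  assumes \<eta>: "\<eta> \<in> c0_star" and "regular (arith_mean \<eta>)"
  shows "regular \<eta>"
proof -
  obtain C where C: "\<And>n. arith_mean (arith_mean \<eta>) n \<le> C * arith_mean \<eta> n"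
    using assms(2) unfolding regular_def by blast
  obtain m where m: "0 < m" "\<And>n. 2 * (\<Sum>j\<le>n. \<eta> j) \<le> (\<Sum>j\<le>m * Suc n - 1. \<eta> j)"
    using doubling_if_mean_bounded[OF mono_partial_sums[OF \<eta>], of C] C c0_star_nonneg[OF \<eta>]
    unfolding arith_mean_def by (auto simp: sum_nonneg)
  have "arith_mean \<eta> n \<le> real m * \<eta> n" for n
  proof -
    let ?N = "m * Suc n - 1"
    have N: "n \<le> ?N" "?N - n \<le> m * Suc n" using m(1) by (cases m; simp)+
    have "(\<Sum>j\<le>?N. \<eta> j) = (\<Sum>j\<le>n. \<eta> j) + (\<Sum>j\<in>{..?N} - {..n}. \<eta> j)"
      using N(1) by (subst sum.subset_diff[of "{..n}"]) auto
    then have "(\<Sum>j\<le>n. \<eta> j) \<le> (\<Sum>j\<in>{..?N} - {..n}. \<eta> j)" using m(2)[of n] by simp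
    also have "\<dots> \<le> real (card ({..?N} - {..n})) * \<eta> n"
      using c0_star_antimono[OF \<eta>] by (intro sum_bounded_above) auto
    also have "\<dots> \<le> real (m * Suc n) * \<eta> n"
    proof (intro mult_right_mono c0_star_nonneg[OF \<eta>])
      have "card ({..?N} - {..n}) \<le> card {..?N}" by (intro card_mono) auto
      also have "\<dots> = m * Suc n" using m(1) by simp
      finally show "real (card ({..?N} - {..n})) \<le> real (m * Suc n)" by (simp only: of_nat_le_iff)
    qed
    finally show ?thesis by (simp add: arith_mean_def field_simps)
  qed
  then show ?thesis unfolding regular_def by blast
qed

subsection \<open>Upper and lower quasi-concave envelopes\<close>

text \<open>\<open>upper_env \<eta>\<close> is up to constants the smallest arithmetic mean dominating \<open>\<eta>\<close>, and
  \<open>lower_env \<eta>\<close> the largest one dominated by \<open>\<eta>\<close>.\<close>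

definition upper_max :: "(nat \<Rightarrow> real) \<Rightarrow> nat \<Rightarrow> real" where
  "upper_max \<eta> n = Max ((\<lambda>k. real (Suc k) * \<eta> k) ` {..n})"

definition upper_env :: "(nat \<Rightarrow> real) \<Rightarrow> nat \<Rightarrow> real" where
  "upper_env \<eta> n = upper_max \<eta> n / real (Suc n)"

definition lower_inf :: "(nat \<Rightarrow> real) \<Rightarrow> nat \<Rightarrow> real" where
  "lower_inf \<eta> n = (INF k\<in>{n..}. real (Suc k) * \<eta> k)"

definition lower_env :: "(nat \<Rightarrow> real) \<Rightarrow> nat \<Rightarrow> real" where
  "lower_env \<eta> n = lower_inf \<eta> n / real (Suc n)"

lemma upper_max_ge: "k \<le> n \<Longrightarrow> real (Suc k) * \<eta> k \<le> upper_max \<eta> n"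
  unfolding upper_max_def by (intro Max_ge) auto

lemma upper_max_le: "(\<And>k. k \<le> n \<Longrightarrow> real (Suc k) * \<eta> k \<le> c) \<Longrightarrow> upper_max \<eta> n \<le> c"
  unfolding upper_max_def by (intro Max.boundedI) auto

lemma upper_max_attained: "\<exists>k\<le>n. upper_max \<eta> n = real (Suc k) * \<eta> k"
proof -
  have "upper_max \<eta> n \<in> (\<lambda>k. real (Suc k) * \<eta> k) ` {..n}"
    unfolding upper_max_def by (intro Max_in) auto
  then show ?thesis by (simp only: image_iff atMost_iff) blast
qed

lemma mono_upper_max: "mono (upper_max \<eta>)"
  by (intro monoI upper_max_le upper_max_ge) simp

lemma upper_max_nonneg: "\<eta> \<in> c0_star \<Longrightarrow> 0 \<le> upper_max \<eta> n"
  using upper_max_ge[of 0 n \<eta>] c0_star_nonneg[of \<eta> 0] by simp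

lemma upper_env_ge: "\<eta> n \<le> upper_env \<eta> n"
  using upper_max_ge[of n n \<eta>] by (simp add: upper_env_def field_simps)

text \<open>This is the minimality of the envelope: partial sums are nondecreasing, so a bound at k
  passes on to every later n and hence to the maximum.\<close>

lemma upper_env_le_arith_mean:
  assumes "\<eta> \<in> c0_star" "\<kappa> \<in> c0_star" "\<And>n. \<eta> n \<le> C * arith_mean \<kappa> n" "0 \<le> C"
  shows "upper_env \<eta> n \<le> C * arith_mean \<kappa> n"
proof -
  have "upper_max \<eta> n \<le> C * (\<Sum>j\<le>n. \<kappa> j)"
  proof (rule upper_max_le)
    fix k assume "k \<le> n"
    have "real (Suc k) * \<eta> k \<le> real (Suc k) * (C * arith_mean \<kappa> k)"
      using assms(3) by (intro mult_left_mono) auto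
    also have "\<dots> = C * (\<Sum>j\<le>k. \<kappa> j)" by (simp add: arith_mean_def)
    also have "\<dots> \<le> C * (\<Sum>j\<le>n. \<kappa> j)"
      using monoD[OF mono_partial_sums[OF assms(2)] \<open>k \<le> n\<close>] assms(4) by (rule mult_left_mono)
    finally show "real (Suc k) * \<eta> k \<le> C * (\<Sum>j\<le>n. \<kappa> j)" .
  qed
  then show ?thesis unfolding upper_env_def arith_mean_def quotient_le_iff .
qed

lemma upper_env_c0_star:
  assumes \<eta>: "\<eta> \<in> c0_star" shows "upper_env \<eta> \<in> c0_star"
proof (rule c0_starI)
  show nn: "0 \<le> upper_env \<eta> n" for n by (simp add: upper_env_def upper_max_nonneg[OF \<eta>])
  show "upper_env \<eta> (Suc n) \<le> upper_env \<eta> n" for n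
  proof -
    obtain k where k: "k \<le> Suc n" "upper_max \<eta> (Suc n) = real (Suc k) * \<eta> k"
      using upper_max_attained by blast
    show ?thesis
    proof (cases "k \<le> n")
      case True
      then have "upper_max \<eta> (Suc n) \<le> upper_max \<eta> n" using k upper_max_ge by simp
      then show ?thesis unfolding upper_env_def using upper_max_nonneg[OF \<eta>] by (intro frac_le) auto
    next
      case False
      then have "upper_env \<eta> (Suc n) = \<eta> (Suc n)" using k by (simp add: upper_env_def le_Suc_eq del: of_nat_Suc)
      also have "\<dots> \<le> \<eta> n" by (rule c0_star_antimono[OF \<eta>]) simp
      finally show ?thesis using upper_env_ge[of \<eta> n] by simp
    qed
  qed
  show "upper_env \<eta> \<longlonglongrightarrow> 0"
  proof (rule tendsto_sandwich[OF always_eventually always_eventually tendsto_const arith_mean_tendsto_zero[OF \<eta>]])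
    show "\<forall>n. 0 \<le> upper_env \<eta> n" using nn by blast
    show "\<forall>n. upper_env \<eta> n \<le> arith_mean \<eta> n"
      using upper_env_le_arith_mean[OF \<eta> \<eta>, of 1] le_arith_mean[OF \<eta>] by simp
  qed
qed

lemma upper_env_mono:
  assumes "\<And>n. \<xi> n \<le> C * \<eta> n" "0 \<le> C" shows "upper_env \<xi> n \<le> C * upper_env \<eta> n"
proof -
  have "upper_max \<xi> n \<le> C * upper_max \<eta> n"
  proof (rule upper_max_le)
    fix k assume "k \<le> n"
    have "real (Suc k) * \<xi> k \<le> C * (real (Suc k) * \<eta> k)"
      using mult_left_mono[OF assms(1)[of k], of "real (Suc k)"] by (simp add: mult_ac)
    also have "\<dots> \<le> C * upper_max \<eta> n" using \<open>k \<le> n\<close> assms(2) by (intro mult_left_mono upper_max_ge)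
    finally show "real (Suc k) * \<xi> k \<le> C * upper_max \<eta> n" .
  qed
  then show ?thesis unfolding upper_env_def quotient_le_iff .
qed

text \<open>Here the ampliation sits inside the envelope, in \<open>upper_env_div\<close> outside
  it. The first compares different generators of a principal set, the second gives invariance of the
  hull under ampliation.\<close>

lemma upper_env_ampliation:
  assumes \<eta>: "\<eta> \<in> c0_star" and m: "0 < m"
  shows "upper_env (\<lambda>n. \<eta> (n div m)) n \<le> real m * upper_env \<eta> n"
proof -
  have "upper_max (\<lambda>n. \<eta> (n div m)) n \<le> real m * upper_max \<eta> n"
  proof (rule upper_max_le)
    fix k assume "k \<le> n"
    have "k < m * Suc (k div m)" using dividend_less_times_div[OF m, of k] by simp
    then have "Suc k \<le> m * Suc (k div m)" by simp
    then have "real (Suc k) \<le> real m * real (Suc (k div m))" by (metis of_nat_le_iff of_nat_mult)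
    then have "real (Suc k) * \<eta> (k div m) \<le> real m * (real (Suc (k div m)) * \<eta> (k div m))"
      using mult_right_mono c0_star_nonneg[OF \<eta>] by (metis mult.assoc)
    also have "\<dots> \<le> real m * upper_max \<eta> n"
      using \<open>k \<le> n\<close> by (intro mult_left_mono upper_max_ge) (auto intro: le_trans[OF div_le_dividend])
    finally show "real (Suc k) * \<eta> (k div m) \<le> real m * upper_max \<eta> n" .
  qed
  then show ?thesis unfolding upper_env_def quotient_le_iff .
qed

lemma upper_env_div:
  assumes "\<eta> \<in> c0_star" "0 < m" shows "upper_env \<eta> (n div m) \<le> real m * upper_env \<eta> n"
  unfolding upper_env_def
  by (rule quotient_ampliation[OF mono_upper_max upper_max_nonneg[OF assms(1)] assms(2)])

text \<open>By doubling, the maximum up to \<open>m * Suc n - 1\<close> is attained beyond n unless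
  it is 0 up to n. There \<eta> is at most \<open>\<eta> n\<close> and the weight at most
  \<open>m * Suc n\<close>, so the envelope is O(\<eta>), and \<eta> inherits its
  regularity.\<close>

lemma regular_if_upper_env_regular:
  assumes \<eta>: "\<eta> \<in> c0_star" and "regular (upper_env \<eta>)"
  shows "regular \<eta>"
proof -
  obtain C where C: "\<And>n. arith_mean (upper_env \<eta>) n \<le> C * upper_env \<eta> n"
    using assms(2) unfolding regular_def by blast
  obtain m where m: "0 < m" "\<And>n. 2 * upper_max \<eta> n \<le> upper_max \<eta> (m * Suc n - 1)"
    using doubling_if_mean_bounded[OF mono_upper_max upper_max_nonneg[OF \<eta>], of C] C
    unfolding upper_env_def by blast
  have upper: "upper_env \<eta> n \<le> real m * \<eta> n" for n
  proof -
    obtain k where k: "k \<le> m * Suc n - 1" "upper_max \<eta> (m * Suc n - 1) = real (Suc k) * \<eta> k"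
      using upper_max_attained by blast
    have "upper_max \<eta> n \<le> real (m * Suc n) * \<eta> n"
    proof (cases "k \<le> n")
      case True
      then have "2 * upper_max \<eta> n \<le> upper_max \<eta> n" using m(2)[of n] k(2) upper_max_ge[of k n \<eta>] by simp
      then have "upper_max \<eta> n \<le> 0" by simp
      also have "\<dots> \<le> real (m * Suc n) * \<eta> n" by (intro mult_nonneg_nonneg c0_star_nonneg[OF \<eta>]) simp
      finally show ?thesis .
    next
      case False
      have "Suc k \<le> m * Suc n" using k(1) m(1) by (cases m) auto
      then have "real (Suc k) * \<eta> k \<le> real (m * Suc n) * \<eta> n"
        using False c0_star_nonneg[OF \<eta>] c0_star_antimono[OF \<eta>, of n k]
        by (intro mult_mono) (simp_all only: of_nat_le_iff of_nat_0_le_iff)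
      then show ?thesis using m(2)[of n] k(2) upper_max_nonneg[OF \<eta>, of n] by simp
    qed
    then show ?thesis by (simp add: upper_env_def field_simps)
  qed
  have "arith_mean \<eta> n \<le> (\<bar>C\<bar> * real m) * \<eta> n" for n
  proof -
    have "arith_mean \<eta> n \<le> 1 * arith_mean (upper_env \<eta>) n"
      by (rule arith_mean_mono) (simp add: upper_env_ge)
    also have "\<dots> \<le> C * upper_env \<eta> n" using C[of n] by simp
    also have "\<dots> \<le> \<bar>C\<bar> * upper_env \<eta> n"
      by (intro mult_right_mono c0_star_nonneg[OF upper_env_c0_star[OF \<eta>]]) simp
    also have "\<dots> \<le> \<bar>C\<bar> * (real m * \<eta> n)" by (intro mult_left_mono upper) simp
    finally show ?thesis by simp
  qed
  then show ?thesis unfolding regular_def by blast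
qed

section \<open>The lower envelope\<close>

lemma bdd_below_lower: "\<eta> \<in> c0_star \<Longrightarrow> bdd_below ((\<lambda>k. real (Suc k) * \<eta> k) ` S)"
  by (rule bdd_belowI2[of _ 0]) (simp add: c0_star_nonneg)

lemma lower_inf_le: "\<eta> \<in> c0_star \<Longrightarrow> n \<le> k \<Longrightarrow> lower_inf \<eta> n \<le> real (Suc k) * \<eta> k"
  unfolding lower_inf_def by (intro cINF_lower bdd_below_lower) auto

lemma lower_inf_ge: "(\<And>k. n \<le> k \<Longrightarrow> c \<le> real (Suc k) * \<eta> k) \<Longrightarrow> c \<le> lower_inf \<eta> n"
  unfolding lower_inf_def by (intro cINF_greatest) auto

lemma lower_inf_nonneg: "\<eta> \<in> c0_star \<Longrightarrow> 0 \<le> lower_inf \<eta> n"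
  by (intro lower_inf_ge) (simp add: c0_star_nonneg)

lemma mono_lower_inf: "\<eta> \<in> c0_star \<Longrightarrow> mono (lower_inf \<eta>)"
  by (intro monoI lower_inf_ge lower_inf_le) auto

lemma lower_env_le: "\<eta> \<in> c0_star \<Longrightarrow> lower_env \<eta> n \<le> \<eta> n"
  using lower_inf_le[of \<eta> n n] by (simp add: lower_env_def field_simps)

lemma lower_env_c0_star:
  assumes \<eta>: "\<eta> \<in> c0_star" shows "lower_env \<eta> \<in> c0_star"
proof (rule c0_starI)
  show nn: "0 \<le> lower_env \<eta> n" for n by (simp add: lower_env_def lower_inf_nonneg[OF \<eta>])
  show "lower_env \<eta> (Suc n) \<le> lower_env \<eta> n" for n
  proof -
    \<comment> \<open>Only the term k = n is absent from the infimum at \<open>Suc n\<close>; it is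
      handled by monotonicity of \<eta>.\<close>
    have "real (Suc n) * lower_env \<eta> (Suc n) \<le> lower_inf \<eta> n"
    proof (rule lower_inf_ge)
      fix k assume "n \<le> k"
      show "real (Suc n) * lower_env \<eta> (Suc n) \<le> real (Suc k) * \<eta> k"
      proof (cases "k = n")
        case True
        have "lower_env \<eta> (Suc n) \<le> \<eta> n"
          using lower_env_le[OF \<eta>, of "Suc n"] c0_star_antimono[OF \<eta>, of n "Suc n"] by simp
        then show ?thesis using True by (simp add: mult_left_mono)
      next
        case False
        have "real (Suc n) * lower_env \<eta> (Suc n) \<le> real (Suc (Suc n)) * lower_env \<eta> (Suc n)"
          using nn by (intro mult_right_mono) auto
        also have "\<dots> = lower_inf \<eta> (Suc n)" by (simp add: lower_env_def)
        also have "\<dots> \<le> real (Suc k) * \<eta> k" using False \<open>n \<le> k\<close> by (intro lower_inf_le[OF \<eta>]) simp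
        finally show ?thesis .
      qed
    qed
    then show ?thesis unfolding lower_env_def[of _ n] by (simp add: field_simps)
  qed
  show "lower_env \<eta> \<longlonglongrightarrow> 0"
    by (rule tendsto_sandwich[OF always_eventually always_eventually tendsto_const c0_star_tendsto[OF \<eta>]])
       (use nn lower_env_le[OF \<eta>] in blast)+
qed

text \<open>The ampliation disappears at the indices \<open>m * k\<close>, where
  \<open>m * k div m\<close> is k. Partial sums at n are bounded by those at \<open>m * k\<close>,
  at the cost of a factor m. Thus the envelope is maximal even with ampliations allowed.\<close>

lemma arith_mean_le_lower_env:
  assumes \<eta>: "\<eta> \<in> c0_star" and \<kappa>: "\<kappa> \<in> c0_star" and m: "0 < m" and C: "0 \<le> C"
    and le: "\<And>n. arith_mean \<kappa> n \<le> C * \<eta> (n div m)"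
  shows "arith_mean \<kappa> n \<le> (C * real m) * lower_env \<eta> n"
proof (cases "C = 0")
  case True
  then show ?thesis using le[of n] by simp
next
  case False
  then have C: "C > 0" using C by simp
  have "(\<Sum>j\<le>n. \<kappa> j) / (C * real m) \<le> lower_inf \<eta> n"
  proof (rule lower_inf_ge)
    fix k assume "n \<le> k"
    also have "k \<le> m * k" using m by simp
    finally have "n \<le> m * k" .
    then have "(\<Sum>j\<le>n. \<kappa> j) \<le> (\<Sum>j\<le>m * k. \<kappa> j)" by (rule monoD[OF mono_partial_sums[OF \<kappa>]])
    also have "\<dots> = real (Suc (m * k)) * arith_mean \<kappa> (m * k)" by (rule sum_arith_mean)
    also have "\<dots> \<le> real (Suc (m * k)) * (C * \<eta> k)"
      using le[of "m * k"] m by (intro mult_left_mono) auto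
    also have "\<dots> \<le> real (m * Suc k) * (C * \<eta> k)"
      using m C c0_star_nonneg[OF \<eta>] by (intro mult_right_mono) (simp_all only: of_nat_le_iff, auto)
    finally show "(\<Sum>j\<le>n. \<kappa> j) / (C * real m) \<le> real (Suc k) * \<eta> k"
      using m C by (simp add: field_simps)
  qed
  then have "(\<Sum>j\<le>n. \<kappa> j) \<le> (C * real m) * lower_inf \<eta> n"
    using m C by (simp add: field_simps)
  then show ?thesis unfolding arith_mean_def lower_env_def quotient_le_iff .
qed

text \<open>The infimum over indices from n is positive and doubles by \<open>m * Suc n - 1\<close>,
  so some k in between comes within the factor 2 of it. Monotonicity then bounds \<eta> at
  \<open>m * Suc n - 1\<close> by the infimum at n. These sparse points suffice, since \<eta> is
  nonincreasing and consecutive ones are within a bounded ratio; so \<eta> is O of its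
  envelope.\<close>

lemma regular_if_lower_env_regular:
  assumes \<eta>: "\<eta> \<in> c0_star" and "regular (lower_env \<eta>)" and pos: "0 < lower_inf \<eta> 0"
  shows "regular \<eta>"
proof -
  obtain C where C: "\<And>n. arith_mean (lower_env \<eta>) n \<le> C * lower_env \<eta> n"
    using assms(2) unfolding regular_def by blast
  obtain m where m: "0 < m" "\<And>n. 2 * lower_inf \<eta> n \<le> lower_inf \<eta> (m * Suc n - 1)"
    using doubling_if_mean_bounded[OF mono_lower_inf[OF \<eta>] lower_inf_nonneg[OF \<eta>], of C] C
    unfolding lower_env_def by blast
  have lpos: "0 < lower_inf \<eta> n" for n
    using pos monoD[OF mono_lower_inf[OF \<eta>], of 0 n] by simp
  have sparse: "real (Suc n) * \<eta> (m * Suc n - 1) \<le> 2 * lower_inf \<eta> n" for n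
  proof -
    have "\<not> 2 * lower_inf \<eta> n \<le> lower_inf \<eta> n" using lpos[of n] by simp
    then obtain k where k: "n \<le> k" "real (Suc k) * \<eta> k < 2 * lower_inf \<eta> n"
      using lower_inf_ge[of n "2 * lower_inf \<eta> n" \<eta>] by fastforce
    have "k < m * Suc n - 1"
    proof (rule ccontr)
      assume "\<not> k < m * Suc n - 1"
      then have "lower_inf \<eta> (m * Suc n - 1) \<le> real (Suc k) * \<eta> k" by (intro lower_inf_le[OF \<eta>]) simp
      then show False using k(2) m(2)[of n] by simp
    qed
    then have "real (Suc n) * \<eta> (m * Suc n - 1) \<le> real (Suc k) * \<eta> k"
      using k(1) c0_star_nonneg[OF \<eta>] c0_star_antimono[OF \<eta>] by (intro mult_mono) auto
    then show ?thesis using k(2) by simp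
  qed
  \<comment> \<open>The first summand is 2 m from the distance to the preceding sparse point times 2
    from \<open>sparse\<close>; the second one covers the indices below m.\<close>
  define D where "D = 4 * real m + \<eta> 0 * real m / lower_inf \<eta> 0"
  have "0 \<le> \<eta> 0 * real m / lower_inf \<eta> 0"
    using pos c0_star_nonneg[OF \<eta>] by (intro divide_nonneg_nonneg mult_nonneg_nonneg) auto
  then have D: "4 * real m \<le> D" "\<eta> 0 * real m / lower_inf \<eta> 0 \<le> D" by (simp_all add: D_def)
  have lower: "\<eta> p \<le> D * lower_env \<eta> p" for p
  proof (cases "p < m")
    case True
    have "real (Suc p) * \<eta> p \<le> real m * \<eta> 0"
      using True c0_star_nonneg[OF \<eta>] c0_star_antimono[OF \<eta>] by (intro mult_mono) auto
    also have "\<dots> = (\<eta> 0 * real m / lower_inf \<eta> 0) * lower_inf \<eta> 0" using pos by simp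
    also have "\<dots> \<le> D * lower_inf \<eta> p"
      using D pos monoD[OF mono_lower_inf[OF \<eta>], of 0 p] \<open>0 \<le> \<eta> 0 * real m / lower_inf \<eta> 0\<close>
      by (intro mult_mono) auto
    finally show ?thesis by (simp add: lower_env_def field_simps)
  next
    case False
    \<comment> \<open>\<open>m * Suc q - 1\<close> is the last sparse point not beyond p. The shift
      by 1 is the passage between counting from 0 and from 1.\<close>
    define q where "q = (p + 1) div m - 1"
    have "1 \<le> (p + 1) div m" using False m(1) by (simp add: div_greater_zero_iff Suc_le_eq)
    then have Sq: "Suc q = (p + 1) div m" by (simp add: q_def)
    have p: "p + 1 = m * Suc q + (p + 1) mod m" by (simp only: Sq mult_div_mod_eq)
    have "m * Suc q - 1 \<le> p" using p by linarith
    have "(p + 1) mod m < m" using m(1) by simp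
    then have "Suc p \<le> m * Suc q + m" using p by linarith
    also have "\<dots> \<le> 2 * m * Suc q" by simp
    finally have "real (Suc p) \<le> 2 * real m * real (Suc q)"
      by (metis of_nat_le_iff of_nat_mult of_nat_numeral)
    moreover have "q \<le> p" unfolding q_def by (metis add_diff_cancel_right' diff_le_mono div_le_dividend)
    have "\<eta> p \<le> \<eta> (m * Suc q - 1)" by (rule c0_star_antimono[OF \<eta>]) fact
    ultimately have "real (Suc p) * \<eta> p \<le> (2 * real m * real (Suc q)) * \<eta> (m * Suc q - 1)"
      using c0_star_nonneg[OF \<eta>] by (intro mult_mono) auto
    also have "\<dots> = 2 * real m * (real (Suc q) * \<eta> (m * Suc q - 1))" by (simp only: mult.assoc)
    also have "\<dots> \<le> 2 * real m * (2 * lower_inf \<eta> q)"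
      using sparse[of q] by (intro mult_left_mono) auto
    also have "\<dots> \<le> D * lower_inf \<eta> p"
    proof -
      have "4 * real m * lower_inf \<eta> q \<le> D * lower_inf \<eta> p"
        using D(1) monoD[OF mono_lower_inf[OF \<eta>] \<open>q \<le> p\<close>] lpos[of q] by (intro mult_mono) (auto intro: order_trans[of _ "4 * real m"])
      then show ?thesis by simp
    qed
    finally show ?thesis by (simp add: lower_env_def field_simps)
  qed
  have "0 \<le> D" using D(1) by (rule order_trans[rotated]) simp
  have "arith_mean \<eta> n \<le> (D * \<bar>C\<bar>) * \<eta> n" for n
  proof -
    have "arith_mean \<eta> n \<le> D * arith_mean (lower_env \<eta>) n" by (rule arith_mean_mono) (rule lower)
    also have "\<dots> \<le> D * (\<bar>C\<bar> * \<eta> n)"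
    proof (rule mult_left_mono[OF _ \<open>0 \<le> D\<close>])
      have "C * lower_env \<eta> n \<le> \<bar>C\<bar> * \<eta> n"
        using lower_env_le[OF \<eta>] c0_star_nonneg[OF lower_env_c0_star[OF \<eta>]] by (intro mult_mono) auto
      then show "arith_mean (lower_env \<eta>) n \<le> \<bar>C\<bar> * \<eta> n" using C[of n] by simp
    qed
    finally show ?thesis by simp
  qed
  then show ?thesis unfolding regular_def by blast
qed

subsection \<open>Splitting a majorised sequence\<close>

text \<open>\<zeta> takes at n the value of \<xi> at the first point of \<open>A\<close> not before
  n, which is the least nonnegative nonincreasing sequence lying above \<xi> on \<open>A\<close>.
  Majorisation known on \<open>A\<close> alone then extends to all indices.\<close>

lemma decreasing_interpolation:
  assumes \<xi>: "\<xi> \<in> c0_star" and \<eta>: "\<eta> \<in> c0_star"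
    and A: "\<And>n. n \<in> A \<Longrightarrow> arith_mean \<xi> n \<le> C * arith_mean \<eta> n" and C: "0 \<le> C"
  obtains \<zeta> where "\<zeta> \<in> c0_star" "\<And>n. n \<in> A \<Longrightarrow> \<xi> n \<le> \<zeta> n" "\<And>n. arith_mean \<zeta> n \<le> C * arith_mean \<eta> n"
proof -
  define nxt where "nxt n = (LEAST k. n \<le> k \<and> k \<in> A)" for n
  \<comment> \<open>The value 0 applies beyond the last point of a finite \<open>A\<close>, where
    \<open>nxt\<close> has no meaning.\<close>
  define \<zeta> where "\<zeta> n = (if \<exists>k. n \<le> k \<and> k \<in> A then \<xi> (nxt n) else 0)" for n
  have nxt: "n \<le> nxt n" "nxt n \<in> A" if "\<exists>k. n \<le> k \<and> k \<in> A" for n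
    using LeastI_ex[OF that] unfolding nxt_def by auto
  have nxt_least: "nxt n \<le> k" if "n \<le> k" "k \<in> A" for n k
    using that unfolding nxt_def by (intro Least_le) simp
  have nxt_same: "nxt j = nxt n" "\<exists>k. j \<le> k \<and> k \<in> A" if "\<exists>k. n \<le> k \<and> k \<in> A" "n \<le> j" "j \<le> nxt n" for j n
  proof -
    show *: "\<exists>k. j \<le> k \<and> k \<in> A" using that nxt[OF that(1)] by blast
    show "nxt j = nxt n"
      using nxt_least[of j "nxt n"] nxt_least[of n "nxt j"] nxt[OF that(1)] nxt[OF *] that by force
  qed
  have \<zeta>_nonneg: "0 \<le> \<zeta> n" for n using c0_star_nonneg[OF \<xi>] by (simp add: \<zeta>_def)
  have \<zeta>_le: "\<zeta> n \<le> \<xi> n" for n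
    using nxt[of n] c0_star_antimono[OF \<xi>] c0_star_nonneg[OF \<xi>] by (simp add: \<zeta>_def)
  have "\<zeta> \<in> c0_star"
  proof (rule c0_starI[OF \<zeta>_nonneg])
    show "\<zeta> (Suc n) \<le> \<zeta> n" for n
    proof (cases "\<exists>k. Suc n \<le> k \<and> k \<in> A")
      case True
      then have ex: "\<exists>k. n \<le> k \<and> k \<in> A" by (meson Suc_leD)
      have "nxt n \<le> nxt (Suc n)" using nxt[OF True] by (intro nxt_least) auto
      then show ?thesis using True ex c0_star_antimono[OF \<xi>] by (simp add: \<zeta>_def)
    next
      case False
      then have "\<zeta> (Suc n) = 0" unfolding \<zeta>_def by (rule if_not_P)
      then show ?thesis using \<zeta>_nonneg by simp
    qed
    show "\<zeta> \<longlonglongrightarrow> 0"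
      by (rule tendsto_sandwich[OF always_eventually always_eventually tendsto_const c0_star_tendsto[OF \<xi>]])
         (use \<zeta>_nonneg \<zeta>_le in blast)+
  qed
  have \<zeta>_A: "\<zeta> n = \<xi> n" if "n \<in> A" for n
  proof -
    have ex: "\<exists>k. n \<le> k \<and> k \<in> A" using that by blast
    have "nxt n = n" using nxt_least[OF order_refl that] nxt(1)[OF ex] by simp
    then show ?thesis using ex by (simp add: \<zeta>_def)
  qed
  define P where "P \<alpha> n = (\<Sum>j\<le>n. \<alpha> j)" for \<alpha> :: "nat \<Rightarrow> real" and n
  have PA: "P \<zeta> n \<le> C * P \<eta> n" if "n \<in> A" for n
  proof -
    have "P \<zeta> n \<le> P \<xi> n" unfolding P_def by (intro sum_mono \<zeta>_le)
    also have "\<dots> \<le> C * P \<eta> n"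
      using A[OF that] unfolding arith_mean_def P_def quotient_le_iff .
    finally show ?thesis .
  qed
  \<comment> \<open>At a least violation the plateau of \<open>\<zeta>\<close> exceeds \<open>C * \<eta>\<close>, so the violation would
    persist up to the next point of \<open>A\<close>.\<close>
  have P: "P \<zeta> n \<le> C * P \<eta> n" for n
  proof (induction n rule: less_induct)
    case (less n)
    show ?case
    proof (rule ccontr)
      assume bad: "\<not> P \<zeta> n \<le> C * P \<eta> n"
      have gt: "C * \<eta> n < \<zeta> n"
      proof (cases n)
        case 0
        then show ?thesis using bad by (simp add: P_def)
      next
        case (Suc k)
        then show ?thesis using bad less.IH[of k] by (simp add: P_def algebra_simps)
      qed
      moreover have "0 \<le> C * \<eta> n" using C c0_star_nonneg[OF \<eta>] by simp
      ultimately have "\<zeta> n \<noteq> 0" by simp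
      then have ex: "\<exists>k. n \<le> k \<and> k \<in> A" unfolding \<zeta>_def by meson
      have "j \<le> nxt n \<longrightarrow> C * P \<eta> j < P \<zeta> j" if "n \<le> j" for j
        using that
      proof (induction j rule: dec_induct)
        case base
        then show ?case using bad by simp
      next
        case (step j)
        show ?case
        proof
          assume j: "Suc j \<le> nxt n"
          have "\<zeta> (Suc j) = \<zeta> n"
            using nxt_same[OF ex _ j] step(1) ex by (simp add: \<zeta>_def)
          moreover have "C * \<eta> (Suc j) \<le> C * \<eta> n"
            using step(1) C by (intro mult_left_mono c0_star_antimono[OF \<eta>]) auto
          ultimately have "C * \<eta> (Suc j) < \<zeta> (Suc j)" using gt by simp
          moreover have "C * P \<eta> j < P \<zeta> j" using step j by simp
          ultimately show "C * P \<eta> (Suc j) < P \<zeta> (Suc j)" by (simp add: P_def distrib_left)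
        qed
      qed
      from this[OF nxt(1)[OF ex]] PA[OF nxt(2)[OF ex]] show False by simp
    qed
  qed
  have "arith_mean \<zeta> n \<le> C * arith_mean \<eta> n" for n
    using P[of n] unfolding arith_mean_def P_def quotient_le_iff .
  with \<open>\<zeta> \<in> c0_star\<close> \<zeta>_A that show ?thesis by simp
qed

text \<open>At each index one of the two means is the larger, and twice it bounds the sum.
  Interpolating \<xi> from either set of indices gives two sequences, one of which lies above \<xi>
  at every index.\<close>

lemma majorised_sum_split:
  assumes \<xi>: "\<xi> \<in> c0_star" and \<eta>: "\<eta> \<in> c0_star" and \<zeta>: "\<zeta> \<in> c0_star" and C: "0 \<le> C"
    and le: "\<And>n. arith_mean \<xi> n \<le> C * (arith_mean \<eta> n + arith_mean \<zeta> n)"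
  obtains \<xi>1 \<xi>2 where "\<xi>1 \<in> c0_star" "\<xi>2 \<in> c0_star" "\<And>n. \<xi> n \<le> \<xi>1 n + \<xi>2 n"
    "\<And>n. arith_mean \<xi>1 n \<le> (2 * C) * arith_mean \<eta> n" "\<And>n. arith_mean \<xi>2 n \<le> (2 * C) * arith_mean \<zeta> n"
proof -
  define A where "A = {n. arith_mean \<zeta> n \<le> arith_mean \<eta> n}"
  have "arith_mean \<xi> n \<le> (2 * C) * arith_mean \<eta> n" if "n \<in> A" for n
  proof -
    have "C * (arith_mean \<eta> n + arith_mean \<zeta> n) \<le> C * (2 * arith_mean \<eta> n)"
      using that C by (intro mult_left_mono) (auto simp: A_def)
    then show ?thesis using le[of n] by simp
  qed
  from decreasing_interpolation[OF \<xi> \<eta> this]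
  obtain \<xi>1 where 1: "\<xi>1 \<in> c0_star" "\<And>n. n \<in> A \<Longrightarrow> \<xi> n \<le> \<xi>1 n" "\<And>n. arith_mean \<xi>1 n \<le> (2 * C) * arith_mean \<eta> n"
    using C by (metis mult_nonneg_nonneg zero_le_numeral)
  have "arith_mean \<xi> n \<le> (2 * C) * arith_mean \<zeta> n" if "n \<in> - A" for n
  proof -
    have "C * (arith_mean \<eta> n + arith_mean \<zeta> n) \<le> C * (2 * arith_mean \<zeta> n)"
      using that C by (intro mult_left_mono) (auto simp: A_def)
    then show ?thesis using le[of n] by simp
  qed
  from decreasing_interpolation[OF \<xi> \<zeta> this]
  obtain \<xi>2 where 2: "\<xi>2 \<in> c0_star" "\<And>n. n \<in> - A \<Longrightarrow> \<xi> n \<le> \<xi>2 n" "\<And>n. arith_mean \<xi>2 n \<le> (2 * C) * arith_mean \<zeta> n"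
    using C by (metis mult_nonneg_nonneg zero_le_numeral)
  have "\<xi> n \<le> \<xi>1 n + \<xi>2 n" for n
    using 1(2)[of n] 2(2)[of n] c0_star_nonneg[OF 1(1), of n] c0_star_nonneg[OF 2(1), of n]
    by (cases "n \<in> A") auto
  with 1 2 show ?thesis using that by blast
qed

subsection \<open>Arithmetic mean operations on characteristic sets\<close>

definition pre_am_set :: "(nat \<Rightarrow> real) set \<Rightarrow> (nat \<Rightarrow> real) set" where
  "pre_am_set S = {\<xi> \<in> c0_star. arith_mean \<xi> \<in> S}"

definition am_set :: "(nat \<Rightarrow> real) set \<Rightarrow> (nat \<Rightarrow> real) set" where
  "am_set S = {\<xi> \<in> c0_star. \<exists>\<eta>\<in>S. \<exists>C. \<forall>n. \<xi> n \<le> C * arith_mean \<eta> n}"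

text \<open>An am-closed set containing \<eta> contains every sequence whose mean is O of the mean
  of \<eta>. Requiring all of these to lie in \<open>S\<close> is therefore necessary, and the
  resulting set proves to be am-closed itself.\<close>

definition am_closed_core :: "(nat \<Rightarrow> real) set \<Rightarrow> (nat \<Rightarrow> real) set" where
  "am_closed_core S = {\<eta> \<in> S. \<forall>\<xi>\<in>c0_star. \<forall>C. (\<forall>n. arith_mean \<xi> n \<le> C * arith_mean \<eta> n) \<longrightarrow> \<xi> \<in> S}"

definition am_open_hull :: "(nat \<Rightarrow> real) set \<Rightarrow> (nat \<Rightarrow> real) set" where
  "am_open_hull S = {\<xi> \<in> c0_star. \<exists>\<eta>\<in>S. \<exists>C. \<forall>n. \<xi> n \<le> C * upper_env \<eta> n}"

text \<open>Only one inclusion is recorded; the other is automatic because a sequence lies below its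
  mean.\<close>

definition stable_set :: "(nat \<Rightarrow> real) set \<Rightarrow> bool" where
  "stable_set S \<longleftrightarrow> (\<forall>\<xi>\<in>S. arith_mean \<xi> \<in> S)"

lemma mult_le_abs_mult:
  fixes x y :: real
  assumes "x \<le> C * y" "0 \<le> y" shows "x \<le> \<bar>C\<bar> * y"
  using assms(1) mult_right_mono[OF abs_ge_self[of C] assms(2)] by simp

text \<open>Common ground of \<open>am_set\<close> and \<open>am_open_hull\<close>, with \<Phi> the
  mean or the upper envelope. Two bounds are merged by passing to the sum of the generators;
  \<open>div\<close> provides the closure under ampliation.\<close>

lemma dominated_set_char_cone:
  fixes \<Phi> :: "(nat \<Rightarrow> real) \<Rightarrow> nat \<Rightarrow> real"
  assumes S: "char_cone S"
    and c0: "\<And>\<eta>. \<eta> \<in> c0_star \<Longrightarrow> \<Phi> \<eta> \<in> c0_star"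
    and mono: "\<And>\<xi> \<eta> C n. 0 \<le> C \<Longrightarrow> (\<And>n. \<xi> n \<le> C * \<eta> n) \<Longrightarrow> \<Phi> \<xi> n \<le> C * \<Phi> \<eta> n"
    and div: "\<And>\<eta> m n. \<eta> \<in> c0_star \<Longrightarrow> 0 < m \<Longrightarrow> \<Phi> \<eta> (n div m) \<le> real m * \<Phi> \<eta> n"
  shows "char_cone {\<xi> \<in> c0_star. \<exists>\<eta>\<in>S. \<exists>C. \<forall>n. \<xi> n \<le> C * \<Phi> \<eta> n}" (is "char_cone ?T")
  unfolding char_cone_def
proof (intro conjI ballI allI impI)
  have nn: "0 \<le> \<Phi> \<eta> n" if "\<eta> \<in> S" for \<eta> n
    using c0[OF char_cone_c0_star[OF S that]] by (rule c0_star_nonneg)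
  show "(\<lambda>_. 0) \<in> ?T" using c0_star_zero char_cone_zero[OF S] by (auto intro!: bexI[of _ "\<lambda>_. 0"] exI[of _ 0])
  fix \<xi> assume "\<xi> \<in> ?T"
  then obtain \<eta> C where \<xi>: "\<xi> \<in> c0_star" "\<eta> \<in> S" "\<And>n. \<xi> n \<le> C * \<Phi> \<eta> n" by blast
  note \<eta> = char_cone_c0_star[OF S \<xi>(2)]
  have C: "\<xi> n \<le> \<bar>C\<bar> * \<Phi> \<eta> n" for n by (rule mult_le_abs_mult[OF \<xi>(3) nn[OF \<xi>(2)]])
  {
    fix \<zeta> assume "\<zeta> \<in> ?T"
    then obtain \<eta>' D where \<zeta>: "\<zeta> \<in> c0_star" "\<eta>' \<in> S" "\<And>n. \<zeta> n \<le> D * \<Phi> \<eta>' n" by blast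
    note \<eta>' = char_cone_c0_star[OF S \<zeta>(2)]
    have D: "\<zeta> n \<le> \<bar>D\<bar> * \<Phi> \<eta>' n" for n by (rule mult_le_abs_mult[OF \<zeta>(3) nn[OF \<zeta>(2)]])
    let ?s = "\<lambda>n. \<eta> n + \<eta>' n"
    have s: "?s \<in> S" by (rule char_cone_add[OF S \<xi>(2) \<zeta>(2)])
    have "\<Phi> \<eta> n \<le> \<Phi> ?s n" "\<Phi> \<eta>' n \<le> \<Phi> ?s n" for n
      using mono[of 1 \<eta> ?s n] mono[of 1 \<eta>' ?s n] c0_star_nonneg[OF \<eta>] c0_star_nonneg[OF \<eta>'] by simp_all
    then have "\<bar>C\<bar> * \<Phi> \<eta> n \<le> \<bar>C\<bar> * \<Phi> ?s n" "\<bar>D\<bar> * \<Phi> \<eta>' n \<le> \<bar>D\<bar> * \<Phi> ?s n" for n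
      by (simp_all add: mult_left_mono)
    then have "\<xi> n + \<zeta> n \<le> (\<bar>C\<bar> + \<bar>D\<bar>) * \<Phi> ?s n" for n
      unfolding distrib_right using C D by (meson add_mono order_trans)
    with s c0_star_add[OF \<xi>(1) \<zeta>(1)] show "(\<lambda>n. \<xi> n + \<zeta> n) \<in> ?T" by blast
  }
  {
    fix \<zeta> D assume \<zeta>: "\<zeta> \<in> c0_star" "\<forall>n. \<zeta> n \<le> D * \<xi> n"
    have "\<zeta> n \<le> (\<bar>D\<bar> * C) * \<Phi> \<eta> n" for n
    proof -
      have "\<zeta> n \<le> \<bar>D\<bar> * \<xi> n" by (rule mult_le_abs_mult[OF spec[OF \<zeta>(2)] c0_star_nonneg[OF \<xi>(1)]])
      also have "\<dots> \<le> \<bar>D\<bar> * (C * \<Phi> \<eta> n)" by (intro mult_left_mono \<xi>(3)) simp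
      finally show ?thesis by simp
    qed
    with \<zeta>(1) \<xi>(2) show "\<zeta> \<in> ?T" by blast
  }
  have "\<xi> (n div 2) \<le> (\<bar>C\<bar> * 2) * \<Phi> \<eta> n" for n
  proof -
    have "\<xi> (n div 2) \<le> \<bar>C\<bar> * \<Phi> \<eta> (n div 2)" by (rule C)
    also have "\<dots> \<le> \<bar>C\<bar> * (real 2 * \<Phi> \<eta> n)" by (intro mult_left_mono div[OF \<eta>]) simp_all
    finally show ?thesis by simp
  qed
  with c0_star_ampliation[OF \<xi>(1), of 2] \<xi>(2) show "(\<lambda>n. \<xi> (n div 2)) \<in> ?T" by auto
qed auto

context
  fixes S :: "(nat \<Rightarrow> real) set"
  assumes S: "char_cone S"
begin

lemma char_cone_am_set: "char_cone (am_set S)"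
  unfolding am_set_def
  by (rule dominated_set_char_cone[OF S arith_mean_c0_star arith_mean_mono arith_mean_div])

lemma char_cone_am_open_hull: "char_cone (am_open_hull S)"
  unfolding am_open_hull_def
  by (rule dominated_set_char_cone[OF S upper_env_c0_star upper_env_mono upper_env_div])

lemma char_cone_pre_am_set: "char_cone (pre_am_set S)"
  unfolding char_cone_def
proof (intro conjI ballI allI impI)
  show "(\<lambda>_. 0) \<in> pre_am_set S"
    using c0_star_zero char_cone_zero[OF S] by (simp add: pre_am_set_def arith_mean_zero)
  fix \<xi> assume "\<xi> \<in> pre_am_set S"
  then have \<xi>: "\<xi> \<in> c0_star" "arith_mean \<xi> \<in> S" by (auto simp: pre_am_set_def)
  {
    fix \<eta> assume "\<eta> \<in> pre_am_set S"
    then show "(\<lambda>n. \<xi> n + \<eta> n) \<in> pre_am_set S"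
      using \<xi> char_cone_add[OF S] by (simp add: pre_am_set_def c0_star_add arith_mean_add)
  next
    fix \<eta> C assume \<eta>: "\<eta> \<in> c0_star" "\<forall>n. \<eta> n \<le> C * \<xi> n"
    from char_cone_le[OF S \<xi>(2) arith_mean_c0_star[OF \<eta>(1)] arith_mean_mono] \<eta>
    show "\<eta> \<in> pre_am_set S" unfolding pre_am_set_def by blast
  }
  have 2: "(\<lambda>n. \<xi> (n div 2)) \<in> c0_star" by (rule c0_star_ampliation[OF \<xi>(1)]) simp
  from char_cone_le[OF S \<xi>(2) arith_mean_c0_star[OF 2] arith_mean_ampliation[OF \<xi>(1)]] 2
  show "(\<lambda>n. \<xi> (n div 2)) \<in> pre_am_set S" unfolding pre_am_set_def by simp
qed (auto simp: pre_am_set_def)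

lemma pre_am_set_subset: "pre_am_set S \<subseteq> S"
proof
  fix \<xi> assume "\<xi> \<in> pre_am_set S"
  then have \<xi>: "\<xi> \<in> c0_star" "arith_mean \<xi> \<in> S" by (auto simp: pre_am_set_def)
  from char_cone_le[OF S \<xi>(2,1), of 1] show "\<xi> \<in> S" using le_arith_mean[OF \<xi>(1)] by simp
qed

lemma subset_am_set: "S \<subseteq> am_set S"
proof
  fix \<xi> assume "\<xi> \<in> S"
  moreover have "\<xi> n \<le> 1 * arith_mean \<xi> n" for n
    using le_arith_mean[OF char_cone_c0_star[OF S \<open>\<xi> \<in> S\<close>]] by simp
  ultimately show "\<xi> \<in> am_set S" using char_cone_c0_star[OF S] unfolding am_set_def by blast
qed

lemma arith_mean_mem_am_set: "\<xi> \<in> S \<Longrightarrow> arith_mean \<xi> \<in> am_set S"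
  unfolding am_set_def using char_cone_c0_star[OF S] arith_mean_c0_star
  by (intro CollectI conjI bexI[of _ \<xi>] exI[of _ 1]) auto

text \<open>Together with the next inclusion this is the Galois connection between
  \<open>am_set\<close> and \<open>pre_am_set\<close>.\<close>

lemma am_set_pre_am_set_subset: "am_set (pre_am_set S) \<subseteq> S"
  unfolding am_set_def pre_am_set_def using char_cone_le[OF S] by blast

lemma subset_pre_am_set_am_set: "S \<subseteq> pre_am_set (am_set S)"
  using arith_mean_mem_am_set char_cone_c0_star[OF S] by (auto simp: pre_am_set_def)

lemma stable_set_iff: "stable_set S \<longleftrightarrow> S = pre_am_set S"
  using pre_am_set_subset char_cone_c0_star[OF S] by (auto simp: stable_set_def pre_am_set_def)

lemma am_closed_core_mono:
  assumes \<eta>: "\<eta> \<in> am_closed_core S" and \<xi>: "\<xi> \<in> c0_star" and le: "\<And>n. arith_mean \<xi> n \<le> C * arith_mean \<eta> n"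
  shows "\<xi> \<in> am_closed_core S"
  unfolding am_closed_core_def
proof (intro CollectI conjI ballI allI impI)
  show "\<xi> \<in> S" using \<eta> \<xi> le unfolding am_closed_core_def by blast
  fix \<zeta> D assume \<zeta>: "\<zeta> \<in> c0_star" "\<forall>n. arith_mean \<zeta> n \<le> D * arith_mean \<xi> n"
  have "arith_mean \<zeta> n \<le> (\<bar>D\<bar> * C) * arith_mean \<eta> n" for n
  proof -
    have "arith_mean \<zeta> n \<le> \<bar>D\<bar> * arith_mean \<xi> n"
      by (rule mult_le_abs_mult[OF spec[OF \<zeta>(2)] arith_mean_nonneg[OF \<xi>]])
    also have "\<dots> \<le> \<bar>D\<bar> * (C * arith_mean \<eta> n)" by (intro mult_left_mono le) simp
    finally show ?thesis by simp
  qed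
  then show "\<zeta> \<in> S" using \<eta> \<zeta>(1) unfolding am_closed_core_def by blast
qed

text \<open>Additivity is the substantial property: a sequence majorised by a sum is bounded by two
  pieces, each majorised by one summand, so each piece lies in \<open>S\<close>.\<close>

lemma char_cone_am_closed_core: "char_cone (am_closed_core S)"
  unfolding char_cone_def
proof (intro conjI ballI allI impI)
  show "am_closed_core S \<subseteq> c0_star" using char_cone_c0_star[OF S] by (auto simp: am_closed_core_def)
  show "(\<lambda>_. 0) \<in> am_closed_core S"
    unfolding am_closed_core_def
  proof (intro CollectI conjI ballI allI impI char_cone_zero[OF S])
    fix \<xi> C assume \<xi>: "\<xi> \<in> c0_star" "\<forall>n. arith_mean \<xi> n \<le> C * arith_mean (\<lambda>_. 0) n"
    have "\<xi> n \<le> 0 * 0" for n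
      using le_arith_mean[OF \<xi>(1), of n] spec[OF \<xi>(2), of n] by (simp add: arith_mean_zero)
    then show "\<xi> \<in> S" using char_cone_le[OF S char_cone_zero[OF S] \<xi>(1), of 0] by simp
  qed
  fix \<xi> assume \<xi>: "\<xi> \<in> am_closed_core S"
  have \<xi>': "\<xi> \<in> c0_star" using \<xi> char_cone_c0_star[OF S] by (auto simp: am_closed_core_def)
  {
    fix \<eta> assume \<eta>: "\<eta> \<in> am_closed_core S"
    have \<eta>': "\<eta> \<in> c0_star" using \<eta> char_cone_c0_star[OF S] by (auto simp: am_closed_core_def)
    show "(\<lambda>n. \<xi> n + \<eta> n) \<in> am_closed_core S"
      unfolding am_closed_core_def
    proof (intro CollectI conjI ballI allI impI)
      show "(\<lambda>n. \<xi> n + \<eta> n) \<in> S"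
        using \<xi> \<eta> char_cone_add[OF S] by (simp add: am_closed_core_def)
      fix \<zeta> C assume \<zeta>: "\<zeta> \<in> c0_star" "\<forall>n. arith_mean \<zeta> n \<le> C * arith_mean (\<lambda>n. \<xi> n + \<eta> n) n"
      have "arith_mean \<zeta> n \<le> \<bar>C\<bar> * (arith_mean \<xi> n + arith_mean \<eta> n)" for n
        using spec[OF \<zeta>(2), of n] arith_mean_nonneg[OF \<xi>', of n] arith_mean_nonneg[OF \<eta>', of n]
        by (intro mult_le_abs_mult) (simp_all add: arith_mean_add)
      then obtain \<zeta>1 \<zeta>2 where z: "\<zeta>1 \<in> c0_star" "\<zeta>2 \<in> c0_star" "\<And>n. \<zeta> n \<le> \<zeta>1 n + \<zeta>2 n"
        "\<And>n. arith_mean \<zeta>1 n \<le> (2 * \<bar>C\<bar>) * arith_mean \<xi> n" "\<And>n. arith_mean \<zeta>2 n \<le> (2 * \<bar>C\<bar>) * arith_mean \<eta> n"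
        using majorised_sum_split[OF \<zeta>(1) \<xi>' \<eta>' abs_ge_zero[of C]] by metis
      have "\<zeta>1 \<in> S" "\<zeta>2 \<in> S"
        using \<xi> \<eta> z(1,2,4,5) unfolding am_closed_core_def by blast+
      from char_cone_le[OF S char_cone_add[OF S this] \<zeta>(1), of 1] z(3) show "\<zeta> \<in> S" by simp
    qed
  next
    fix \<eta> C assume "\<eta> \<in> c0_star" "\<forall>n. \<eta> n \<le> C * \<xi> n"
    then show "\<eta> \<in> am_closed_core S"
      using am_closed_core_mono[OF \<xi>] arith_mean_mono[of \<eta> C \<xi>] by blast
  }
  show "(\<lambda>n. \<xi> (n div 2)) \<in> am_closed_core S"
    by (rule am_closed_core_mono[OF \<xi> c0_star_ampliation[OF \<xi>'] arith_mean_ampliation[OF \<xi>']]) simp_all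
qed

end

lemma am_closed_core_subset: "am_closed_core S \<subseteq> S"
  by (auto simp: am_closed_core_def)

lemma am_closed_core_closed:
  assumes S: "char_cone S" shows "am_closed_core S = pre_am_set (am_set (am_closed_core S))"
proof
  show "pre_am_set (am_set (am_closed_core S)) \<subseteq> am_closed_core S"
    using am_closed_core_mono[OF S] unfolding pre_am_set_def am_set_def by blast
qed (rule subset_pre_am_set_am_set[OF char_cone_am_closed_core[OF S]])

lemma subset_am_closed_core:
  assumes S: "char_cone S" and T: "char_cone T" "T = pre_am_set (am_set T)" "T \<subseteq> S"
  shows "T \<subseteq> am_closed_core S"
proof
  fix \<eta> assume \<eta>: "\<eta> \<in> T"
  show "\<eta> \<in> am_closed_core S"
    unfolding am_closed_core_def
  proof (intro CollectI conjI ballI allI impI)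
    show "\<eta> \<in> S" using \<eta> T(3) by blast
    fix \<xi> C assume \<xi>: "\<xi> \<in> c0_star" "\<forall>n. arith_mean \<xi> n \<le> C * arith_mean \<eta> n"
    then have "\<xi> \<in> pre_am_set (am_set T)"
      using \<eta> arith_mean_c0_star unfolding pre_am_set_def am_set_def by blast
    then show "\<xi> \<in> S" using T(2,3) by blast
  qed
qed

lemma subset_am_open_hull:
  assumes S: "char_cone S" shows "S \<subseteq> am_open_hull S"
proof
  fix \<xi> assume "\<xi> \<in> S"
  moreover have "\<xi> n \<le> 1 * upper_env \<xi> n" for n using upper_env_ge by simp
  ultimately show "\<xi> \<in> am_open_hull S" using char_cone_c0_star[OF S] unfolding am_open_hull_def by blast
qed

lemma upper_env_mem_am_open_hull:
  assumes S: "char_cone S" and \<eta>: "\<eta> \<in> S" shows "upper_env \<eta> \<in> am_open_hull S"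
proof -
  have "upper_env \<eta> n \<le> 1 * upper_env \<eta> n" for n by simp
  with upper_env_c0_star[OF char_cone_c0_star[OF S \<eta>]] \<eta> show ?thesis unfolding am_open_hull_def by blast
qed

text \<open>An upper envelope need not be an arithmetic mean, since its numerators need not be
  concave. The sequence \<kappa>, whose mean agrees with it up to the factor 2, provides the
  required member of \<open>pre_am_set\<close>.\<close>

lemma am_open_hull_open:
  assumes S: "char_cone S" shows "am_open_hull S = am_set (pre_am_set (am_open_hull S))"
proof
  note H = char_cone_am_open_hull[OF S]
  show "am_open_hull S \<subseteq> am_set (pre_am_set (am_open_hull S))"
  proof
    fix \<xi> assume "\<xi> \<in> am_open_hull S"
    then obtain \<eta> C where \<xi>: "\<xi> \<in> c0_star" "\<eta> \<in> S" "\<And>n. \<xi> n \<le> C * upper_env \<eta> n"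
      unfolding am_open_hull_def by blast
    note \<eta> = char_cone_c0_star[OF S \<xi>(2)]
    obtain \<kappa> where \<kappa>: "\<kappa> \<in> c0_star" "\<And>n. upper_env \<eta> n \<le> arith_mean \<kappa> n" "\<And>n. arith_mean \<kappa> n \<le> 2 * upper_env \<eta> n"
      using quasi_concave_arith_mean[OF mono_upper_max] upper_env_c0_star[OF \<eta>] unfolding upper_env_def by blast
    have "arith_mean \<kappa> \<in> am_open_hull S"
      using char_cone_le[OF H upper_env_mem_am_open_hull[OF S \<xi>(2)] arith_mean_c0_star[OF \<kappa>(1)] \<kappa>(3)] .
    then have "\<kappa> \<in> pre_am_set (am_open_hull S)" using \<kappa>(1) by (simp add: pre_am_set_def)
    moreover have "\<xi> n \<le> \<bar>C\<bar> * arith_mean \<kappa> n" for n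
    proof -
      have "\<xi> n \<le> \<bar>C\<bar> * upper_env \<eta> n"
        by (rule mult_le_abs_mult[OF \<xi>(3) c0_star_nonneg[OF upper_env_c0_star[OF \<eta>]]])
      also have "\<dots> \<le> \<bar>C\<bar> * arith_mean \<kappa> n" by (intro mult_left_mono \<kappa>(2)) simp
      finally show ?thesis .
    qed
    ultimately show "\<xi> \<in> am_set (pre_am_set (am_open_hull S))"
      using \<xi>(1) unfolding am_set_def by blast
  qed
qed (rule am_set_pre_am_set_subset[OF char_cone_am_open_hull[OF S]])

lemma am_open_hull_subset:
  assumes S: "char_cone S" and T: "char_cone T" "T = am_set (pre_am_set T)" "S \<subseteq> T"
  shows "am_open_hull S \<subseteq> T"
proof
  fix \<xi> assume "\<xi> \<in> am_open_hull S"
  then obtain \<eta> C where \<xi>: "\<xi> \<in> c0_star" "\<eta> \<in> S" "\<And>n. \<xi> n \<le> C * upper_env \<eta> n"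
    unfolding am_open_hull_def by blast
  note \<eta> = char_cone_c0_star[OF S \<xi>(2)]
  have "\<eta> \<in> am_set (pre_am_set T)" using \<xi>(2) T(2,3) by blast
  then obtain \<kappa> D where \<kappa>: "\<kappa> \<in> c0_star" "arith_mean \<kappa> \<in> T" "\<And>n. \<eta> n \<le> D * arith_mean \<kappa> n"
    unfolding am_set_def pre_am_set_def by blast
  have "upper_env \<eta> n \<le> \<bar>D\<bar> * arith_mean \<kappa> n" for n
    by (rule upper_env_le_arith_mean[OF \<eta> \<kappa>(1) mult_le_abs_mult[OF \<kappa>(3) arith_mean_nonneg[OF \<kappa>(1)]]]) simp
  from char_cone_le[OF T(1) \<kappa>(2) upper_env_c0_star[OF \<eta>] this]
  have "upper_env \<eta> \<in> T" .
  from char_cone_le[OF T(1) this \<xi>(1,3)] show "\<xi> \<in> T" .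
qed

text \<open>Source of all forward implications: every derived set equals \<open>S\<close>, the
  interior and the closure by composing the first two equations.\<close>

lemma stable_set_collapse:
  assumes S: "char_cone S" and st: "stable_set S"
  shows "pre_am_set S = S" "am_set S = S" "am_closed_core S = S" "am_open_hull S = S"
proof -
  show p: "pre_am_set S = S" using stable_set_iff[OF S] st by simp
  have "am_set S \<subseteq> S" using am_set_pre_am_set_subset[OF S] by (simp add: p)
  then show a: "am_set S = S" using subset_am_set[OF S] by blast
  show "am_closed_core S = S"
    using am_closed_core_subset subset_am_closed_core[OF S S] by (auto simp: a p)
  show "am_open_hull S = S"
    using subset_am_open_hull[OF S] am_open_hull_subset[OF S S] by (auto simp: a p)
qed

subsection \<open>Principal characteristic sets\<close>

locale principal_set =
  fixes S :: "(nat \<Rightarrow> real) set" and \<eta> :: "nat \<Rightarrow> real"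
  assumes S: "char_cone S" and \<eta>_mem: "\<eta> \<in> S"
    and S_eq: "S = {\<xi> \<in> c0_star. \<exists>C m. 0 < m \<and> (\<forall>n. \<xi> n \<le> C * \<eta> (n div m))}"
begin

lemma \<eta>: "\<eta> \<in> c0_star" by (rule char_cone_c0_star[OF S \<eta>_mem])

lemma dominated:
  assumes "\<xi> \<in> S"
  obtains C m where "0 \<le> C" "0 < m" "\<And>n. \<xi> n \<le> C * \<eta> (n div m)"
proof -
  obtain C m where *: "0 < m" "\<And>n. \<xi> n \<le> C * \<eta> (n div m)" using assms S_eq by blast
  have "\<xi> n \<le> \<bar>C\<bar> * \<eta> (n div m)" for n
    by (rule mult_le_abs_mult[OF *(2) c0_star_nonneg[OF \<eta>]])
  then show ?thesis using that[of "\<bar>C\<bar>" m] *(1) by simp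
qed

lemma stable_if_regular:
  assumes "regular \<eta>" shows "stable_set S"
  unfolding stable_set_def
proof
  fix \<xi> assume \<xi>: "\<xi> \<in> S"
  obtain K where K: "\<And>n. arith_mean \<eta> n \<le> K * \<eta> n" using assms unfolding regular_def by blast
  obtain C m where C: "0 \<le> C" "0 < m" "\<And>n. \<xi> n \<le> C * \<eta> (n div m)" by (rule dominated[OF \<xi>]) blast
  have "arith_mean \<xi> n \<le> (C * real m * K) * \<eta> n" for n
  proof -
    have "arith_mean \<xi> n \<le> C * arith_mean (\<lambda>n. \<eta> (n div m)) n" by (rule arith_mean_mono[OF C(3)])
    also have "\<dots> \<le> C * (real m * arith_mean \<eta> n)"
      by (intro mult_left_mono arith_mean_ampliation[OF \<eta> C(2)] C(1))
    also have "\<dots> \<le> C * (real m * (K * \<eta> n))"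
      using C(1) by (intro mult_left_mono K) auto
    finally show ?thesis by (simp add: mult.assoc)
  qed
  from char_cone_le[OF S \<eta>_mem arith_mean_c0_star[OF char_cone_c0_star[OF S \<xi>]] this]
  show "arith_mean \<xi> \<in> S" .
qed

text \<open>The mean absorbs the ampliation of the generator into the constant, so the single
  sequence \<open>arith_mean \<eta>\<close> dominates.\<close>

lemma am_set_dominated:
  assumes "\<xi> \<in> am_set S" obtains C where "\<And>n. \<xi> n \<le> C * arith_mean \<eta> n"
proof -
  obtain \<zeta> D where \<zeta>: "\<zeta> \<in> S" "\<And>n. \<xi> n \<le> D * arith_mean \<zeta> n" using assms unfolding am_set_def by blast
  obtain C m where C: "0 \<le> C" "0 < m" "\<And>n. \<zeta> n \<le> C * \<eta> (n div m)" by (rule dominated[OF \<zeta>(1)]) blast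
  have "\<xi> n \<le> (\<bar>D\<bar> * (C * real m)) * arith_mean \<eta> n" for n
  proof -
    have "arith_mean \<zeta> n \<le> C * arith_mean (\<lambda>n. \<eta> (n div m)) n" by (rule arith_mean_mono[OF C(3)])
    also have "\<dots> \<le> C * (real m * arith_mean \<eta> n)"
      by (intro mult_left_mono arith_mean_ampliation[OF \<eta> C(2)] C(1))
    finally have "\<bar>D\<bar> * arith_mean \<zeta> n \<le> \<bar>D\<bar> * (C * (real m * arith_mean \<eta> n))" by (rule mult_left_mono) simp
    moreover have "\<xi> n \<le> \<bar>D\<bar> * arith_mean \<zeta> n"
      by (rule mult_le_abs_mult[OF \<zeta>(2) arith_mean_nonneg[OF char_cone_c0_star[OF S \<zeta>(1)]]])
    ultimately show ?thesis by (simp add: mult.assoc)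
  qed
  then show ?thesis by (rule that)
qed

section \<open>Recovering stability from the derived sets\<close>

lemma stable_if_am_set_stable:
  assumes "stable_set (am_set S)" shows "stable_set S"
proof -
  have "arith_mean (arith_mean \<eta>) \<in> am_set S"
    using assms arith_mean_mem_am_set[OF S \<eta>_mem] by (simp add: stable_set_def)
  then have "regular (arith_mean \<eta>)" unfolding regular_def by (rule am_set_dominated) blast
  then show ?thesis by (rule stable_if_regular[OF regular_if_arith_mean_regular[OF \<eta>]])
qed

text \<open>Stability of the closure puts the mean of \<eta> into it, and \<open>pre_am_set\<close>
  supplies the second mean, so the argument for \<open>am_set\<close> applies.\<close>

lemma stable_if_am_closure_stable:
  assumes "stable_set (pre_am_set (am_set S))" shows "stable_set S"
proof -
  have "arith_mean \<eta> \<in> pre_am_set (am_set S)"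
    using assms subset_pre_am_set_am_set[OF S] \<eta>_mem by (auto simp: stable_set_def)
  then have "arith_mean (arith_mean \<eta>) \<in> am_set S" by (simp add: pre_am_set_def)
  then have "regular (arith_mean \<eta>)" unfolding regular_def by (rule am_set_dominated) blast
  then show ?thesis by (rule stable_if_regular[OF regular_if_arith_mean_regular[OF \<eta>]])
qed

lemma stable_if_am_open_hull_stable:
  assumes "stable_set (am_open_hull S)" shows "stable_set S"
proof -
  have "arith_mean (upper_env \<eta>) \<in> am_open_hull S"
    using assms upper_env_mem_am_open_hull[OF S \<eta>_mem] by (simp add: stable_set_def)
  then obtain \<zeta> D where \<zeta>: "\<zeta> \<in> S" "\<And>n. arith_mean (upper_env \<eta>) n \<le> D * upper_env \<zeta> n"
    unfolding am_open_hull_def by blast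
  obtain C m where C: "0 \<le> C" "0 < m" "\<And>n. \<zeta> n \<le> C * \<eta> (n div m)" by (rule dominated[OF \<zeta>(1)]) blast
  have "arith_mean (upper_env \<eta>) n \<le> (\<bar>D\<bar> * (C * real m)) * upper_env \<eta> n" for n
  proof -
    have "upper_env \<zeta> n \<le> C * upper_env (\<lambda>n. \<eta> (n div m)) n" by (rule upper_env_mono[OF C(3,1)])
    also have "\<dots> \<le> C * (real m * upper_env \<eta> n)"
      by (intro mult_left_mono upper_env_ampliation[OF \<eta> C(2)] C(1))
    finally have "\<bar>D\<bar> * upper_env \<zeta> n \<le> \<bar>D\<bar> * (C * (real m * upper_env \<eta> n))" by (rule mult_left_mono) simp
    moreover have "arith_mean (upper_env \<eta>) n \<le> \<bar>D\<bar> * upper_env \<zeta> n"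
      by (rule mult_le_abs_mult[OF \<zeta>(2) c0_star_nonneg[OF upper_env_c0_star[OF char_cone_c0_star[OF S \<zeta>(1)]]]])
    ultimately show ?thesis by (simp add: mult.assoc)
  qed
  then have "regular (upper_env \<eta>)" unfolding regular_def by blast
  then show ?thesis by (rule stable_if_regular[OF regular_if_upper_env_regular[OF \<eta>]])
qed

lemma pre_am_set_dominated:
  assumes "\<kappa> \<in> pre_am_set S"
  obtains C where "0 \<le> C" "\<And>n. arith_mean \<kappa> n \<le> C * lower_env \<eta> n"
proof -
  have \<kappa>: "\<kappa> \<in> c0_star" "arith_mean \<kappa> \<in> S" using assms by (auto simp: pre_am_set_def)
  obtain C m where C: "0 \<le> C" "0 < m" "\<And>n. arith_mean \<kappa> n \<le> C * \<eta> (n div m)"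
    by (rule dominated[OF \<kappa>(2)]) blast
  show ?thesis
    by (rule that[of "C * real m"]) (use C arith_mean_le_lower_env[OF \<eta> \<kappa>(1) C(2,1,3)] in auto)
qed

text \<open>Here the nonzero condition is turned into positivity. Index 0 suffices because
  \<open>lower_inf\<close> is nondecreasing.\<close>

lemma lower_inf_pos:
  assumes "pre_am_set S \<noteq> {\<lambda>_. 0}" shows "0 < lower_inf \<eta> 0"
proof -
  obtain \<kappa> where \<kappa>: "\<kappa> \<in> pre_am_set S" "\<kappa> \<noteq> (\<lambda>_. 0)"
    using assms char_cone_zero[OF char_cone_pre_am_set[OF S]] by blast
  have \<kappa>': "\<kappa> \<in> c0_star" using \<kappa>(1) by (simp add: pre_am_set_def)
  obtain n where "\<kappa> n \<noteq> 0" using \<kappa>(2) by blast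
  then have "0 < \<kappa> 0"
    using c0_star_nonneg[OF \<kappa>', of n] c0_star_antimono[OF \<kappa>', of 0 n] by simp
  obtain C where C: "0 \<le> C" "\<And>n. arith_mean \<kappa> n \<le> C * lower_env \<eta> n"
    by (rule pre_am_set_dominated[OF \<kappa>(1)]) blast
  have "0 < C * lower_inf \<eta> 0"
    using C(2)[of 0] \<open>0 < \<kappa> 0\<close> by (simp add: arith_mean_def lower_env_def)
  then show ?thesis using C(1) lower_inf_nonneg[OF \<eta>, of 0] by (simp add: zero_less_mult_iff)
qed

text \<open>The lower envelope need not be a mean, so an actual member of
  \<open>pre_am_set S\<close> is produced whose mean agrees with it up to the factor 2.\<close>

lemma lower_env_generator:
  obtains \<kappa> where "\<kappa> \<in> pre_am_set S" "\<And>n. lower_env \<eta> n \<le> arith_mean \<kappa> n"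
proof -
  obtain \<kappa> where \<kappa>: "\<kappa> \<in> c0_star" "\<And>n. lower_env \<eta> n \<le> arith_mean \<kappa> n" "\<And>n. arith_mean \<kappa> n \<le> 2 * lower_env \<eta> n"
    using quasi_concave_arith_mean[OF mono_lower_inf[OF \<eta>]] lower_env_c0_star[OF \<eta>] unfolding lower_env_def by blast
  have "arith_mean \<kappa> n \<le> 2 * \<eta> n" for n using \<kappa>(3)[of n] lower_env_le[OF \<eta>, of n] by simp
  from char_cone_le[OF S \<eta>_mem arith_mean_c0_star[OF \<kappa>(1)] this]
  have "\<kappa> \<in> pre_am_set S" using \<kappa>(1) by (simp add: pre_am_set_def)
  then show ?thesis using \<kappa>(2) that by blast
qed

text \<open>Stability applied to \<kappa> bounds its second mean by the lower envelope. As the first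
  mean lies above the envelope, this bounds the mean of the envelope by itself.\<close>

lemma stable_if_pre_am_set_stable:
  assumes nz: "pre_am_set S \<noteq> {\<lambda>_. 0}" and st: "stable_set (pre_am_set S)"
  shows "stable_set S"
proof -
  obtain \<kappa> where \<kappa>: "\<kappa> \<in> pre_am_set S" "\<And>n. lower_env \<eta> n \<le> arith_mean \<kappa> n" by (rule lower_env_generator) blast
  have "arith_mean \<kappa> \<in> pre_am_set S" using st \<kappa>(1) by (simp add: stable_set_def)
  then obtain C where C: "\<And>n. arith_mean (arith_mean \<kappa>) n \<le> C * lower_env \<eta> n"
    by (rule pre_am_set_dominated) blast
  have "arith_mean (lower_env \<eta>) n \<le> C * lower_env \<eta> n" for n
    using arith_mean_mono[of "lower_env \<eta>" 1 "arith_mean \<kappa>" n] \<kappa>(2) C[of n] by simp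
  then have "regular (lower_env \<eta>)" unfolding regular_def by blast
  then show ?thesis by (rule stable_if_regular[OF regular_if_lower_env_regular[OF \<eta> _ lower_inf_pos[OF nz]]])
qed

text \<open>A stable interior contains the means of its members, and these lie in \<open>S\<close>;
  so it is contained in \<open>pre_am_set S\<close>, and the two coincide.\<close>

lemma stable_if_am_interior_stable:
  assumes nz: "am_set (pre_am_set S) \<noteq> {\<lambda>_. 0}" and st: "stable_set (am_set (pre_am_set S))"
  shows "stable_set S"
proof (rule stable_if_pre_am_set_stable)
  note P = char_cone_pre_am_set[OF S]
  note A = char_cone_am_set[OF P]
  have eq: "am_set (pre_am_set S) = pre_am_set S"
  proof
    show "am_set (pre_am_set S) \<subseteq> pre_am_set S"
      using st am_set_pre_am_set_subset[OF S] char_cone_c0_star[OF A]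
      by (auto simp: stable_set_def pre_am_set_def)
  qed (rule subset_am_set[OF P])
  show "pre_am_set S \<noteq> {\<lambda>_. 0}" "stable_set (pre_am_set S)" using nz st unfolding eq .
qed

text \<open>\<open>pre_am_set S\<close> is am-closed and so lies in the core. A stable core contains
  the means of its members and lies in \<open>S\<close>, hence in
  \<open>pre_am_set S\<close>.\<close>

lemma stable_if_am_closed_core_stable:
  assumes nz: "am_closed_core S \<noteq> {\<lambda>_. 0}" and st: "stable_set (am_closed_core S)"
  shows "stable_set S"
proof (rule stable_if_pre_am_set_stable)
  note P = char_cone_pre_am_set[OF S]
  have "pre_am_set S = pre_am_set (am_set (pre_am_set S))"
    using subset_pre_am_set_am_set[OF P] am_set_pre_am_set_subset[OF S] by (auto simp: pre_am_set_def)
  then have "pre_am_set S \<subseteq> am_closed_core S"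
    by (rule subset_am_closed_core[OF S P _ pre_am_set_subset[OF S]])
  moreover have "am_closed_core S \<subseteq> pre_am_set S"
    using st am_closed_core_subset[of S] char_cone_c0_star[OF S] unfolding stable_set_def pre_am_set_def by blast
  ultimately have eq: "am_closed_core S = pre_am_set S" by blast
  show "pre_am_set S \<noteq> {\<lambda>_. 0}" "stable_set (pre_am_set S)" using nz st unfolding eq .
qed

end

subsection \<open>Arithmetic mean ideals\<close>

context
  assumes inf: "infinite_dimensional TYPE('a::complex_hilbert_space)"
begin

lemma pre_am_char_set:
  fixes J :: "('a \<Rightarrow>\<^sub>L 'a) set"
  assumes J: "op_ideal J"
  shows "op_ideal (pre_am J)" "char_set (pre_am J) = pre_am_set (char_set J)"
  using ideal_with_char_set[OF inf char_cone_pre_am_set[OF char_cone_char_set[OF inf J]]]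
  unfolding pre_am_def pre_am_set_def by blast+

lemma am_char_set:
  fixes J :: "('a \<Rightarrow>\<^sub>L 'a) set"
  assumes J: "op_ideal J"
  shows "op_ideal (am J)" "char_set (am J) = am_set (char_set J)"
  using ideal_with_char_set[OF inf char_cone_am_set[OF char_cone_char_set[OF inf J]]]
  unfolding am_def am_set_def by blast+

lemma am_stable_iff:
  fixes J :: "('a \<Rightarrow>\<^sub>L 'a) set"
  assumes J: "op_ideal J" shows "am_stable J \<longleftrightarrow> stable_set (char_set J)"
  unfolding am_stable_def op_ideal_eq_iff[OF inf J pre_am_char_set(1)[OF J]] pre_am_char_set(2)[OF J]
    stable_set_iff[OF char_cone_char_set[OF inf J]] ..

lemma am_closure_char_set:
  fixes J :: "('a \<Rightarrow>\<^sub>L 'a) set"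
  assumes J: "op_ideal J"
  shows "op_ideal (am_closure J)" "char_set (am_closure J) = pre_am_set (am_set (char_set J))"
  using am_char_set[OF J] pre_am_char_set[OF am_char_set(1)[OF J]] by (simp_all add: am_closure_def)

lemma am_interior_char_set:
  fixes J :: "('a \<Rightarrow>\<^sub>L 'a) set"
  assumes J: "op_ideal J"
  shows "op_ideal (am_interior J)" "char_set (am_interior J) = am_set (pre_am_set (char_set J))"
  using pre_am_char_set[OF J] am_char_set[OF pre_am_char_set(1)[OF J]] by (simp_all add: am_interior_def)

lemma am_closed_iff:
  fixes J :: "('a \<Rightarrow>\<^sub>L 'a) set"
  assumes J: "op_ideal J" shows "am_closed J \<longleftrightarrow> char_set J = pre_am_set (am_set (char_set J))"
  unfolding am_closed_def op_ideal_eq_iff[OF inf J am_closure_char_set(1)[OF J]] am_closure_char_set(2)[OF J] ..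

lemma am_open_iff:
  fixes J :: "('a \<Rightarrow>\<^sub>L 'a) set"
  assumes J: "op_ideal J" shows "am_open J \<longleftrightarrow> char_set J = am_set (pre_am_set (char_set J))"
  unfolding am_open_def op_ideal_eq_iff[OF inf J am_interior_char_set(1)[OF J]] am_interior_char_set(2)[OF J] ..

text \<open>The description \<open>GREATEST\<close> has a meaning only if a greatest ideal exists;
  the ideal of the core is shown to be one.\<close>

lemma largest_am_closed_char_set:
  fixes J :: "('a \<Rightarrow>\<^sub>L 'a) set"
  assumes J: "op_ideal J"
  shows "op_ideal (largest_am_closed J)" "char_set (largest_am_closed J) = am_closed_core (char_set J)"
proof -
  let ?S = "char_set J"
  note S = char_cone_char_set[OF inf J]
  define K :: "('a \<Rightarrow>\<^sub>L 'a) set" where "K = ideal_with_char_set (am_closed_core ?S)"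
  have K: "op_ideal K" "char_set K = am_closed_core ?S"
    unfolding K_def by (rule ideal_with_char_set[OF inf char_cone_am_closed_core[OF S]])+
  have "largest_am_closed J = K"
    unfolding largest_am_closed_def
  proof (rule Greatest_equality)
    show "op_ideal K \<and> am_closed K \<and> K \<subseteq> J"
      using K am_closed_iff[OF K(1)] am_closed_core_closed[OF S] op_ideal_subset_iff[OF inf K(1) J]
        am_closed_core_subset[of ?S] by simp
    fix L assume L: "op_ideal L \<and> am_closed L \<and> L \<subseteq> J"
    then have "char_set L \<subseteq> am_closed_core ?S"
      using am_closed_iff[of L] op_ideal_subset_iff[OF inf, of L J] J
      by (intro subset_am_closed_core[OF S char_cone_char_set[OF inf]]) simp_all
    then show "L \<subseteq> K" using L K op_ideal_subset_iff[OF inf, of L K] by simp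
  qed
  with K show "op_ideal (largest_am_closed J)" "char_set (largest_am_closed J) = am_closed_core ?S" by simp_all
qed

lemma smallest_am_open_char_set:
  fixes J :: "('a \<Rightarrow>\<^sub>L 'a) set"
  assumes J: "op_ideal J"
  shows "op_ideal (smallest_am_open J)" "char_set (smallest_am_open J) = am_open_hull (char_set J)"
proof -
  let ?S = "char_set J"
  note S = char_cone_char_set[OF inf J]
  define K :: "('a \<Rightarrow>\<^sub>L 'a) set" where "K = ideal_with_char_set (am_open_hull ?S)"
  have K: "op_ideal K" "char_set K = am_open_hull ?S"
    unfolding K_def by (rule ideal_with_char_set[OF inf char_cone_am_open_hull[OF S]])+
  have "smallest_am_open J = K"
    unfolding smallest_am_open_def
  proof (rule Least_equality)
    show "op_ideal K \<and> am_open K \<and> J \<subseteq> K"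
      using K am_open_iff[OF K(1)] am_open_hull_open[OF S] op_ideal_subset_iff[OF inf J K(1)]
        subset_am_open_hull[OF S] by simp
    fix L assume L: "op_ideal L \<and> am_open L \<and> J \<subseteq> L"
    then have "am_open_hull ?S \<subseteq> char_set L"
      using am_open_iff[of L] op_ideal_subset_iff[OF inf, of J L] J
      by (intro am_open_hull_subset[OF S char_cone_char_set[OF inf]]) simp_all
    then show "K \<subseteq> L" using L K op_ideal_subset_iff[OF inf, of K L] by simp
  qed
  with K show "op_ideal (smallest_am_open J)" "char_set (smallest_am_open J) = am_open_hull ?S" by simp_all
qed

end

theorem theorem5p1:
  fixes I :: "('a::complex_hilbert_space \<Rightarrow>\<^sub>L 'a) set"
  assumes "separable_space_type TYPE('a)"
    and "infinite_dimensional TYPE('a)"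
    and "principal_ideal I"
    and "I \<noteq> {0}"
  shows "(am_stable I \<longleftrightarrow> pre_am I \<noteq> {0} \<and> am_stable (pre_am I))
    \<and> (am_stable I \<longleftrightarrow> am_interior I \<noteq> {0} \<and> am_stable (am_interior I))
    \<and> (am_stable I \<longleftrightarrow> largest_am_closed I \<noteq> {0} \<and> am_stable (largest_am_closed I))
    \<and> (am_stable I \<longleftrightarrow> am_stable (smallest_am_open I))
    \<and> (am_stable I \<longleftrightarrow> am_stable (am I))
    \<and> (am_stable I \<longleftrightarrow> am_stable (am_closure I))"
proof -
  note inf = assms(2)
  let ?S = "char_set I"
  obtain \<eta> where I: "op_ideal I" and \<eta>: "\<eta> \<in> ?S"
    "?S = {\<xi> \<in> c0_star. \<exists>C m. 0 < m \<and> (\<forall>n. \<xi> n \<le> C * \<eta> (n div m))}"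
    by (rule principal_ideal_char_set[OF inf assms(3)])
  note S = char_cone_char_set[OF inf I]
  interpret principal_set ?S \<eta> by unfold_locales (rule S, rule \<eta>, rule \<eta>)
  note pre = pre_am_char_set[OF inf I] and int = am_interior_char_set[OF inf I]
    and large = largest_am_closed_char_set[OF inf I] and small = smallest_am_open_char_set[OF inf I]
    and a = am_char_set[OF inf I] and cl = am_closure_char_set[OF inf I]
  \<comment> \<open>Needed for the forward implications: the derived sets collapse to
    \<open>?S\<close>, which must not be the zero set.\<close>
  have nz: "?S \<noteq> {\<lambda>_. 0}" using assms(4) op_ideal_zero_iff[OF inf I] by simp
  note st = am_stable_iff[OF inf]
  note zero = op_ideal_zero_iff[OF inf]
  note collapse = stable_set_collapse[OF S]
  show ?thesis
    unfolding st[OF I] st[OF pre(1)] st[OF int(1)] st[OF large(1)] st[OF small(1)] st[OF a(1)] st[OF cl(1)]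
      zero[OF pre(1)] zero[OF int(1)] zero[OF large(1)] pre(2) int(2) large(2) small(2) a(2) cl(2)
    using nz collapse stable_if_pre_am_set_stable stable_if_am_interior_stable stable_if_am_closed_core_stable
      stable_if_am_open_hull_stable stable_if_am_set_stable stable_if_am_closure_stable
    by metis
qed

end
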